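(* Let $k$ be an algebraically closed field and let $Q_1$ be the quiver with vertices $b,mid,e$ and arrows $b\to e$, $b\to mid$, $mid\to e$. The exceptional objects of $Rep_k(Q_1)$, up to isomorphism, are the following representations ($m=0,1,2,\dots$), where a representation is given by its spaces $(V_b,V_{mid},V_e)$ and its maps $(V_b\to V_e,\ V_b\to V_{mid},\ V_{mid}\to V_e)$: $E_1^m$: spaces $(k^{m+1},k^m,k^m)$, maps $(\pi_+^m,\pi_-^m,\mathrm{Id})$; $E_2^m$: spaces $(k^{m},k^{m+1},k^{m+1})$, maps $(j_+^m,j_-^m,\mathrm{Id})$; $E_3^m$: spaces $(k^{m},k^{m},k^{m+1})$, maps $(j_+^m,\mathrm{Id},j_-^m)$; $E_4^m$: spaces $(k^{m+1},k^{m+1},k^{m})$, maps $(\pi_+^m,\mathrm{Id},\pi_-^m)$; $M$: spaces $(0,k,0)$, all maps zero; $M'$: spaces $(k,0,k)$, maps $(\mathrm{Id},0,0)$.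
   Context: $Rep_k(Q)$ is the category of finite-dimensional $k$-representations of $Q$. An object $X$ of $Rep_k(Q)$ is exceptional if $\mathrm{Hom}(X,X)=k$ and $\mathrm{Ext}^i(X,X)=0$ for $i\neq0$. For $m\ge 1$ the maps $\pi_\pm^m:k^{m+1}\to k^m$ and $j_\pm^m:k^m\to k^{m+1}$ are $\pi_+^m(a_1,\dots,a_{m+1})=(a_1,\dots,a_m)$, $\pi_-^m(a_1,\dots,a_{m+1})=(a_2,\dots,a_{m+1})$, $j_+^m(a_1,\dots,a_m)=(a_1,\dots,a_m,0)$, $j_-^m(a_1,\dots,a_m)=(0,a_1,\dots,a_m)$; for $m=0$ they are the zero maps ($k^0=0$). *)

theory Defs
  imports "HOL-Computational_Algebra.Polynomial" "HOL-Library.Function_Algebras"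
begin

section \<open>Finite-dimensional representations of a quiver\<close>

text \<open>Vertices and arrows are all elements of the types \<open>'q\<close> and \<open>'a\<close>.\<close>

record ('q, 'a) quiver =
  src :: "'a \<Rightarrow> 'q"
  tgt :: "'a \<Rightarrow> 'q"

text \<open>
  The spaces at the vertices are subspaces of one ambient vector space \<open>('v, scl)\<close>. This is no
  restriction: finitely many vector spaces always embed into their direct sum. Structure maps and
  morphisms are HOL functions, of which only the values on the spaces matter; accordingly,
  equality of morphisms is equality on the spaces.
\<close>

record ('k, 'q, 'a, 'v) rep =
  scl :: "'k \<Rightarrow> 'v \<Rightarrow> 'v"
  sp  :: "'q \<Rightarrow> 'v set"
  mp  :: "'a \<Rightarrow> 'v \<Rightarrow> 'v"

type_synonym ('q, 'v, 'w) mor = "'q \<Rightarrow> 'v \<Rightarrow> 'w"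

definition linear_between ::
  "('k::field \<Rightarrow> 'v::ab_group_add \<Rightarrow> 'v) \<Rightarrow> 'v set \<Rightarrow> ('k \<Rightarrow> 'w::ab_group_add \<Rightarrow> 'w) \<Rightarrow> 'w set
    \<Rightarrow> ('v \<Rightarrow> 'w) \<Rightarrow> bool" where
  "linear_between s V t W f \<longleftrightarrow>
     (\<forall>x\<in>V. f x \<in> W) \<and>
     (\<forall>x\<in>V. \<forall>y\<in>V. f (x + y) = f x + f y) \<and>
     (\<forall>c. \<forall>x\<in>V. f (s c x) = t c (f x))"

definition is_rep ::
  "('q, 'a) quiver \<Rightarrow> ('k::field, 'q, 'a, 'v::ab_group_add) rep \<Rightarrow> bool" where
  "is_rep Q X \<longleftrightarrow>
     vector_space (scl X) \<and>
     (\<forall>i. \<exists>B. finite B \<and> sp X i = module.span (scl X) B) \<and>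
     (\<forall>a. linear_between (scl X) (sp X (src Q a)) (scl X) (sp X (tgt Q a)) (mp X a))"

definition is_hom ::
  "('q, 'a) quiver \<Rightarrow> ('k::field, 'q, 'a, 'v::ab_group_add) rep
    \<Rightarrow> ('k, 'q, 'a, 'w::ab_group_add) rep \<Rightarrow> ('q, 'v, 'w) mor \<Rightarrow> bool" where
  "is_hom Q X Y f \<longleftrightarrow>
     (\<forall>i. linear_between (scl X) (sp X i) (scl Y) (sp Y i) (f i)) \<and>
     (\<forall>a. \<forall>x\<in>sp X (src Q a). f (tgt Q a) (mp X a x) = mp Y a (f (src Q a) x))"

definition rep_iso ::
  "('q, 'a) quiver \<Rightarrow> ('k::field, 'q, 'a, 'v::ab_group_add) rep
    \<Rightarrow> ('k, 'q, 'a, 'w::ab_group_add) rep \<Rightarrow> bool" where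
  "rep_iso Q X Y \<longleftrightarrow>
     (\<exists>f g. is_hom Q X Y f \<and> is_hom Q Y X g \<and>
        (\<forall>i. \<forall>x\<in>sp X i. g i (f i x) = x) \<and>
        (\<forall>i. \<forall>y\<in>sp Y i. f i (g i y) = y))"


section \<open>Ext and exceptional objects\<close>

text \<open>
  Quantifiers over all objects of the category range over representations carried by
  \<open>nat \<Rightarrow> 'k\<close>. Since this type contains spaces of every finite dimension and the vertices needed
  here are finite in number, every finite-dimensional representation is isomorphic to one of these.
\<close>

type_synonym ('k, 'q, 'a) std_rep = "('k, 'q, 'a, nat \<Rightarrow> 'k) rep"

definition surj_mor ::
  "('k::field, 'q, 'a, 'v::ab_group_add) rep \<Rightarrow> ('k, 'q, 'a, 'w::ab_group_add) rep
    \<Rightarrow> ('q, 'v, 'w) mor \<Rightarrow> bool" where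
  "surj_mor X Y f \<longleftrightarrow> (\<forall>i. f i ` sp X i = sp Y i)"

definition exact_at ::
  "('k::field, 'q, 'a, 'u::ab_group_add) rep \<Rightarrow> ('k, 'q, 'a, 'v::ab_group_add) rep
    \<Rightarrow> ('q, 'u, 'v) mor \<Rightarrow> ('q, 'v, 'w::ab_group_add) mor \<Rightarrow> bool" where
  "exact_at X Y f g \<longleftrightarrow> (\<forall>i. f i ` sp X i = {y \<in> sp Y i. g i y = 0})"

definition projective ::
  "('q, 'a) quiver \<Rightarrow> ('k::field, 'q, 'a) std_rep \<Rightarrow> bool" where
  "projective Q P \<longleftrightarrow>
     (\<forall>(A :: ('k, 'q, 'a) std_rep) (B :: ('k, 'q, 'a) std_rep) p h.
        is_rep Q A \<and> is_rep Q B \<and> is_hom Q A B p \<and> surj_mor A B p \<and> is_hom Q P B h \<longrightarrow>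
        (\<exists>h'. is_hom Q P A h' \<and> (\<forall>i. \<forall>x\<in>sp P i. p i (h' i x) = h i x)))"

text \<open>
  A projective resolution \<open>\<dots> \<rightarrow> P 2 \<rightarrow> P 1 \<rightarrow> P 0 \<rightarrow> X \<rightarrow> 0\<close> with differentials
  \<open>d n : P (n + 1) \<rightarrow> P n\<close> and augmentation \<open>e : P 0 \<rightarrow> X\<close>.
\<close>

definition proj_resolution ::
  "('q, 'a) quiver \<Rightarrow> ('k::field, 'q, 'a, 'v::ab_group_add) rep
    \<Rightarrow> (nat \<Rightarrow> ('k, 'q, 'a) std_rep) \<Rightarrow> (nat \<Rightarrow> ('q, nat \<Rightarrow> 'k, nat \<Rightarrow> 'k) mor)
    \<Rightarrow> ('q, nat \<Rightarrow> 'k, 'v) mor \<Rightarrow> bool" where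
  "proj_resolution Q X P d e \<longleftrightarrow>
     (\<forall>n. is_rep Q (P n) \<and> projective Q (P n)) \<and>
     (\<forall>n. is_hom Q (P (Suc n)) (P n) (d n)) \<and>
     is_hom Q (P 0) X e \<and>
     surj_mor (P 0) X e \<and>
     exact_at (P 1) (P 0) (d 0) e \<and>
     (\<forall>n. exact_at (P (Suc (Suc n))) (P (Suc n)) (d (Suc n)) (d n))"

text \<open>
  Cocycles and coboundaries in degree \<open>n\<close> of the complex \<open>Hom(P 0, Y) \<rightarrow> Hom(P 1, Y) \<rightarrow> \<dots>\<close>.
\<close>

definition cocycle ::
  "('q, 'a) quiver \<Rightarrow> ('k::field, 'q, 'a, 'w::ab_group_add) rep
    \<Rightarrow> (nat \<Rightarrow> ('k, 'q, 'a) std_rep) \<Rightarrow> (nat \<Rightarrow> ('q, nat \<Rightarrow> 'k, nat \<Rightarrow> 'k) mor)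
    \<Rightarrow> nat \<Rightarrow> ('q, nat \<Rightarrow> 'k, 'w) mor \<Rightarrow> bool" where
  "cocycle Q Y P d n f \<longleftrightarrow>
     is_hom Q (P n) Y f \<and> (\<forall>i. \<forall>x\<in>sp (P (Suc n)) i. f i (d n i x) = 0)"

fun coboundary ::
  "('q, 'a) quiver \<Rightarrow> ('k::field, 'q, 'a, 'w::ab_group_add) rep
    \<Rightarrow> (nat \<Rightarrow> ('k, 'q, 'a) std_rep) \<Rightarrow> (nat \<Rightarrow> ('q, nat \<Rightarrow> 'k, nat \<Rightarrow> 'k) mor)
    \<Rightarrow> nat \<Rightarrow> ('q, nat \<Rightarrow> 'k, 'w) mor \<Rightarrow> bool" where
  "coboundary Q Y P d 0 f \<longleftrightarrow> (\<forall>i. \<forall>x\<in>sp (P 0) i. f i x = 0)"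
| "coboundary Q Y P d (Suc n) f \<longleftrightarrow>
     (\<exists>g. is_hom Q (P n) Y g \<and> (\<forall>i. \<forall>x\<in>sp (P (Suc n)) i. f i x = g i (d n i x)))"

text \<open>
  \<open>Ext\<^sup>n(X, Y) = 0\<close>, where Ext is the derived functor of Hom, computed from a projective resolution
  of \<open>X\<close>; as always, the choice of the resolution is immaterial. For a finite quiver without
  oriented cycles every finite-dimensional representation has a projective resolution by
  finite-dimensional ones.
\<close>

definition ext_zero ::
  "('q, 'a) quiver \<Rightarrow> nat \<Rightarrow> ('k::field, 'q, 'a, 'v::ab_group_add) rep
    \<Rightarrow> ('k, 'q, 'a, 'w::ab_group_add) rep \<Rightarrow> bool" where
  "ext_zero Q n X Y \<longleftrightarrow>
     (\<exists>P d e. proj_resolution Q X P d e \<and> (\<forall>f. cocycle Q Y P d n f \<longrightarrow> coboundary Q Y P d n f))"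

text \<open>
  \<open>Hom(X, X) = k\<close> says that \<open>c \<mapsto> c \<cdot> id\<close> is a bijection from \<open>k\<close> onto the endomorphisms of \<open>X\<close>
  (so \<open>X\<close> is nonzero).
\<close>

definition exceptional ::
  "('q, 'a) quiver \<Rightarrow> ('k::field, 'q, 'a, 'v::ab_group_add) rep \<Rightarrow> bool" where
  "exceptional Q X \<longleftrightarrow>
     (\<forall>f. is_hom Q X X f \<longrightarrow> (\<exists>!c. \<forall>i. \<forall>x\<in>sp X i. f i x = scl X c x)) \<and>
     (\<forall>n. n \<noteq> 0 \<longrightarrow> ext_zero Q n X X)"


section \<open>The quiver with arrows from b to e, from b to mid and from mid to e\<close>

datatype vertex = v_b | v_mid | v_e
datatype arrow = b_to_e | b_to_mid | mid_to_e

definition Q1 :: "(vertex, arrow) quiver" where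
  "Q1 = \<lparr> src = (\<lambda>a. case a of b_to_e \<Rightarrow> v_b | b_to_mid \<Rightarrow> v_b | mid_to_e \<Rightarrow> v_mid),
          tgt = (\<lambda>a. case a of b_to_e \<Rightarrow> v_e | b_to_mid \<Rightarrow> v_mid | mid_to_e \<Rightarrow> v_e) \<rparr>"

text \<open>
  \<open>k\<^sup>n\<close> is the space of sequences vanishing from index \<open>n\<close> on; the coordinates are numbered from 0.
\<close>

definition kpow :: "nat \<Rightarrow> (nat \<Rightarrow> 'k::field) set" where
  "kpow n = {x. \<forall>i\<ge>n. x i = 0}"

definition pi_plus :: "nat \<Rightarrow> (nat \<Rightarrow> 'k::field) \<Rightarrow> nat \<Rightarrow> 'k" where
  "pi_plus m x = (\<lambda>i. if i < m then x i else 0)"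

definition pi_minus :: "nat \<Rightarrow> (nat \<Rightarrow> 'k::field) \<Rightarrow> nat \<Rightarrow> 'k" where
  "pi_minus m x = (\<lambda>i. if i < m then x (i + 1) else 0)"

definition j_plus :: "nat \<Rightarrow> (nat \<Rightarrow> 'k::field) \<Rightarrow> nat \<Rightarrow> 'k" where
  "j_plus m x = (\<lambda>i. if i < m then x i else 0)"

definition j_minus :: "nat \<Rightarrow> (nat \<Rightarrow> 'k::field) \<Rightarrow> nat \<Rightarrow> 'k" where
  "j_minus m x = (\<lambda>i. if 1 \<le> i \<and> i \<le> m then x (i - 1) else 0)"

text \<open>
  The representation with spaces \<open>(k\<^sup>p, k\<^sup>q, k\<^sup>r)\<close> at \<open>(b, mid, e)\<close> and maps \<open>(f, g, h)\<close> along
  the arrows from \<open>b\<close> to \<open>e\<close>, from \<open>b\<close> to \<open>mid\<close> and from \<open>mid\<close> to \<open>e\<close>.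
\<close>

definition mk_rep ::
  "nat \<Rightarrow> nat \<Rightarrow> nat \<Rightarrow> ((nat \<Rightarrow> 'k::field) \<Rightarrow> nat \<Rightarrow> 'k) \<Rightarrow> ((nat \<Rightarrow> 'k) \<Rightarrow> nat \<Rightarrow> 'k)
    \<Rightarrow> ((nat \<Rightarrow> 'k) \<Rightarrow> nat \<Rightarrow> 'k) \<Rightarrow> ('k, vertex, arrow) std_rep" where
  "mk_rep p q r f g h =
     \<lparr> scl = (\<lambda>c x i. c * x i),
       sp = (\<lambda>v. case v of v_b \<Rightarrow> kpow p | v_mid \<Rightarrow> kpow q | v_e \<Rightarrow> kpow r),
       mp = (\<lambda>a. case a of b_to_e \<Rightarrow> f | b_to_mid \<Rightarrow> g | mid_to_e \<Rightarrow> h) \<rparr>"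

datatype label = E1 nat | E2 nat | E3 nat | E4 nat | M | M'

fun listed :: "label \<Rightarrow> ('k::field, vertex, arrow) std_rep" where
  "listed (E1 m) = mk_rep (m + 1) m m (pi_plus m) (pi_minus m) id"
| "listed (E2 m) = mk_rep m (m + 1) (m + 1) (j_plus m) (j_minus m) id"
| "listed (E3 m) = mk_rep m m (m + 1) (j_plus m) id (j_minus m)"
| "listed (E4 m) = mk_rep (m + 1) (m + 1) m (pi_plus m) id (pi_minus m)"
| "listed M = mk_rep 0 1 0 (\<lambda>_. 0) (\<lambda>_. 0) (\<lambda>_. 0)"
| "listed M' = mk_rep 1 0 1 id (\<lambda>_. 0) (\<lambda>_. 0)"

end

theory Submission
  imports Defs
begin

text \<open>
  Replace \<open>X\<close> by an isomorphic representation on coordinate spaces, of dimension vector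
  \<open>(p, q, r)\<close> and with maps \<open>\<alpha>\<close> from \<open>b\<close> to \<open>mid\<close>, \<open>\<beta>\<close> from \<open>mid\<close> to \<open>e\<close> and \<open>\<gamma>\<close> from \<open>b\<close> to \<open>e\<close>.
  The vanishing of \<open>Ext\<^sup>1(X, X)\<close> says that \<open>X\<close> is rigid: every family of maps along the arrows has
  the form \<open>\<sigma> a - a \<sigma>\<close>. Hence \<open>\<alpha>\<close>, \<open>\<beta>\<close> and all \<open>\<gamma> + c \<beta> \<alpha>\<close> are injective or surjective. Counting
  equations for endomorphisms, \<open>End(X) = k\<close> forces
  \<open>(p - q)\<^sup>2 + (q - r)\<^sup>2 + (r - p)\<^sup>2 \<le> 2\<close>, and equality together with \<open>End(X) = k\<close> implies rigidity.

  If \<open>p = q = r\<close>, an eigenvector yields a noninjective member of the pencil, which is impossible.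
  If \<open>r = p + 1\<close>, then \<open>\<alpha>\<close>, \<open>\<beta>\<close> and the pencil are injective, so every nonzero subrepresentation
  has defect \<open>dim\<^sub>b - dim\<^sub>e < 0\<close>; therefore nonzero morphisms between two such representations are
  injective, and counting equations provides a nonzero morphism to the representation of the list
  with the same dimension vector. The case \<open>p = r + 1\<close> is dual. Finally, if \<open>p = r\<close> then \<open>\<gamma>\<close> is
  invertible, and the endomorphism with components \<open>\<gamma>\<^sup>-\<^sup>1 \<beta> \<alpha>\<close>, \<open>\<alpha> \<gamma>\<^sup>-\<^sup>1 \<beta>\<close>, \<open>\<beta> \<alpha> \<gamma>\<^sup>-\<^sup>1\<close> must
  vanish, which leaves only \<open>M\<close> and \<open>M'\<close>.
\<close>

section \<open>Finite-dimensional subspaces\<close>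


text \<open>The bound 2 comes from a count. An endomorphism has \<open>n v * n v\<close> matrix
  entries at each vertex as unknowns, and each arrow imposes
  \<open>n (src Q a) * n (tgt Q a)\<close> equations. One further equation, the vanishing of a
  single matrix entry, excludes the nonzero scalars; so for a brick the unknowns exceed the arrow
  equations by at most 1, and doubling this inequality produces the three squares. In the case of
  equality there is room for one more unknown, a multiple t of a prescribed family of maps along the
  arrows; since t = 0 would leave a forbidden endomorphism, t is nonzero, and division by t gives
  rigidity.

  Vanishing of Ext only provides some resolution about which nothing else is known. It is therefore
  exploited with an arbitrary resolution, through a self-extension of X, but established with one
  explicit resolution of length one, in which degree 1 alone carries information.

  Algebraic closedness enters through eigenvectors, both in bounding the defect of
  subrepresentations and in showing that endomorphisms are scalars.\<close>

locale linear_operators = vector_space scale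
  for scale :: "'a::field \<Rightarrow> 'b::ab_group_add \<Rightarrow> 'b"
begin

sublocale vector_space_pair scale scale
  by unfold_locales

text \<open>The ambient space \<open>nat \<Rightarrow> 'k\<close> has infinite dimension, so
  finiteness is a property of the subspace. Without it \<open>dim S = 0\<close> would not force
  \<open>S = {0}\<close>, since \<open>dim\<close> is 0 on spaces of infinite dimension.\<close>

definition fin_subspace :: "'b set \<Rightarrow> bool" where
  "fin_subspace S \<longleftrightarrow> subspace S \<and> (\<exists>B. finite B \<and> S \<subseteq> span B)"

lemma fin_subspace_span: "finite B \<Longrightarrow> fin_subspace (span B)"
  unfolding fin_subspace_def by auto

lemma fin_subspace_basis:
  assumes "fin_subspace S"
  obtains B where "finite B" "independent B" "span B = S" "card B = dim S"
proof -
  from assms obtain C where S: "subspace S" and C: "finite C" "S \<subseteq> span C"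
    unfolding fin_subspace_def by auto
  obtain B where B: "B \<subseteq> S" "independent B" "S \<subseteq> span B" "card B = dim S"
    using basis_exists[of S] by auto
  have "finite B"
    using independent_span_bound[OF C(1) B(2)] B(1) C(2) by blast
  moreover have "span B = S"
    using B(1,3) S span_minimal by blast
  ultimately show ?thesis using B that by blast
qed

lemma fin_subspace_subset:
  "fin_subspace T \<Longrightarrow> subspace S \<Longrightarrow> S \<subseteq> T \<Longrightarrow> fin_subspace S"
  unfolding fin_subspace_def by blast

lemma fin_subspace_dim_mono:
  assumes "fin_subspace T" "subspace S" "S \<subseteq> T"
  shows "dim S \<le> dim T"
proof -
  obtain B where B: "finite B" "independent B" "span B = T" "card B = dim T"
    by (rule fin_subspace_basis[OF assms(1)])
  show ?thesis using dim_le_card[of S B] B assms(3) by auto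
qed

lemma fin_subspace_dim_eq:
  assumes T: "fin_subspace T" and S: "subspace S" "S \<subseteq> T" and d: "dim T \<le> dim S"
  shows "S = T"
proof (rule ccontr)
  assume "S \<noteq> T"
  then obtain x where x: "x \<in> T" "x \<notin> S" using S by blast
  obtain B where B: "finite B" "independent B" "span B = S" "card B = dim S"
    by (rule fin_subspace_basis[OF fin_subspace_subset[OF T S]])
  obtain C where C: "finite C" "independent C" "span C = T" "card C = dim T"
    by (rule fin_subspace_basis[OF T])
  have "independent (insert x B)"
    using x B by (intro independent_insertI) auto
  moreover have "insert x B \<subseteq> span C"
    using x C B S span_superset by blast
  ultimately have "card (insert x B) \<le> card C"
    using independent_span_bound[OF C(1)] by blast
  moreover have "x \<notin> B" using x B span_superset by blast
  ultimately show False using B C d by simp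
qed

lemma fin_subspace_dim_0:
  assumes "fin_subspace S"
  shows "dim S = 0 \<longleftrightarrow> S = {0}"
proof -
  obtain B where B: "finite B" "independent B" "span B = S" "card B = dim S"
    by (rule fin_subspace_basis[OF assms])
  show ?thesis
  proof
    assume "dim S = 0"
    then have "B = {}" using B by simp
    then show "S = {0}" using B by auto
  next
    assume "S = {0}"
    then have "S \<subseteq> span {}" by simp
    from dim_le_card[OF this finite.emptyI] show "dim S = 0" by simp
  qed
qed

text \<open>A basis \<open>B\<close> of the kernel inside \<open>S\<close> is extended to a basis
  \<open>C\<close> of \<open>S\<close>; the images of \<open>C - B\<close> form a basis of the
  image.\<close>

lemma rank_nullity:
  assumes f: "Vector_Spaces.linear scale scale f" and S: "fin_subspace S"
  shows "dim (S \<inter> {x. f x = 0}) + dim (f ` S) = dim S"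
proof -
  interpret f: Vector_Spaces.linear scale scale f by fact
  let ?K = "S \<inter> {x. f x = 0}"
  have sS: "subspace S" using S by (simp add: fin_subspace_def)
  have sK: "subspace ?K"
    by (intro subspace_inter sS f.subspace_kernel)
  obtain B where B: "finite B" "independent B" "span B = ?K" "card B = dim ?K"
    by (rule fin_subspace_basis[OF fin_subspace_subset[OF S sK Int_lower1]])
  have BS: "B \<subseteq> S" using span_superset[of B] unfolding B(3) by blast
  obtain C where C: "B \<subseteq> C" "C \<subseteq> S" "independent C" "S \<subseteq> span C"
    using maximal_independent_subset_extend[OF BS B(2)] by auto
  obtain D where D: "finite D" "independent D" "span D = S" "card D = dim S"
    by (rule fin_subspace_basis[OF S])
  have finC: "finite C"
    using independent_span_bound[OF D(1) C(3)] C(2) unfolding D(3) by blast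
  have spC: "span C = S" using span_minimal[OF C(2) sS] C(4) by (rule subset_antisym)
  have cC: "card C = dim S"
    using dim_span_eq_card_independent[OF C(3)] spC by simp
  let ?D = "C - B"
  have iD: "independent ?D" using C(3) by (rule independent_mono) blast
  have DC: "span ?D \<subseteq> S" using span_mono[of ?D C] unfolding spC by blast
  have inj: "inj_on f (span ?D)"
  proof (subst f.inj_on_iff_eq_0)
    show "subspace (span ?D)" by (rule subspace_span)
    show "\<forall>x\<in>span ?D. f x = 0 \<longrightarrow> x = 0"
    proof (intro ballI impI)
      fix x assume x: "x \<in> span ?D" "f x = 0"
      have "x \<in> S" using x(1) DC by blast
      then have xB: "x \<in> span B" using x(2) unfolding B(3) by blast
      \<comment> \<open>The coordinates of x with respect to \<open>C\<close> are supported in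
        \<open>B\<close> and also in \<open>C - B\<close>, hence they all vanish.\<close>
      have "representation C x = representation B x"
        using representation_extend[OF C(3) xB C(1)] .
      moreover have "representation C x = representation ?D x"
        using representation_extend[OF C(3) x(1) Diff_subset] .
      ultimately have r: "representation C x b = 0" for b
        using representation_ne_zero[of B x b] representation_ne_zero[of ?D x b] by auto
      have "x \<in> span C" using span_mono[OF C(1)] xB by (rule subsetD)
      from sum_nonzero_representation_eq[OF C(3) this]
      show "x = 0" using r by simp
    qed
  qed
  have ind: "independent (f ` ?D)"
    using f.independent_injective_image[OF iD inj] .
  have im: "f ` S = span (f ` ?D)"
  proof
    have "f ` C \<subseteq> span (f ` ?D)"
    proof
      fix y assume "y \<in> f ` C"
      then obtain c where c: "c \<in> C" "y = f c" by blast
      show "y \<in> span (f ` ?D)"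
      proof (cases "c \<in> B")
        case True
        then have "c \<in> ?K" using span_superset[of B] unfolding B(3) by blast
        then have "y = 0" using c by simp
        then show ?thesis using span_zero by simp
      next
        case False
        then show ?thesis unfolding c(2) using c(1) by (intro span_base imageI) simp
      qed
    qed
    then have "span (f ` C) \<subseteq> span (f ` ?D)"
      using span_minimal[OF _ subspace_span] by simp
    then show "f ` S \<subseteq> span (f ` ?D)" using f.span_image[of C] spC by simp
    show "span (f ` ?D) \<subseteq> f ` S"
      using DC by (simp only: f.span_image image_mono)
  qed
  have "dim (f ` S) = card (f ` ?D)"
    using im dim_span_eq_card_independent[OF ind] by simp
  also have "\<dots> = card ?D"
    using inj_on_subset[OF inj span_superset] by (rule card_image)
  finally have "dim (f ` S) = card ?D" .
  moreover have "card C = card B + card ?D"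
    using C(1) finC B(1) by (metis card_Diff_subset card_mono le_add_diff_inverse)
  ultimately show ?thesis using cC B(4) by simp
qed

lemma dim_image_inj_on:
  assumes f: "Vector_Spaces.linear scale scale f" and S: "fin_subspace S" and inj: "\<And>x. x \<in> S \<Longrightarrow> f x = 0 \<Longrightarrow> x = 0"
  shows "dim (f ` S) = dim S"
proof -
  have s: "subspace S" using S by (simp add: fin_subspace_def)
  interpret f: Vector_Spaces.linear scale scale f by fact
  have "S \<inter> {x. f x = 0} = {0}" using inj subspace_0[OF s] by auto
  then have "dim (S \<inter> {x. f x = 0}) = 0"
    using fin_subspace_dim_0[OF fin_subspace_span[of "{}"]] by simp
  then show ?thesis using rank_nullity[OF f S] by simp
qed

end

section \<open>Eigenvectors on finite-dimensional invariant subspaces\<close>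

locale alg_closed_linear_operators = linear_operators scale
  for scale :: "'k::alg_closed_field \<Rightarrow> 'v::ab_group_add \<Rightarrow> 'v"
begin

text \<open>A root a of p splits off a linear factor, p = (X - a) q. Either (T - a) v is zero and v
  is an eigenvector, or (T - a) v is a nonzero vector of \<open>S\<close> annihilated by q, which
  has smaller degree.\<close>

lemma eigenvector_of_annihilator:
  assumes T: "Vector_Spaces.linear scale scale T" and inv: "\<And>x. x \<in> S \<Longrightarrow> T x \<in> S" and S: "subspace S"
    and "v \<in> S" "v \<noteq> 0" "p \<noteq> 0" "(\<Sum>k\<le>degree p. scale (coeff p k) ((T ^^ k) v)) = 0"
  shows "\<exists>x\<in>S. \<exists>c. x \<noteq> 0 \<and> T x = scale c x"
  using assms(4-)
proof (induction "degree p" arbitrary: p v rule: less_induct)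
  case less
  interpret T: Vector_Spaces.linear scale scale T by fact
  show ?case
  proof (cases "degree p = 0")
    case True
    then have "scale (coeff p 0) v = 0" using less.prems(4) by simp
    moreover have "coeff p 0 \<noteq> 0" using True less.prems(3) leading_coeff_0_iff[of p] by simp
    ultimately show ?thesis using less.prems(2) by simp
  next
    case False
    then obtain a where "poly p a = 0" using alg_closed_imp_poly_has_root[of p] by blast
    then have "[:- a, 1:] dvd p" by (simp only: poly_eq_0_iff_dvd)
    then obtain q where q: "p = [:- a, 1:] * q" by (rule dvdE)
    have q0: "q \<noteq> 0"
    proof
      assume "q = 0"
      with q less.prems(3) show False by (simp only: mult_zero_right)
    qed
    have dp: "degree p = Suc (degree q)"
      using q q0 by (simp add: degree_mult_eq del: mult_pCons_left)
    let ?w = "T v - scale a v"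
    have wS: "?w \<in> S" using inv[OF less.prems(1)] less.prems(1) S
      by (simp add: subspace_diff subspace_scale)
    have Tk: "Vector_Spaces.linear scale scale (T ^^ k)" for k
    proof (induction k)
      case 0 then show ?case using linear_id by (simp add: id_def)
    next
      case (Suc k) then show ?case
        using Vector_Spaces.linear_compose[OF Suc T] by (simp add: o_def)
    qed
    have Tkw: "(T ^^ k) ?w = (T ^^ Suc k) v - scale a ((T ^^ k) v)" for k
    proof -
      interpret Tk: Vector_Spaces.linear scale scale "T ^^ k" by (fact Tk)
      show ?thesis by (simp only: Tk.diff Tk.scale funpow_Suc_right o_apply)
    qed
    \<comment> \<open>The coefficient of p at k is that of q at k - 1 minus a times that of q at k.
      This matches \<open>Tkw\<close>, so that q applied to \<open>?w\<close> and p applied to v are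
      the same sum after an index shift.\<close>
    have cp: "coeff p k = (if k = 0 then 0 else coeff q (k - 1)) - a * coeff q k" for k
      unfolding q by (cases k) (auto simp: coeff_pCons split: nat.split)
    have "(\<Sum>k\<le>degree q. scale (coeff q k) ((T ^^ k) ?w))
        = (\<Sum>k\<le>degree q. scale (coeff q k) ((T ^^ Suc k) v)) - (\<Sum>k\<le>degree q. scale (a * coeff q k) ((T ^^ k) v))"
      unfolding Tkw by (simp only: scale_right_diff_distrib sum_subtractf scale_scale mult.commute)
    also have "(\<Sum>k\<le>degree q. scale (coeff q k) ((T ^^ Suc k) v))
        = (\<Sum>k\<le>degree p. scale (if k = 0 then 0 else coeff q (k - 1)) ((T ^^ k) v))"
      unfolding dp by (subst sum.atMost_Suc_shift) simp
    also have "(\<Sum>k\<le>degree q. scale (a * coeff q k) ((T ^^ k) v)) = (\<Sum>k\<le>degree p. scale (a * coeff q k) ((T ^^ k) v))"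
      unfolding dp by (simp add: coeff_eq_0)
    also have "(\<Sum>k\<le>degree p. scale (if k = 0 then 0 else coeff q (k - 1)) ((T ^^ k) v)) - \<dots>
        = (\<Sum>k\<le>degree p. scale (coeff p k) ((T ^^ k) v))"
      unfolding cp by (simp only: scale_left_diff_distrib sum_subtractf)
    finally have sum0: "(\<Sum>k\<le>degree q. scale (coeff q k) ((T ^^ k) ?w)) = 0" using less.prems(4) by simp
    show ?thesis
    proof (cases "?w = 0")
      case True
      then show ?thesis using less.prems(1,2) by (intro bexI[of _ v] exI[of _ a]) auto
    next
      case False
      show ?thesis using less.hyps[OF _ wS False q0 sum0] dp by simp
    qed
  qed
qed

text \<open>With n = dim S, the n + 1 iterates v, T v, ..., T^n v satisfy a nontrivial linear
  relation; its coefficients are those of a polynomial annihilating v.\<close>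

lemma eigenvector_exists:
  assumes T: "Vector_Spaces.linear scale scale T" and inv: "\<And>x. x \<in> S \<Longrightarrow> T x \<in> S"
    and S: "fin_subspace S" and nz: "S \<noteq> {0}"
  obtains x c where "x \<in> S" "x \<noteq> 0" "T x = scale c x"
proof -
  interpret T: Vector_Spaces.linear scale scale T by fact
  have sS: "subspace S" using S by (simp add: fin_subspace_def)
  obtain v where v: "v \<in> S" "v \<noteq> 0" using nz subspace_0[OF sS] by blast
  let ?x = "\<lambda>k. (T ^^ k) v"
  have xS: "?x k \<in> S" for k by (induction k) (auto simp: v inv)
  obtain B where B: "finite B" "independent B" "span B = S" "card B = dim S"
    by (rule fin_subspace_basis[OF S])
  let ?n = "card B"
  have "\<exists>u. (\<exists>k\<le>?n. u k \<noteq> 0) \<and> (\<Sum>k\<le>?n. scale (u k) (?x k)) = 0"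
  proof (cases "inj_on ?x {..?n}")
    case True
    have "dependent (?x ` {..?n})"
    proof (rule ccontr)
      assume "\<not> dependent (?x ` {..?n})"
      then have "card (?x ` {..?n}) \<le> card B"
        using independent_span_bound[OF B(1), of "?x ` {..?n}"] xS B by auto
      then show False using card_image[OF True] by simp
    qed
    then obtain u where u: "\<exists>y\<in>?x ` {..?n}. u y \<noteq> 0" "(\<Sum>y\<in>?x ` {..?n}. scale (u y) y) = 0"
      using dependent_finite[of "?x ` {..?n}"] by auto
    have "(\<Sum>k\<le>?n. scale (u (?x k)) (?x k)) = 0"
      using u(2) sum.reindex[OF True, of "\<lambda>y. scale (u y) y"] by simp
    then show ?thesis using u(1) by (intro exI[of _ "\<lambda>k. u (?x k)"]) auto
  next
    \<comment> \<open>Dependence is a notion for sets and does not see repeated iterates. A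
      repetition is itself a relation, with coefficients 1 and -1.\<close>
    case False
    then obtain i j where ij: "i \<le> ?n" "j \<le> ?n" "i \<noteq> j" "?x i = ?x j"
      unfolding inj_on_def by auto
    let ?u = "\<lambda>k. if k = i then 1 else if k = j then -1 else (0::'k)"
    have "(\<Sum>k\<le>?n. scale (?u k) (?x k)) = (\<Sum>k\<in>{i,j}. scale (?u k) (?x k))"
      using ij by (intro sum.mono_neutral_right) auto
    also have "\<dots> = 0" using ij by simp
    finally show ?thesis using ij by (intro exI[of _ ?u]) auto
  qed
  then obtain u where u: "\<exists>k\<le>?n. u k \<noteq> 0" "(\<Sum>k\<le>?n. scale (u k) (?x k)) = 0" by blast
  define p where "p = (\<Sum>k\<le>?n. monom (u k) k)"
  have cp: "coeff p k = (if k \<le> ?n then u k else 0)" for k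
    unfolding p_def by (simp add: coeff_sum)
  have "p \<noteq> 0" using u(1) cp by (metis coeff_0)
  have dp: "degree p \<le> ?n" by (rule degree_le) (simp add: cp)
  have "(\<Sum>k\<le>degree p. scale (coeff p k) (?x k)) = (\<Sum>k\<le>?n. scale (coeff p k) (?x k))"
    using dp by (intro sum.mono_neutral_left) (auto simp: coeff_eq_0)
  also have "\<dots> = 0" using u(2) by (simp add: cp)
  finally show ?thesis
    using eigenvector_of_annihilator[OF T inv sS v \<open>p \<noteq> 0\<close>] that by blast
qed

text \<open>An eigenvector of the inverse of \<open>B\<close> followed by \<open>A\<close> lies in the kernel of a member of the pencil.\<close>

lemma injective_pencil_dim_less:
  assumes A: "Vector_Spaces.linear scale scale A" and B: "Vector_Spaces.linear scale scale B"
    and S: "fin_subspace S" "S \<noteq> {0}" and T: "fin_subspace T"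
    and AST: "\<And>x. x \<in> S \<Longrightarrow> A x \<in> T" and BST: "\<And>x. x \<in> S \<Longrightarrow> B x \<in> T"
    and injB: "\<And>x. x \<in> S \<Longrightarrow> B x = 0 \<Longrightarrow> x = 0"
    and inj: "\<And>x c. x \<in> S \<Longrightarrow> A x = scale c (B x) \<Longrightarrow> x = 0"
  shows "dim S < dim T"
proof (rule ccontr)
  interpret A: Vector_Spaces.linear scale scale A by fact
  interpret B: Vector_Spaces.linear scale scale B by fact
  assume "\<not> dim S < dim T"
  have sS: "subspace S" using S by (simp add: fin_subspace_def)
  have "dim (B ` S) = dim S" using dim_image_inj_on[OF B S(1) injB] .
  then have BS: "B ` S = T"
    using fin_subspace_dim_eq[OF T B.subspace_image[OF sS]] BST \<open>\<not> dim S < dim T\<close> by auto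
  have spS: "span S = S" using sS by simp
  have "inj_on B (span S)"
    unfolding spS by (subst B.inj_on_iff_eq_0) (auto simp: sS injB)
  from linear_inj_on_left_inverse[OF B this]
  obtain R where R: "range R \<subseteq> S" "Vector_Spaces.linear scale scale R" "\<forall>x\<in>S. R (B x) = x"
    unfolding spS by auto
  have BR: "B (R t) = t" if "t \<in> T" for t
    using that R(3) BS by auto
  have "Vector_Spaces.linear scale scale (R \<circ> A)" by (rule Vector_Spaces.linear_compose[OF A R(2)])
  then obtain x c where x: "x \<in> S" "x \<noteq> 0" "(R \<circ> A) x = scale c x"
    by (rule eigenvector_exists[OF _ _ S]) (use R(1) in auto)
  have "A x = scale c (B x)"
    using BR[OF AST[OF x(1)]] x(3) by (simp add: B.scale)
  then show False using inj x by blast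
qed

end


section \<open>Linear maps between subspaces\<close>

lemma linear_betweenD:
  assumes "linear_between s V t W f"
  shows "x \<in> V \<Longrightarrow> f x \<in> W"
    and "x \<in> V \<Longrightarrow> y \<in> V \<Longrightarrow> f (x + y) = f x + f y"
    and "x \<in> V \<Longrightarrow> f (s c x) = t c (f x)"
  using assms unfolding linear_between_def by blast+

lemma linear_between_compose:
  assumes "linear_between s V t W f" "linear_between t W u U g"
  shows "linear_between s V u U (\<lambda>x. g (f x))"
  using assms unfolding linear_between_def by simp

lemma linear_between_zero:
  assumes "vector_space s" "vector_space t" "linear_between s V t W f" "x \<in> V"
  shows "f 0 = 0"
proof -
  interpret s: vector_space s by fact
  interpret t: vector_space t by fact
  have "f (s 0 x) = t 0 (f x)" using linear_betweenD(3)[OF assms(3,4)] .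
  then show ?thesis by simp
qed

lemma linear_between_add:
  assumes "vector_space t" "module.subspace t W" "linear_between s V t W f" "linear_between s V t W g"
  shows "linear_between s V t W (\<lambda>x. f x + g x)"
proof -
  interpret t: vector_space t by fact
  show ?thesis
    using assms(3,4) t.subspace_add[OF assms(2)]
    unfolding linear_between_def by (simp add: t.scale_right_distrib algebra_simps)
qed

lemma linear_between_scale:
  assumes "vector_space t" "module.subspace t W" "linear_between s V t W f"
  shows "linear_between s V t W (\<lambda>x. t c (f x))"
proof -
  interpret t: vector_space t by fact
  show ?thesis
    using assms(3) t.subspace_scale[OF assms(2)]
    unfolding linear_between_def by (simp add: t.scale_right_distrib mult.commute)
qed

lemma linear_between_minus:
  assumes "vector_space t" "module.subspace t W" "linear_between s V t W f"
  shows "linear_between s V t W (\<lambda>x. - f x)"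
proof -
  interpret t: vector_space t by fact
  show ?thesis using linear_between_scale[OF assms, of "-1"] by simp
qed

lemma linear_between_const_zero:
  assumes "vector_space t" "module.subspace t W"
  shows "linear_between s V t W (\<lambda>x. 0)"
proof -
  interpret t: vector_space t by fact
  show ?thesis using t.subspace_0[OF assms(2)] unfolding linear_between_def by simp
qed

lemma linear_between_id: "linear_between s V s V (\<lambda>x. x)"
  unfolding linear_between_def by simp

lemma linear_imp_linear_between:
  assumes "Vector_Spaces.linear s t F" "\<And>x. x \<in> V \<Longrightarrow> F x \<in> W"
  shows "linear_between s V t W F"
proof -
  interpret Vector_Spaces.linear s t F by fact
  show ?thesis using assms(2) unfolding linear_between_def by (simp add: add scale)
qed

text \<open>Structure maps and morphisms are linear on their spaces only. Replacing them by globally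
  linear extensions gives access to rank-nullity, eigenvectors and the other results on linear
  maps.\<close>

lemma linear_extends_basis:
  assumes s: "vector_space s" and t: "vector_space t" and V: "V = module.span s B"
    and f: "linear_between s V t W f"
  obtains F where "Vector_Spaces.linear s t F" "\<And>x. x \<in> V \<Longrightarrow> F x = f x"
proof -
  interpret s: vector_space s by fact
  interpret t: vector_space t by fact
  interpret p: vector_space_pair s t by unfold_locales
  have sV: "s.subspace V" unfolding V by simp
  obtain C where C: "C \<subseteq> V" "s.independent C" "V \<subseteq> s.span C"
    using s.maximal_independent_subset[of V] by auto
  obtain F where F: "Vector_Spaces.linear s t F" "\<forall>x\<in>C. F x = f x"
    using p.linear_independent_extend[OF C(2), of f] by auto
  interpret F: Vector_Spaces.linear s t F by (fact F(1))
  have f0: "f 0 = 0"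
    using linear_between_zero[OF s t f s.subspace_0[OF sV]] .
  have CV: "s.span C \<subseteq> V" using s.span_minimal[OF C(1) sV] .
  have "x \<in> V \<and> F x = f x" if "x \<in> s.span C" for x
    using that
  proof (induction rule: s.span_induct_alt)
    case base
    show ?case using f0 s.subspace_0[OF sV] by simp
  next
    case (step c x y)
    have "x \<in> V" using step C(1) by auto
    moreover have "s c x \<in> V" using s.subspace_scale[OF sV \<open>x \<in> V\<close>] .
    ultimately show ?case
      using step F(2) linear_betweenD(2,3)[OF f] s.subspace_add[OF sV] by (simp add: F.add F.scale)
  qed
  then show ?thesis using that F(1) C(3) by blast
qed

lemma linear_between_inv_into:
  assumes s: "vector_space s" and V: "module.subspace s V"
    and f: "linear_between s V t W f" and inj: "inj_on f V" and surj: "f ` V = W"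
  shows "linear_between t W s V (inv_into V f)"
proof -
  interpret s: vector_space s by fact
  have gV: "inv_into V f y \<in> V" "f (inv_into V f y) = y" if "y \<in> W" for y
    using that surj inv_into_into[of y f V] f_inv_into_f[of y f V] by auto
  have eq: "inv_into V f y = x" if "x \<in> V" "f x = y" for x y
    using that inj by (auto intro: inv_into_f_eq)
  show ?thesis
    unfolding linear_between_def
  proof (intro conjI ballI allI)
    fix y z assume "y \<in> W" "z \<in> W"
    then show "inv_into V f (y + z) = inv_into V f y + inv_into V f z"
      using gV s.subspace_add[OF V] linear_betweenD(2)[OF f] by (intro eq) auto
  next
    fix c y assume "y \<in> W"
    then show "inv_into V f (t c y) = s c (inv_into V f y)"
      using gV s.subspace_scale[OF V] linear_betweenD(3)[OF f] by (intro eq) auto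
  qed (rule gV)
qed


section \<open>Isomorphism invariance\<close>

lemma is_rep_subspace: "is_rep Q X \<Longrightarrow> module.subspace (scl X) (sp X i)"
proof -
  assume X: "is_rep Q X"
  then interpret vector_space "scl X" unfolding is_rep_def by blast
  obtain B where "sp X i = span B" using X unfolding is_rep_def by blast
  then show ?thesis by simp
qed

lemma is_homD:
  assumes "is_hom Q X Y f"
  shows "linear_between (scl X) (sp X i) (scl Y) (sp Y i) (f i)"
    and "x \<in> sp X i \<Longrightarrow> f i x \<in> sp Y i"
    and "x \<in> sp X (src Q a) \<Longrightarrow> f (tgt Q a) (mp X a x) = mp Y a (f (src Q a) x)"
  using assms unfolding is_hom_def linear_between_def by blast+

lemma is_rep_mp:
  "is_rep Q X \<Longrightarrow> x \<in> sp X (src Q a) \<Longrightarrow> mp X a x \<in> sp X (tgt Q a)"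
  unfolding is_rep_def linear_between_def by blast

lemma is_hom_zero:
  assumes "is_rep Q X" "is_hom Q X Y f" "is_rep Q Y"
  shows "f i 0 = 0"
proof -
  have "vector_space (scl X)" "vector_space (scl Y)" using assms unfolding is_rep_def by auto
  moreover have "0 \<in> sp X i"
    using is_rep_subspace[OF assms(1)] calculation(1)
    by (metis module.subspace_0 module_iff_vector_space)
  ultimately show ?thesis using linear_between_zero is_homD(1)[OF assms(2)] by blast
qed

lemma is_hom_compose:
  assumes "is_hom Q X Y f" "is_hom Q Y Z g"
  shows "is_hom Q X Z (\<lambda>i x. g i (f i x))"
  using assms linear_between_compose unfolding is_hom_def
  by (auto simp: linear_between_def)

lemma rep_iso_sym: "rep_iso Q X Y \<Longrightarrow> rep_iso Q Y X"
  unfolding rep_iso_def by blast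

lemma rep_iso_trans:
  assumes "rep_iso Q X Y" "rep_iso Q Y Z"
  shows "rep_iso Q X Z"
proof -
  obtain f f' where f: "is_hom Q X Y f" "is_hom Q Y X f'"
    "\<And>i x. x \<in> sp X i \<Longrightarrow> f' i (f i x) = x" "\<And>i y. y \<in> sp Y i \<Longrightarrow> f i (f' i y) = y"
    using assms(1) unfolding rep_iso_def by blast
  obtain g g' where g: "is_hom Q Y Z g" "is_hom Q Z Y g'"
    "\<And>i x. x \<in> sp Y i \<Longrightarrow> g' i (g i x) = x" "\<And>i y. y \<in> sp Z i \<Longrightarrow> g i (g' i y) = y"
    using assms(2) unfolding rep_iso_def by blast
  show ?thesis
    unfolding rep_iso_def
    using is_hom_compose[OF f(1) g(1)] is_hom_compose[OF g(2) f(2)] f g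
      is_homD(2)[OF f(1)] is_homD(2)[OF g(2)]
    by (intro exI[of _ "\<lambda>i x. g i (f i x)"] exI[of _ "\<lambda>i x. f' i (g' i x)"]) simp
qed

lemma bij_hom_imp_rep_iso:
  assumes X: "is_rep Q X" and f: "is_hom Q X Y f"
    and bij: "\<And>i. bij_betw (f i) (sp X i) (sp Y i)"
  shows "rep_iso Q X Y"
proof -
  let ?g = "\<lambda>i. inv_into (sp X i) (f i)"
  have vs: "vector_space (scl X)" using X unfolding is_rep_def by blast
  have gf: "?g i (f i x) = x" if "x \<in> sp X i" for i x
    using that bij[of i] by (simp add: bij_betw_def)
  have fg: "f i (?g i y) = y" and gX: "?g i y \<in> sp X i" if "y \<in> sp Y i" for i y
    using that bij[of i] f_inv_into_f[of y "f i" "sp X i"] inv_into_into[of y "f i" "sp X i"]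
    by (auto simp: bij_betw_def)
  have "is_hom Q Y X ?g"
    unfolding is_hom_def
  proof (intro conjI allI ballI)
    fix i show "linear_between (scl Y) (sp Y i) (scl X) (sp X i) (?g i)"
      using linear_between_inv_into[OF vs is_rep_subspace[OF X] is_homD(1)[OF f]] bij[of i]
      by (simp add: bij_betw_def)
  next
    fix a y assume y: "y \<in> sp Y (src Q a)"
    let ?x = "?g (src Q a) y"
    have "mp Y a y = f (tgt Q a) (mp X a ?x)"
      using is_homD(3)[OF f gX[OF y]] fg[OF y] by simp
    then show "?g (tgt Q a) (mp Y a y) = mp X a ?x"
      using gf[OF is_rep_mp[OF X gX[OF y]]] by simp
  qed
  then show ?thesis unfolding rep_iso_def using f gf fg by blast
qed

text \<open>Composing the augmentation with the isomorphism turns a resolution of X into one of Y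
  with the same terms and differentials. Cocycles are carried from Y to X by g, and the bounding
  morphisms back by f.\<close>

lemma ext_zero_iso:
  fixes X :: "('k::field, 'q, 'a, 'v::ab_group_add) rep" and Y :: "('k, 'q, 'a, 'w::ab_group_add) rep"
  assumes X: "is_rep Q X" and Y: "is_rep Q Y" and iso: "rep_iso Q X Y" and ext: "ext_zero Q (Suc n) X X"
  shows "ext_zero Q (Suc n) Y Y"
proof -
  obtain f g where f: "is_hom Q X Y f" and g: "is_hom Q Y X g"
    and gf: "\<And>i x. x \<in> sp X i \<Longrightarrow> g i (f i x) = x" and fg: "\<And>i y. y \<in> sp Y i \<Longrightarrow> f i (g i y) = y"
    using iso unfolding rep_iso_def by blast
  obtain P d e where res: "proj_resolution Q X P d e"
    and coc: "\<And>u. cocycle Q X P d (Suc n) u \<Longrightarrow> coboundary Q X P d (Suc n) u"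
    using ext unfolding ext_zero_def by blast
  let ?e = "\<lambda>i x. f i (e i x)"
  have e: "is_hom Q (P 0) X e" and se: "surj_mor (P 0) X e" and ex: "exact_at (P 1) (P 0) (d 0) e"
    using res unfolding proj_resolution_def by auto
  have f0: "f i (e i x) = 0 \<longleftrightarrow> e i x = 0" if "x \<in> sp (P 0) i" for i x
  proof
    assume "f i (e i x) = 0"
    then have "g i 0 = e i x" using gf[OF is_homD(2)[OF e that]] by simp
    then show "e i x = 0" using is_hom_zero[OF Y g X] by simp
  qed (simp add: is_hom_zero[OF X f Y])
  have "f i ` e i ` sp (P 0) i = sp Y i" for i
  proof -
    have "y \<in> f i ` sp X i" if "y \<in> sp Y i" for y
      using fg[OF that] is_homD(2)[OF g that] by (intro image_eqI[of _ _ "g i y"]) simp_all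
    then have "f i ` sp X i = sp Y i" using is_homD(2)[OF f] by (intro equalityI image_subsetI subsetI)
    then show ?thesis using se unfolding surj_mor_def by simp
  qed
  then have "surj_mor (P 0) Y ?e" unfolding surj_mor_def by (simp add: image_image)
  moreover have "exact_at (P 1) (P 0) (d 0) ?e"
    using ex f0 unfolding exact_at_def by (simp cong: conj_cong)
  ultimately have res': "proj_resolution Q Y P d ?e"
    using res is_hom_compose[OF e f] unfolding proj_resolution_def by (elim conjE) (intro conjI)
  have "coboundary Q Y P d (Suc n) u" if u: "cocycle Q Y P d (Suc n) u" for u
  proof -
    have hu: "is_hom Q (P (Suc n)) Y u" using u unfolding cocycle_def by blast
    have "cocycle Q X P d (Suc n) (\<lambda>i x. g i (u i x))"
      using u is_hom_compose[OF hu g] is_hom_zero[OF Y g X] unfolding cocycle_def by simp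
    from coc[OF this] obtain w where w: "is_hom Q (P n) X w"
      "\<And>i x. x \<in> sp (P (Suc n)) i \<Longrightarrow> g i (u i x) = w i (d n i x)" by auto
    have "u i x = f i (w i (d n i x))" if "x \<in> sp (P (Suc n)) i" for i x
      using w(2)[OF that] fg[OF is_homD(2)[OF hu that]] by simp
    then show ?thesis using is_hom_compose[OF w(1) f] by auto
  qed
  then show ?thesis unfolding ext_zero_def using res' by blast
qed

definition brick :: "('q, 'a) quiver \<Rightarrow> ('k::field, 'q, 'a, 'v::ab_group_add) rep \<Rightarrow> bool" where
  "brick Q X \<longleftrightarrow> (\<forall>f. is_hom Q X X f \<longrightarrow> (\<exists>!c. \<forall>i. \<forall>x\<in>sp X i. f i x = scl X c x))"

lemma exceptional_iff:
  "exceptional Q X \<longleftrightarrow> brick Q X \<and> (\<forall>n. ext_zero Q (Suc n) X X)"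
proof -
  have "(\<forall>n. n \<noteq> 0 \<longrightarrow> R n) \<longleftrightarrow> (\<forall>n. R (Suc n))" for R :: "nat \<Rightarrow> bool"
    by (metis not0_implies_Suc nat.distinct(1))
  then show ?thesis unfolding exceptional_def brick_def by simp
qed

lemma brick_iso:
  assumes "rep_iso Q X Y" "brick Q X"
  shows "brick Q Y"
proof -
  obtain f g where f: "is_hom Q X Y f" and g: "is_hom Q Y X g"
    and gf: "\<And>i x. x \<in> sp X i \<Longrightarrow> g i (f i x) = x" and fg: "\<And>i y. y \<in> sp Y i \<Longrightarrow> f i (g i y) = y"
    using assms(1) unfolding rep_iso_def by blast
  show ?thesis
    unfolding brick_def
  proof (intro allI impI)
    fix h assume h: "is_hom Q Y Y h"
    have eq: "(\<forall>i. \<forall>y\<in>sp Y i. h i y = scl Y c y) \<longleftrightarrow> (\<forall>i. \<forall>x\<in>sp X i. g i (h i (f i x)) = scl X c x)" for c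
    proof
      assume *: "\<forall>i. \<forall>y\<in>sp Y i. h i y = scl Y c y"
      show "\<forall>i. \<forall>x\<in>sp X i. g i (h i (f i x)) = scl X c x"
        using * is_homD(2)[OF f] gf linear_betweenD(3)[OF is_homD(1)[OF g]] by simp
    next
      assume *: "\<forall>i. \<forall>x\<in>sp X i. g i (h i (f i x)) = scl X c x"
      show "\<forall>i. \<forall>y\<in>sp Y i. h i y = scl Y c y"
      proof (intro allI ballI)
        fix i y assume y: "y \<in> sp Y i"
        have "g i (h i y) = scl X c (g i y)" using * is_homD(2)[OF g y] fg[OF y] by force
        then have "f i (g i (h i y)) = scl Y c (f i (g i y))"
          using linear_betweenD(3)[OF is_homD(1)[OF f] is_homD(2)[OF g y]] by simp
        then show "h i y = scl Y c y" using fg[OF y] fg[OF is_homD(2)[OF h y]] by simp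
      qed
    qed
    have "is_hom Q X X (\<lambda>i x. g i (h i (f i x)))"
      using is_hom_compose[OF is_hom_compose[OF f h] g] .
    then show "\<exists>!c. \<forall>i. \<forall>y\<in>sp Y i. h i y = scl Y c y"
      unfolding eq using assms(2) unfolding brick_def by blast
  qed
qed

lemma exceptional_iso:
  assumes "is_rep Q X" "is_rep Q Y" "rep_iso Q X Y" "exceptional Q X"
  shows "exceptional Q Y"
  using assms brick_iso ext_zero_iso unfolding exceptional_iff by blast


section \<open>Representations on coordinate spaces\<close>

text \<open>The index type stays open because the same scaling acts on coordinate vectors and on the
  vectors of unknowns in the linear systems below.\<close>

definition fscale :: "'k::field \<Rightarrow> ('i \<Rightarrow> 'k) \<Rightarrow> 'i \<Rightarrow> 'k" where
  "fscale c x = (\<lambda>i. c * x i)"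

lemma fscale_apply [simp]: "fscale c x i = c * x i"
  by (simp add: fscale_def)

interpretation fs: linear_operators fscale
  by unfold_locales (auto simp: fun_eq_iff algebra_simps)

lemma vector_space_fscale: "vector_space fscale"
  by unfold_locales

lemma sum_fun_apply: "(\<Sum>a\<in>A. f a) i = (\<Sum>a\<in>A. f a i)"
  by (induction A rule: infinite_finite_induct) auto

definition evec :: "nat \<Rightarrow> nat \<Rightarrow> 'k::field" where
  "evec i = (\<lambda>j. if j = i then 1 else 0)"

lemma evec_apply [simp]: "evec i j = (if j = i then 1 else 0)"
  by (simp add: evec_def)

lemma evec_in_kpow [simp]: "evec i \<in> kpow n \<longleftrightarrow> i < n"
  unfolding kpow_def by (auto simp: not_less)

lemma inj_evec: "inj (evec :: nat \<Rightarrow> nat \<Rightarrow> 'k::field)"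
proof (rule injI)
  fix i j assume "evec i = (evec j :: nat \<Rightarrow> 'k)"
  then have "evec i i = (evec j i :: 'k)" by simp
  then show "i = j" by (simp split: if_splits)
qed

lemma subspace_kpow [simp]: "fs.subspace (kpow n)"
  unfolding fs.subspace_def kpow_def by simp

lemma zero_in_kpow [simp]: "0 \<in> kpow n"
  by (simp add: kpow_def)

lemma kpow_0: "kpow 0 = {0}"
  unfolding kpow_def by (auto simp: fun_eq_iff)

lemma kpow_expansion:
  assumes "x \<in> kpow n"
  shows "x = (\<Sum>i<n. fscale (x i) (evec i))"
proof
  fix j
  show "x j = (\<Sum>i<n. fscale (x i) (evec i)) j"
  proof (cases "j < n")
    case True
    have "(\<Sum>i<n. fscale (x i) (evec i)) j = (\<Sum>i<n. if i = j then x i else 0)"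
      unfolding sum_fun_apply by (intro sum.cong) auto
    then show ?thesis using True by simp
  next
    case False
    then show ?thesis using assms by (auto simp: kpow_def sum_fun_apply intro!: sum.neutral[symmetric])
  qed
qed

lemma kpow_eq_span: "kpow n = fs.span (evec ` {..<n} :: (nat \<Rightarrow> 'k::field) set)"
proof
  show "kpow n \<subseteq> fs.span (evec ` {..<n} :: (nat \<Rightarrow> 'k) set)"
  proof
    fix x :: "nat \<Rightarrow> 'k" assume "x \<in> kpow n"
    then have "x = (\<Sum>i<n. fscale (x i) (evec i))" by (rule kpow_expansion)
    also have "\<dots> \<in> fs.span (evec ` {..<n})"
      by (intro fs.span_sum fs.span_scale fs.span_base) auto
    finally show "x \<in> fs.span (evec ` {..<n})" .
  qed
  show "fs.span (evec ` {..<n} :: (nat \<Rightarrow> 'k) set) \<subseteq> kpow n"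
    by (intro fs.span_minimal) auto
qed

lemma independent_evec: "fs.independent (evec ` {..<n} :: (nat \<Rightarrow> 'k::field) set)"
proof (rule fs.independent_if_scalars_zero)
  fix f :: "(nat \<Rightarrow> 'k) \<Rightarrow> 'k" and x :: "nat \<Rightarrow> 'k"
  assume *: "(\<Sum>x\<in>evec ` {..<n}. fscale (f x) x) = 0" and "x \<in> evec ` {..<n}"
  then obtain i where i: "i < n" "x = evec i" by auto
  have "(\<Sum>j<n. fscale (f (evec j)) (evec j)) = (0 :: nat \<Rightarrow> 'k)"
    using * by (subst (asm) sum.reindex) (auto intro: inj_on_subset[OF inj_evec])
  then have "(\<Sum>j<n. fscale (f (evec j)) (evec j)) i = (0 :: 'k)" by (simp only: zero_fun_apply)
  moreover have "(\<Sum>j<n. fscale (f (evec j)) (evec j)) i = (\<Sum>j<n. if j = i then f (evec j) else 0)"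
    unfolding sum_fun_apply by (intro sum.cong) auto
  ultimately show "f x = 0" using i by simp
qed simp

lemma fin_subspace_kpow [simp]: "fs.fin_subspace (kpow n)"
  unfolding kpow_eq_span by (rule fs.fin_subspace_span) simp

lemma dim_kpow [simp]: "fs.dim (kpow n :: (nat \<Rightarrow> 'k::field) set) = n"
proof -
  have "fs.dim (kpow n :: (nat \<Rightarrow> 'k) set) = card (evec ` {..<n} :: (nat \<Rightarrow> 'k) set)"
    unfolding kpow_eq_span by (rule fs.dim_span_eq_card_independent[OF independent_evec])
  also have "\<dots> = n"
    by (subst card_image) (auto intro: inj_on_subset[OF inj_evec])
  finally show ?thesis .
qed

abbreviation lin :: "nat \<Rightarrow> nat \<Rightarrow> ((nat \<Rightarrow> 'k::field) \<Rightarrow> nat \<Rightarrow> 'k) \<Rightarrow> bool" where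
  "lin m n f \<equiv> linear_between fscale (kpow m) fscale (kpow n) f"

lemmas lin_in = linear_betweenD(1)[of fscale "kpow m" fscale "kpow n" for m n]
lemmas lin_add = linear_betweenD(2)[of fscale "kpow m" fscale "kpow n" for m n]
lemmas lin_scale = linear_betweenD(3)[of fscale "kpow m" fscale "kpow n" for m n]

lemma lin_zero: "lin m n f \<Longrightarrow> f 0 = 0"
  using linear_between_zero[OF vector_space_fscale vector_space_fscale, of "kpow m" "kpow n" f 0] by simp

lemma lin_extends:
  fixes f :: "(nat \<Rightarrow> 'k::field) \<Rightarrow> nat \<Rightarrow> 'k"
  assumes "lin m n f"
  obtains F where "Vector_Spaces.linear fscale fscale F" "\<And>x. x \<in> kpow m \<Longrightarrow> F x = f x"
proof (rule linear_extends_basis[OF vector_space_fscale vector_space_fscale kpow_eq_span assms])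
  fix F assume "Vector_Spaces.linear fscale fscale F" "\<And>x. x \<in> kpow m \<Longrightarrow> F x = f x"
  then show ?thesis by (rule that)
qed

lemma lin_diff:
  fixes f :: "(nat \<Rightarrow> 'k::field) \<Rightarrow> nat \<Rightarrow> 'k"
  assumes "lin m n f" "x \<in> kpow m" "y \<in> kpow m"
  shows "f (x - y) = f x - f y"
proof -
  obtain F where F: "Vector_Spaces.linear fscale fscale F" "\<And>x. x \<in> kpow m \<Longrightarrow> F x = f x"
    by (rule lin_extends[OF assms(1)]) blast
  interpret F: Vector_Spaces.linear fscale fscale F by (fact F(1))
  show ?thesis
    using F.diff[of x y] F(2) assms(2,3) fs.subspace_diff[OF subspace_kpow assms(2,3)] by simp
qed

lemma lin_sum:
  fixes f :: "(nat \<Rightarrow> 'k::field) \<Rightarrow> nat \<Rightarrow> 'k"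
  assumes "lin m n f" "\<And>i. i \<in> I \<Longrightarrow> x i \<in> kpow m"
  shows "f (\<Sum>i\<in>I. x i) = (\<Sum>i\<in>I. f (x i))"
proof -
  obtain F where F: "Vector_Spaces.linear fscale fscale F" "\<And>x. x \<in> kpow m \<Longrightarrow> F x = f x"
    by (rule lin_extends[OF assms(1)]) blast
  interpret F: Vector_Spaces.linear fscale fscale F by (fact F(1))
  have "f (\<Sum>i\<in>I. x i) = F (\<Sum>i\<in>I. x i)"
    using F(2)[OF fs.subspace_sum[OF subspace_kpow, of I x m]] assms(2) by simp
  also have "\<dots> = (\<Sum>i\<in>I. f (x i))"
    unfolding F.sum using assms(2) F(2) by (intro sum.cong) auto
  finally show ?thesis .
qed

lemma lin_expansion:
  assumes f: "lin m n f" and x: "x \<in> kpow m"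
  shows "f x = (\<Sum>i<m. fscale (x i) (f (evec i)))"
proof -
  have "f x = f (\<Sum>i<m. fscale (x i) (evec i))" using kpow_expansion[OF x] by simp
  also have "\<dots> = (\<Sum>i<m. f (fscale (x i) (evec i)))"
    by (rule lin_sum[OF f]) (auto intro: fs.subspace_scale)
  also have "\<dots> = (\<Sum>i<m. fscale (x i) (f (evec i)))"
    using lin_scale[OF f] by (intro sum.cong) auto
  finally show ?thesis .
qed

lemma lin_eq_on_basis:
  assumes "lin m n f" "lin m n' g" "\<And>i. i < m \<Longrightarrow> f (evec i) = g (evec i)" "x \<in> kpow m"
  shows "f x = g x"
  using lin_expansion[OF assms(1,4)] lin_expansion[OF assms(2,4)] assms(3) by simp

lemma lin_rank_nullity:
  fixes f :: "(nat \<Rightarrow> 'k::field) \<Rightarrow> nat \<Rightarrow> 'k"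
  assumes f: "lin m n f" and S: "fs.subspace S" "S \<subseteq> kpow m"
  shows "fs.dim {x\<in>S. f x = 0} + fs.dim (f ` S) = fs.dim S"
    and "fs.subspace {x\<in>S. f x = 0}" "fs.subspace (f ` S)"
proof -
  obtain F where F: "Vector_Spaces.linear fscale fscale F" "\<And>x. x \<in> kpow m \<Longrightarrow> F x = f x"
    by (rule lin_extends[OF f]) blast
  interpret F: Vector_Spaces.linear fscale fscale F by (fact F(1))
  have e: "S \<inter> {x. F x = 0} = {x\<in>S. f x = 0}" "F ` S = f ` S"
    using F(2) S(2) by (auto simp: subset_iff image_iff)
  have S': "fs.fin_subspace S" by (rule fs.fin_subspace_subset[OF fin_subspace_kpow S])
  show "fs.dim {x\<in>S. f x = 0} + fs.dim (f ` S) = fs.dim S"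
    using fs.rank_nullity[OF F(1) S'] unfolding e .
  show "fs.subspace {x\<in>S. f x = 0}"
    using fs.subspace_inter[OF S(1) F.subspace_kernel] unfolding e .
  show "fs.subspace (f ` S)"
    using F.subspace_image[OF S(1)] unfolding e .
qed

lemma lin_kernel_trivial:
  assumes "lin m n f" "\<And>x. x \<in> kpow m \<Longrightarrow> f x = 0 \<Longrightarrow> x = 0"
  shows "inj_on f (kpow m)" "fs.dim {x\<in>kpow m. f x = 0} = 0"
proof -
  show "inj_on f (kpow m)"
  proof (rule inj_onI)
    fix x y assume xy: "x \<in> kpow m" "y \<in> kpow m" "f x = f y"
    then have "f (x - y) = 0" using lin_diff[OF assms(1)] by simp
    then have "x - y = 0" by (rule assms(2)[OF fs.subspace_diff[OF subspace_kpow xy(1,2)]])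
    then show "x = y" by simp
  qed
  have "{x\<in>kpow m. f x = 0} = {0}" using assms(2) lin_zero[OF assms(1)] by auto
  then show "fs.dim {x\<in>kpow m. f x = 0} = 0"
    using fs.fin_subspace_dim_0[OF fs.fin_subspace_span[of "{}"]] by simp
qed

lemma lin_inj_le:
  assumes f: "lin m n f" and inj: "\<And>x. x \<in> kpow m \<Longrightarrow> f x = 0 \<Longrightarrow> x = 0"
  shows "m \<le> n"
  using lin_rank_nullity(1,3)[OF f subspace_kpow order.refl] lin_kernel_trivial(2)[OF assms]
    fs.fin_subspace_dim_mono[OF fin_subspace_kpow, of "f ` kpow m" n] lin_in[OF f] by (auto simp: image_subset_iff)

lemma lin_inj_surj:
  assumes f: "lin m n f" and inj: "\<And>x. x \<in> kpow m \<Longrightarrow> f x = 0 \<Longrightarrow> x = 0" and "n \<le> m"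
  shows "f ` kpow m = kpow n"
  using lin_rank_nullity(1,3)[OF f subspace_kpow order.refl] lin_kernel_trivial(2)[OF assms(1,2)]
    fs.fin_subspace_dim_eq[OF fin_subspace_kpow, of "f ` kpow m" n] lin_in[OF f] assms(3)
  by (auto simp: image_subset_iff)

lemma lin_surj_inj:
  assumes f: "lin m n f" and surj: "f ` kpow m = kpow n" and "m \<le> n" and x: "x \<in> kpow m" "f x = 0"
  shows "x = 0"
proof -
  let ?K = "{x\<in>kpow m. f x = 0}"
  have "fs.dim ?K = 0"
    using lin_rank_nullity(1)[OF f subspace_kpow order.refl] surj assms(3) by simp
  moreover have "fs.fin_subspace ?K"
    by (rule fs.fin_subspace_subset[OF fin_subspace_kpow lin_rank_nullity(2)[OF f subspace_kpow order.refl]]) auto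
  ultimately show ?thesis using fs.fin_subspace_dim_0[of ?K] x by auto
qed

section \<open>Passage to coordinate spaces\<close>

definition coord_rep ::
  "('q, 'a) quiver \<Rightarrow> ('k::field, 'q, 'a) std_rep \<Rightarrow> ('q \<Rightarrow> nat) \<Rightarrow> bool" where
  "coord_rep Q X n \<longleftrightarrow> is_rep Q X \<and> scl X = fscale \<and> (\<forall>i. sp X i = kpow (n i))"

lemma coord_rep_iff:
  "coord_rep Q X n \<longleftrightarrow> scl X = fscale \<and> (\<forall>i. sp X i = kpow (n i)) \<and>
     (\<forall>a. lin (n (src Q a)) (n (tgt Q a)) (mp X a))"
proof -
  have "\<exists>B. finite B \<and> kpow m = fs.span B" for m
    using kpow_eq_span by (intro exI[of _ "evec ` {..<m}"]) simp
  then show ?thesis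
    unfolding coord_rep_def is_rep_def using vector_space_fscale by auto
qed

lemma span_iso_kpow:
  fixes s :: "'k::field \<Rightarrow> 'v::ab_group_add \<Rightarrow> 'v"
  assumes s: "vector_space s" and B: "finite B" "V = module.span s B"
  obtains n f g where "linear_between s V fscale (kpow n) f" "linear_between fscale (kpow n) s V g"
    "\<And>x. x \<in> V \<Longrightarrow> g (f x) = x" "\<And>y. y \<in> kpow n \<Longrightarrow> f (g y) = y"
proof -
  interpret s: vector_space s by fact
  interpret vk: vector_space_pair s "fscale :: 'k \<Rightarrow> (nat \<Rightarrow> 'k) \<Rightarrow> _"
    by unfold_locales
  interpret kv: vector_space_pair "fscale :: 'k \<Rightarrow> (nat \<Rightarrow> 'k) \<Rightarrow> _" s
    by unfold_locales
  obtain C where C: "C \<subseteq> B" "s.independent C" "B \<subseteq> s.span C"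
    using s.maximal_independent_subset[of B] by auto
  have finC: "finite C" using C(1) B(1) by (rule finite_subset)
  have V: "V = s.span C"
    unfolding B(2) using s.span_mono[OF C(1)] s.span_minimal[OF C(3) s.subspace_span]
    by (intro subset_antisym)
  let ?n = "card C"
  obtain b where b: "bij_betw b {..<?n} C"
    using ex_bij_betw_nat_finite[OF finC] by (auto simp: atLeast0LessThan)
  define b' where "b' = inv_into {..<?n} b"
  have b'b: "b' (b i) = i" if "i < ?n" for i
    using b that unfolding b'_def by (simp add: bij_betw_def)
  have bb': "b (b' c) = c" "b' c < ?n" if "c \<in> C" for c
    using that b f_inv_into_f[of c b "{..<?n}"] inv_into_into[of c b "{..<?n}"]
    unfolding b'_def by (auto simp: bij_betw_def)
  obtain f where f: "Vector_Spaces.linear s fscale f" "\<forall>c\<in>C. f c = evec (b' c)"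
    using vk.linear_independent_extend[OF C(2), of "\<lambda>c. evec (b' c)"] by auto
  obtain g where g: "Vector_Spaces.linear fscale s g"
    "\<forall>x\<in>evec ` {..<?n}. g x = b (inv evec x)"
    using kv.linear_independent_extend[OF independent_evec, of ?n "\<lambda>x. b (inv evec x)"] by auto
  have ge: "g (evec i) = b i" if "i < ?n" for i
    using bspec[OF g(2), of "evec i"] that by (simp add: inv_f_f[OF inj_evec])
  interpret f: Vector_Spaces.linear s fscale f by (fact f(1))
  interpret g: Vector_Spaces.linear fscale s g by (fact g(1))
  have bC: "b i \<in> C" if "i < ?n" for i using b that by (auto simp: bij_betw_def)
  have gf: "g (f x) = x" if "x \<in> s.span C" for x
    using that
  proof (induction rule: s.span_induct_alt)
    case base show ?case by (simp only: f.zero g.zero)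
  next
    case (step c x y)
    then have "g (f x) = x" using f(2) ge bb' by simp
    then show ?case using step by (simp only: f.add f.scale g.add g.scale)
  qed
  have fg: "f (g y) = y" if "y \<in> fs.span (evec ` {..<?n})" for y
    using that
  proof (induction rule: fs.span_induct_alt)
    case base show ?case by (simp only: f.zero g.zero)
  next
    case (step c x y)
    then obtain i where "i < ?n" "x = evec i" by auto
    then have "f (g x) = x" using f(2) ge b'b bC by simp
    then show ?case using step by (simp only: f.add f.scale g.add g.scale)
  qed
  have fV: "f x \<in> kpow ?n" if "x \<in> V" for x
  proof -
    have "f ` C \<subseteq> evec ` {..<?n}" using f(2) bb' by auto
    then have "f ` s.span C \<subseteq> kpow ?n"
      unfolding f.span_image[symmetric] kpow_eq_span by (rule fs.span_mono)
    then show ?thesis using that V by blast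
  qed
  have gV: "g y \<in> V" if "y \<in> kpow ?n" for y
  proof -
    have "g ` evec ` {..<?n} \<subseteq> C" using ge bC by auto
    then have "g ` kpow ?n \<subseteq> V"
      unfolding V kpow_eq_span g.span_image[symmetric] by (rule s.span_mono)
    then show ?thesis using that by blast
  qed
  show ?thesis
  proof (rule that)
    show "linear_between s V fscale (kpow ?n) f"
      by (rule linear_imp_linear_between[OF f(1) fV])
    show "linear_between fscale (kpow ?n) s V g"
      by (rule linear_imp_linear_between[OF g(1) gV])
  qed (use gf fg V in \<open>auto simp: kpow_eq_span\<close>)
qed

text \<open>Transport of structure along coordinate isomorphisms, one for each vertex; it removes
  the arbitrary carrier type of X.\<close>

lemma coord_rep_exists:
  fixes X :: "('k::field, 'q, 'a, 'v::ab_group_add) rep"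
  assumes X: "is_rep Q X"
  obtains Y n where "coord_rep Q Y n" "rep_iso Q X Y"
proof -
  have vs: "vector_space (scl X)" using X unfolding is_rep_def by blast
  have "\<exists>n f g. linear_between (scl X) (sp X i) fscale (kpow n) f \<and> linear_between fscale (kpow n) (scl X) (sp X i) g
    \<and> (\<forall>x\<in>sp X i. g (f x) = x) \<and> (\<forall>y\<in>kpow n. f (g y) = y)" for i
  proof -
    obtain B where B: "finite B" "sp X i = module.span (scl X) B"
      using X unfolding is_rep_def by blast
    show ?thesis by (rule span_iso_kpow[OF vs B]) blast
  qed
  then obtain n f g where f: "\<And>i. linear_between (scl X) (sp X i) fscale (kpow (n i)) (f i)"
    and g: "\<And>i. linear_between fscale (kpow (n i)) (scl X) (sp X i) (g i)"
    and gf: "\<And>i x. x \<in> sp X i \<Longrightarrow> g i (f i x) = x" and fg: "\<And>i y. y \<in> kpow (n i) \<Longrightarrow> f i (g i y) = y"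
    by metis
  define Y :: "('k, 'q, 'a) std_rep" where
    "Y = \<lparr>scl = fscale, sp = (\<lambda>i. kpow (n i)), mp = (\<lambda>a x. f (tgt Q a) (mp X a (g (src Q a) x)))\<rparr>"
  have mpX: "linear_between (scl X) (sp X (src Q a)) (scl X) (sp X (tgt Q a)) (mp X a)" for a
    using X unfolding is_rep_def by blast
  have "coord_rep Q Y n"
    unfolding coord_rep_iff Y_def
    using linear_between_compose[OF linear_between_compose[OF g mpX] f] by simp
  moreover have "is_hom Q X Y f"
    unfolding is_hom_def Y_def using f gf by simp
  moreover have "is_hom Q Y X g"
    unfolding is_hom_def Y_def using g gf linear_betweenD(1)[OF mpX] linear_betweenD(1)[OF g] by simp
  moreover have "\<forall>i. \<forall>y\<in>sp Y i. f i (g i y) = y" using fg unfolding Y_def by simp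
  ultimately have "rep_iso Q X Y" using gf unfolding rep_iso_def by blast
  with \<open>coord_rep Q Y n\<close> show ?thesis by (rule that)
qed


section \<open>Counting equations\<close>

text \<open>Gaussian elimination by induction on the set of equations. If equation j vanishes on all
  unit vectors of \<open>I\<close>, it holds for every vector supported there; otherwise one unknown
  serves as a pivot and is solved for.\<close>

lemma linear_system_nontrivial_solution:
  fixes L :: "('i \<Rightarrow> 'k::field) \<Rightarrow> 'j \<Rightarrow> 'k"
  assumes "finite J" "finite I" "card J < card I"
    and "\<And>x y. L (x + y) = L x + L y" "\<And>c x. L (fscale c x) = fscale c (L x)"
  shows "\<exists>x. (\<exists>i. x i \<noteq> 0) \<and> (\<forall>i. i \<notin> I \<longrightarrow> x i = 0) \<and> (\<forall>j\<in>J. L x j = 0)"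
  using assms
proof (induction J arbitrary: I L rule: finite_induct)
  case empty
  then obtain i0 where "i0 \<in> I" by fastforce
  then show ?case by (intro exI[of _ "\<lambda>i. if i = i0 then 1 else 0"]) auto
next
  case (insert j J)
  define e :: "'i \<Rightarrow> 'i \<Rightarrow> 'k" where "e = (\<lambda>i k. if k = i then 1 else 0)"
  note add = insert.prems(3) and scale = insert.prems(4)
  have L0: "L 0 = 0"
  proof -
    have "L (fscale 0 0) = fscale 0 (L 0)" by (rule scale)
    then show ?thesis by (simp only: fs.scale_zero_left)
  qed
  have Lsum: "L (\<Sum>i\<in>A. f i) = (\<Sum>i\<in>A. L (f i))" for A :: "'i set" and f
    by (induction A rule: infinite_finite_induct) (simp_all only: sum.infinite sum.empty sum.insert L0 add not_False_eq_True)
  show ?case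
  proof (cases "\<exists>i\<in>I. L (e i) j \<noteq> 0")
    case False
    obtain i0 where i0: "i0 \<in> I" using insert.prems(1,2) by fastforce
    have "card J < card (I - {i0})" using insert i0 by simp
    then obtain x where
      x: "\<exists>i. x i \<noteq> 0" "\<forall>i. i \<notin> I - {i0} \<longrightarrow> x i = 0" "\<forall>j\<in>J. L x j = 0"
      using insert.IH[of "I - {i0}" L] finite_Diff[OF insert.prems(1)] add scale by blast
    have "x = (\<Sum>i\<in>I. fscale (x i) (e i))"
    proof
      fix k
      have "(\<Sum>i\<in>I. fscale (x i) (e i)) k = (\<Sum>i\<in>I. if i = k then x i else 0)"
        unfolding sum_fun_apply e_def by (intro sum.cong) auto
      then show "x k = (\<Sum>i\<in>I. fscale (x i) (e i)) k" using x(2) insert.prems(1) by simp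
    qed
    then have "L x = L (\<Sum>i\<in>I. fscale (x i) (e i))" by (rule arg_cong)
    also have "\<dots> = (\<Sum>i\<in>I. fscale (x i) (L (e i)))" by (simp only: Lsum scale)
    finally have "L x j = 0" using False by (simp add: sum_fun_apply)
    then show ?thesis using x by (intro exI[of _ x]) auto
  next
    case True
    then obtain i0 where i0: "i0 \<in> I" "L (e i0) j \<noteq> 0" by blast
    \<comment> \<open>\<open>R\<close> changes only the pivot coordinate \<open>i0\<close>, by
      exactly the amount that makes equation j hold. It is linear in x, so the remaining equations
      can be imposed on \<open>R x\<close> with x free of \<open>i0\<close>.\<close>
    define R where "R = (\<lambda>x. x + fscale (- (L x j / L (e i0) j)) (e i0))"
    have Radd: "R (x + y) = R x + R y" for x y
      unfolding R_def add by (simp add: fun_eq_iff add_divide_distrib algebra_simps)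
    have Rscale: "R (fscale c x) = fscale c (R x)" for c x
      unfolding R_def scale by (simp add: fun_eq_iff algebra_simps)
    have Rj: "L (R x) j = 0" for x
      unfolding R_def add scale using i0 by simp
    have "card J < card (I - {i0})" using insert i0 by simp
    moreover have "L (R (x + y)) = L (R x) + L (R y)" "L (R (fscale c x)) = fscale c (L (R x))" for x y c
      by (simp_all only: Radd Rscale add scale)
    ultimately obtain x where
      x: "\<exists>i. x i \<noteq> 0" "\<forall>i. i \<notin> I - {i0} \<longrightarrow> x i = 0" "\<forall>j\<in>J. L (R x) j = 0"
      using insert.IH[of "I - {i0}" "\<lambda>x. L (R x)"] finite_Diff[OF insert.prems(1)] by blast
    then obtain i where i: "x i \<noteq> 0" "i \<in> I - {i0}" by blast
    have "R x i \<noteq> 0" using i unfolding R_def e_def by simp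
    moreover have "R x k = 0" if "k \<notin> I" for k
      using that x(2) i0 unfolding R_def e_def by auto
    ultimately show ?thesis using x(3) Rj by (intro exI[of _ "R x"]) auto
  qed
qed

text \<open>One linear system for three purposes. The unknowns are the matrix entries of h and, if
  \<open>inhom\<close>, the factor t of the inhomogeneous term; the equations are the entries of the
  intertwining relations and, if \<open>nrm\<close>, the vanishing of the corner entry at
  \<open>v0\<close>, by which the nonzero scalars are excluded when X = Y.\<close>

lemma intertwiner_system:
  fixes Q :: "('q::finite, 'a::finite) quiver" and X Y :: "('k::field, 'q, 'a) std_rep"
  assumes X: "coord_rep Q X n" and Y: "coord_rep Q Y m"
    and \<phi>: "\<And>a. lin (n (src Q a)) (m (tgt Q a)) (\<phi> a)"
    and less: "(\<Sum>a\<in>UNIV. n (src Q a) * m (tgt Q a)) + of_bool nrm < (\<Sum>v\<in>UNIV. n v * m v) + of_bool inhom"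
    and v0: "n v0 > 0" "m v0 > 0"
  obtains h t where "\<And>v. lin (n v) (m v) (h v)"
    "\<And>a x. x \<in> kpow (n (src Q a)) \<Longrightarrow> h (tgt Q a) (mp X a x) = mp Y a (h (src Q a) x) + fscale t (\<phi> a x)"
    "nrm \<Longrightarrow> h v0 (evec 0) 0 = 0" "\<not> inhom \<Longrightarrow> t = 0"
    "t \<noteq> 0 \<or> (\<exists>v. \<exists>x\<in>kpow (n v). h v x \<noteq> 0)"
proof -
  have linX: "lin (n (src Q a)) (n (tgt Q a)) (mp X a)" for a
    using X unfolding coord_rep_iff by blast
  have linY: "lin (m (src Q a)) (m (tgt Q a)) (mp Y a)" for a
    using Y unfolding coord_rep_iff by blast
  \<comment> \<open>\<open>None\<close> stands for the unknown t in \<open>I\<close> and for the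
    normalising equation in \<open>J\<close>; the triples number matrix entries.\<close>
  define I where "I = Some ` (SIGMA v:(UNIV::'q set). {..<m v} \<times> {..<n v}) \<union> (if inhom then {None} else {})"
  define J where "J = Some ` (SIGMA a:(UNIV::'a set). {..<m (tgt Q a)} \<times> {..<n (src Q a)}) \<union> (if nrm then {None} else {})"
  define H :: "(('q \<times> nat \<times> nat) option \<Rightarrow> 'k) \<Rightarrow> 'q \<Rightarrow> (nat \<Rightarrow> 'k) \<Rightarrow> nat \<Rightarrow> 'k" where
    "H = (\<lambda>u v x i. if i < m v then \<Sum>j<n v. u (Some (v, i, j)) * x j else 0)"
  define L :: "(('q \<times> nat \<times> nat) option \<Rightarrow> 'k) \<Rightarrow> ('a \<times> nat \<times> nat) option \<Rightarrow> 'k" where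
    "L = (\<lambda>u k. case k of None \<Rightarrow> u (Some (v0, 0, 0))
      | Some (a, i, j) \<Rightarrow> H u (tgt Q a) (mp X a (evec j)) i - mp Y a (H u (src Q a) (evec j)) i - u None * \<phi> a (evec j) i)"
  have finI: "finite I" and finJ: "finite J" unfolding I_def J_def by auto
  have cI: "card I = (\<Sum>v\<in>UNIV. n v * m v) + of_bool inhom"
  proof -
    have "card I = card (Some ` (SIGMA v:(UNIV::'q set). {..<m v} \<times> {..<n v})) + of_bool inhom"
      unfolding I_def by (auto simp: card_insert_if)
    then show ?thesis by (simp add: card_image mult.commute)
  qed
  have cJ: "card J = (\<Sum>a\<in>UNIV. n (src Q a) * m (tgt Q a)) + of_bool nrm"
  proof -
    have "card J = card (Some ` (SIGMA a:(UNIV::'a set). {..<m (tgt Q a)} \<times> {..<n (src Q a)})) + of_bool nrm"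
      unfolding J_def by (auto simp: card_insert_if)
    then show ?thesis by (simp add: card_image mult.commute)
  qed
  have linH: "lin (n v) (m v) (H u v)" for u v
    unfolding linear_between_def H_def kpow_def
    by (auto simp: fun_eq_iff distrib_left sum.distrib sum_distrib_left algebra_simps)
  have Hk: "H u v x \<in> kpow (m v)" for u v x
    unfolding H_def kpow_def by simp
  have Hadd: "H (u + w) v x = H u v x + H w v x" for u w v x
    unfolding H_def by (simp add: fun_eq_iff distrib_right sum.distrib)
  have Hscale: "H (fscale c u) v x = fscale c (H u v x)" for c u v x
    unfolding H_def by (simp add: fun_eq_iff sum_distrib_left mult.assoc)
  have "L (u + w) = L u + L w" for u w
    unfolding L_def Hadd
    by (auto simp: fun_eq_iff lin_add[OF linY Hk Hk] algebra_simps split: option.split)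
  moreover have "L (fscale c u) = fscale c (L u)" for c u
    unfolding L_def Hscale
    by (auto simp: fun_eq_iff lin_scale[OF linY Hk] algebra_simps split: option.split)
  ultimately have "\<exists>u. (\<exists>i. u i \<noteq> 0) \<and> (\<forall>i. i \<notin> I \<longrightarrow> u i = 0) \<and> (\<forall>j\<in>J. L u j = 0)"
    using linear_system_nontrivial_solution[OF finJ finI, of L] less unfolding cI cJ by blast
  then obtain u where u: "\<exists>i. u i \<noteq> 0" "\<And>i. i \<notin> I \<Longrightarrow> u i = 0" "\<And>j. j \<in> J \<Longrightarrow> L u j = 0" by blast
  have Hevec: "H u v (evec j) i = u (Some (v, i, j))" if "i < m v" "j < n v" for v i j
  proof -
    have "H u v (evec j) i = (\<Sum>k<n v. if k = j then u (Some (v, i, k)) else 0)"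
      unfolding H_def if_P[OF that(1)] by (intro sum.cong) simp_all
    then show ?thesis using that by simp
  qed
  show ?thesis
  proof (rule that[of "H u" "u None"])
    fix a and x :: "nat \<Rightarrow> 'k" assume x: "x \<in> kpow (n (src Q a))"
    let ?f = "\<lambda>x. H u (tgt Q a) (mp X a x)"
    let ?g = "\<lambda>x. mp Y a (H u (src Q a) x) + fscale (u None) (\<phi> a x)"
    have f: "lin (n (src Q a)) (m (tgt Q a)) ?f"
      by (rule linear_between_compose[OF linX linH])
    have g: "lin (n (src Q a)) (m (tgt Q a)) ?g"
      by (intro linear_between_add linear_between_scale linear_between_compose[OF linH linY] \<phi> vector_space_fscale subspace_kpow)
    show "?f x = ?g x"
    proof (rule lin_eq_on_basis[OF f g _ x])
      fix j assume j: "j < n (src Q a)"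
      show "?f (evec j) = ?g (evec j)"
      proof
        fix i
        show "?f (evec j) i = ?g (evec j) i"
        proof (cases "i < m (tgt Q a)")
          case True
          then have "Some (a, i, j) \<in> J" using j unfolding J_def by auto
          from u(3)[OF this] show ?thesis unfolding L_def by (simp add: algebra_simps)
        next
          case False
          have "?f (evec j) \<in> kpow (m (tgt Q a))" "?g (evec j) \<in> kpow (m (tgt Q a))"
            using linear_betweenD(1)[OF f, of "evec j"] linear_betweenD(1)[OF g, of "evec j"] j by auto
          then show ?thesis using False unfolding kpow_def by simp
        qed
      qed
    qed
  next
    assume nrm
    then have "None \<in> J" unfolding J_def by simp
    from u(3)[OF this] show "H u v0 (evec 0) 0 = 0" using Hevec v0 unfolding L_def by simp
  next
    assume "\<not> inhom"
    then have "None \<notin> I" unfolding I_def by auto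
    then show "u None = 0" by (rule u(2))
  next
    obtain k where k: "u k \<noteq> 0" using u(1) by blast
    show "u None \<noteq> 0 \<or> (\<exists>v. \<exists>x\<in>kpow (n v). H u v x \<noteq> 0)"
    proof (cases k)
      case None
      then show ?thesis using k by simp
    next
      case (Some w)
      obtain v i j where w: "w = (v, i, j)" by (cases w) auto
      have "k \<in> I" using u(2) k by blast
      then have ij: "i < m v" "j < n v" unfolding I_def Some w by (auto split: if_splits)
      then have "H u v (evec j) i \<noteq> 0" using Hevec k Some w by simp
      then have "H u v (evec j) \<noteq> 0" by (auto simp: fun_eq_iff)
      then show ?thesis using ij by (intro disjI2 exI[of _ v] bexI[of _ "evec j"]) auto
    qed
  qed (rule linH)
qed

text \<open>The hypothesis says that the Euler form dim Hom(X, Y) - dim Ext(X, Y) of the two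
  dimension vectors is positive.\<close>

lemma nonzero_hom_exists:
  fixes Q :: "('q::finite, 'a::finite) quiver" and X Y :: "('k::field, 'q, 'a) std_rep"
  assumes X: "coord_rep Q X n" and Y: "coord_rep Q Y m"
    and less: "(\<Sum>a\<in>UNIV. n (src Q a) * m (tgt Q a)) < (\<Sum>v\<in>UNIV. n v * m v)"
  obtains h v x where "is_hom Q X Y h" "x \<in> sp X v" "h v x \<noteq> 0"
proof -
  have "(\<Sum>v\<in>UNIV. n v * m v) \<noteq> 0" using less by linarith
  then obtain v0 where v0: "n v0 > 0" "m v0 > 0" by (auto simp: sum_eq_0_iff)
  have 0: "lin p q (\<lambda>x. 0 :: nat \<Rightarrow> 'k)" for p q
    by (intro linear_between_const_zero vector_space_fscale subspace_kpow)
  obtain h t where h: "\<And>v. lin (n v) (m v) (h v)"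
    "\<And>a x. x \<in> kpow (n (src Q a)) \<Longrightarrow> h (tgt Q a) (mp X a x) = mp Y a (h (src Q a) x) + fscale t 0"
    "t = 0" "t \<noteq> 0 \<or> (\<exists>v. \<exists>x\<in>kpow (n v). h v x \<noteq> 0)"
    by (rule intertwiner_system[OF X Y 0, of False False v0]) (use less v0 in auto)
  have "is_hom Q X Y h"
    using X Y h(1,2) unfolding coord_rep_def is_hom_def by simp
  moreover obtain v x where "x \<in> sp X v" "h v x \<noteq> 0"
    using h(3,4) X unfolding coord_rep_def by auto
  ultimately show ?thesis by (rule that)
qed

text \<open>For a quiver without relations the cokernel of \<sigma> \<mapsto> \<sigma> a - a
  \<sigma>, taken over all arrows a, is the first Ext group of X with itself. Thus this is its
  vanishing, stated without a resolution.\<close>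

definition rigid :: "('q, 'a) quiver \<Rightarrow> ('k::field, 'q, 'a, 'v::ab_group_add) rep \<Rightarrow> bool" where
  "rigid Q X \<longleftrightarrow> (\<forall>\<phi>. (\<forall>a. linear_between (scl X) (sp X (src Q a)) (scl X) (sp X (tgt Q a)) (\<phi> a)) \<longrightarrow>
     (\<exists>\<sigma>. (\<forall>i. linear_between (scl X) (sp X i) (scl X) (sp X i) (\<sigma> i)) \<and>
          (\<forall>a. \<forall>x\<in>sp X (src Q a). \<phi> a x = \<sigma> (tgt Q a) (mp X a x) - mp X a (\<sigma> (src Q a) x))))"

text \<open>The scalar by which h acts can be read off from a single matrix entry, so one equation
  is enough to force h = 0.\<close>

lemma brick_scalar_zero:
  assumes X: "coord_rep Q X n" and b: "brick Q X" and h: "is_hom Q X X h"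
    and v0: "n v0 > 0" "h v0 (evec 0) 0 = 0" and x: "x \<in> kpow (n v)"
  shows "h v x = 0"
proof -
  obtain c where c: "\<And>i x. x \<in> sp X i \<Longrightarrow> h i x = scl X c x"
    using b h unfolding brick_def by blast
  have "h v0 (evec 0) = fscale c (evec 0)"
    using c[of "evec 0" v0] X v0(1) unfolding coord_rep_def by simp
  then have "c = 0" using v0(2) by simp
  then show ?thesis using c[of x v] X x unfolding coord_rep_def by (simp add: fun_eq_iff)
qed

lemma brick_nonzero:
  fixes X :: "('k::field, 'q, 'a) std_rep"
  assumes X: "coord_rep Q X n" and b: "brick Q X"
  shows "\<exists>v. n v > 0"
proof (rule ccontr)
  assume "\<not> (\<exists>v. n v > 0)"
  then have sp: "sp X i = {0}" for i
    using X kpow_0 unfolding coord_rep_def by (metis neq0_conv)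
  have "is_hom Q X X (\<lambda>i x. x)" by (simp add: is_hom_def linear_between_id)
  then have u: "\<exists>!c. \<forall>i. \<forall>x\<in>sp X i. x = scl X c x" using b unfolding brick_def by blast
  have "\<forall>i. \<forall>x\<in>sp X i. x = scl X c x" for c
    using X sp unfolding coord_rep_def by simp
  then have "(0 :: 'k) = 1" using u by blast
  then show False by simp
qed

text \<open>Otherwise the unknowns outnumber the equations even after normalisation, which yields a
  nonzero endomorphism whose scalar is 0.\<close>

lemma brick_euler_form_le:
  fixes Q :: "('q::finite, 'a::finite) quiver" and X :: "('k::field, 'q, 'a) std_rep"
  assumes X: "coord_rep Q X n" and b: "brick Q X"
  shows "(\<Sum>v\<in>UNIV. n v * n v) \<le> (\<Sum>a\<in>UNIV. n (src Q a) * n (tgt Q a)) + 1"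
proof (rule ccontr)
  assume less: "\<not> ?thesis"
  obtain v0 where v0: "n v0 > 0" using brick_nonzero[OF assms] by blast
  have 0: "lin p q (\<lambda>x. 0 :: nat \<Rightarrow> 'k)" for p q
    by (intro linear_between_const_zero vector_space_fscale subspace_kpow)
  obtain h t where h: "\<And>v. lin (n v) (n v) (h v)"
    "\<And>a x. x \<in> kpow (n (src Q a)) \<Longrightarrow> h (tgt Q a) (mp X a x) = mp X a (h (src Q a) x) + fscale t 0"
    "h v0 (evec 0) 0 = 0" "t = 0" "t \<noteq> 0 \<or> (\<exists>v. \<exists>x\<in>kpow (n v). h v x \<noteq> 0)"
    by (rule intertwiner_system[OF X X 0, of True False v0]) (use less v0 in auto)
  have "is_hom Q X X h"
    using X h(1,2) unfolding coord_rep_def is_hom_def by simp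
  from brick_scalar_zero[OF X b this v0 h(3)] show False using h(4,5) by blast
qed

text \<open>With t as an additional unknown and the normalisation as an additional equation, the
  system for \<phi> has exactly one unknown more than equations. A solution with t = 0 would be a
  normalised nonzero endomorphism; hence t is invertible and \<sigma> = h / t.\<close>

lemma brick_imp_rigid:
  fixes Q :: "('q::finite, 'a::finite) quiver" and X :: "('k::field, 'q, 'a) std_rep"
  assumes X: "coord_rep Q X n" and b: "brick Q X"
    and eq: "(\<Sum>v\<in>UNIV. n v * n v) = (\<Sum>a\<in>UNIV. n (src Q a) * n (tgt Q a)) + 1"
  shows "rigid Q X"
  unfolding rigid_def
proof (intro allI impI)
  fix \<phi> assume \<phi>: "\<forall>a. linear_between (scl X) (sp X (src Q a)) (scl X) (sp X (tgt Q a)) (\<phi> a)"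
  obtain v0 where v0: "n v0 > 0" using brick_nonzero[OF X b] by blast
  have \<phi>': "lin (n (src Q a)) (n (tgt Q a)) (\<phi> a)" for a
    using \<phi> X unfolding coord_rep_def by simp
  obtain h t where h: "\<And>v. lin (n v) (n v) (h v)"
    "\<And>a x. x \<in> kpow (n (src Q a)) \<Longrightarrow> h (tgt Q a) (mp X a x) = mp X a (h (src Q a) x) + fscale t (\<phi> a x)"
    "h v0 (evec 0) 0 = 0" "t \<noteq> 0 \<or> (\<exists>v. \<exists>x\<in>kpow (n v). h v x \<noteq> 0)"
  proof (rule intertwiner_system[OF X X \<phi>', of True True v0])
    fix h t assume "\<And>v. lin (n v) (n v) (h v)"
      "\<And>a x. x \<in> kpow (n (src Q a)) \<Longrightarrow> h (tgt Q a) (mp X a x) = mp X a (h (src Q a) x) + fscale t (\<phi> a x)"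
      "True \<Longrightarrow> h v0 (evec 0) 0 = 0" "t \<noteq> 0 \<or> (\<exists>v. \<exists>x\<in>kpow (n v). h v x \<noteq> 0)"
    then show thesis by (intro that) simp_all
  qed (use eq v0 in auto)
  have linX: "lin (n (src Q a)) (n (tgt Q a)) (mp X a)" for a
    using X unfolding coord_rep_iff by blast
  have "t \<noteq> 0"
  proof
    assume t: "t = 0"
    have "is_hom Q X X h"
      using X h(1,2) t unfolding coord_rep_def is_hom_def by simp
    from brick_scalar_zero[OF X b this v0 h(3)] show False using h(4) t by blast
  qed
  let ?\<sigma> = "\<lambda>i x. fscale (1 / t) (h i x)"
  have "linear_between (scl X) (sp X i) (scl X) (sp X i) (?\<sigma> i)" for i
  proof -
    have "lin (n i) (n i) (?\<sigma> i)"
      by (intro linear_between_scale h(1) vector_space_fscale subspace_kpow)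
    then show ?thesis using X unfolding coord_rep_def by simp
  qed
  moreover have "\<phi> a x = ?\<sigma> (tgt Q a) (mp X a x) - mp X a (?\<sigma> (src Q a) x)" if "x \<in> sp X (src Q a)" for a x
  proof -
    have x: "x \<in> kpow (n (src Q a))" using that X unfolding coord_rep_def by simp
    show ?thesis
      unfolding h(2)[OF x] lin_scale[OF linX lin_in[OF h(1) x]]
      using \<open>t \<noteq> 0\<close> by (simp add: fun_eq_iff distrib_left)
  qed
  ultimately show "\<exists>\<sigma>. (\<forall>i. linear_between (scl X) (sp X i) (scl X) (sp X i) (\<sigma> i)) \<and>
          (\<forall>a. \<forall>x\<in>sp X (src Q a). \<phi> a x = \<sigma> (tgt Q a) (mp X a x) - mp X a (\<sigma> (src Q a) x))"
    by (intro exI[of _ ?\<sigma>]) blast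
qed


section \<open>Rigidity\<close>

text \<open>The homomorphism theorem for maps given on subspaces: w takes equal values on vectors
  with the same image under f, so it can be evaluated at any preimage.\<close>

lemma linear_between_factor:
  assumes s: "vector_space s" and u: "vector_space u" and V: "module.subspace s V"
    and f: "linear_between s V t W f" and surj: "f ` V = W"
    and w: "linear_between s V u U w" and ker: "\<And>x. x \<in> V \<Longrightarrow> f x = 0 \<Longrightarrow> w x = 0"
  obtains g where "linear_between t W u U g" "\<And>x. x \<in> V \<Longrightarrow> g (f x) = w x"
proof -
  interpret s: vector_space s by fact
  define g where "g = (\<lambda>y. w (inv_into V f y))"
  have eq: "w x = w y" if "x \<in> V" "y \<in> V" "f x = f y" for x y
  proof -
    have xy: "x - y \<in> V" using s.subspace_diff[OF V that(1,2)] .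
    have "f x = f (x - y) + f y" using linear_betweenD(2)[OF f xy that(2)] by simp
    then have "w (x - y) = 0" using ker[OF xy] that(3) by simp
    moreover have "w x = w (x - y) + w y" using linear_betweenD(2)[OF w xy that(2)] by simp
    ultimately show ?thesis by simp
  qed
  have gf: "g (f x) = w x" if "x \<in> V" for x
    unfolding g_def using that
    by (intro eq) (auto intro: inv_into_into f_inv_into_f)
  have "linear_between t W u U g"
    unfolding linear_between_def surj[symmetric]
  proof (intro conjI ballI allI)
    fix y assume "y \<in> f ` V"
    then show "g y \<in> U" using gf linear_betweenD(1)[OF w] by auto
  next
    fix y z assume "y \<in> f ` V" "z \<in> f ` V"
    then obtain x x' where x: "x \<in> V" "x' \<in> V" "y = f x" "z = f x'" by blast
    have "g (y + z) = g (f (x + x'))" using x linear_betweenD(2)[OF f] by simp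
    also have "\<dots> = g y + g z"
      using x gf linear_betweenD(2)[OF w] s.subspace_add[OF V] by simp
    finally show "g (y + z) = g y + g z" .
  next
    fix c y assume "y \<in> f ` V"
    then obtain x where x: "x \<in> V" "y = f x" by blast
    have "g (t c y) = g (f (s c x))" using x linear_betweenD(3)[OF f] by simp
    also have "\<dots> = u c (g y)"
      using x gf linear_betweenD(3)[OF w] s.subspace_scale[OF V] by simp
    finally show "g (t c y) = u c (g y)" .
  qed
  then show ?thesis using gf by (rule that)
qed

text \<open>Interleaving realises the direct sum of two coordinate spaces inside
  \<open>nat \<Rightarrow> 'k\<close>, so that an extension of X by itself is again a
  \<open>std_rep\<close> and can be fed into \<open>projective\<close>. Two copies of
  \<open>kpow n\<close> become \<open>kpow (2 * n)\<close>.\<close>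

definition evens :: "(nat \<Rightarrow> 'k) \<Rightarrow> nat \<Rightarrow> 'k" where "evens z = (\<lambda>i. z (2 * i))"

definition odds :: "(nat \<Rightarrow> 'k) \<Rightarrow> nat \<Rightarrow> 'k" where "odds z = (\<lambda>i. z (2 * i + 1))"

definition interleave :: "(nat \<Rightarrow> 'k) \<Rightarrow> (nat \<Rightarrow> 'k) \<Rightarrow> nat \<Rightarrow> 'k" where
  "interleave x y = (\<lambda>i. if even i then x (i div 2) else y (i div 2))"

lemma evens_interleave [simp]: "evens (interleave x y) = x"
  by (simp add: evens_def interleave_def)

lemma odds_interleave [simp]: "odds (interleave x y) = y"
  by (simp add: odds_def interleave_def)

lemma interleave_evens_odds [simp]: "interleave (evens z) (odds z) = z"
  by (rule ext) (auto simp: evens_def odds_def interleave_def elim: oddE)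

lemma interleave_in_kpow [simp]:
  "interleave x y \<in> kpow (2 * n) \<longleftrightarrow> x \<in> kpow n \<and> y \<in> kpow n"
proof
  assume *: "interleave x y \<in> kpow (2 * n)"
  show "x \<in> kpow n \<and> y \<in> kpow n"
    unfolding kpow_def
  proof (intro conjI CollectI allI impI)
    fix i assume "n \<le> i"
    then have "interleave x y (2 * i) = 0" "interleave x y (2 * i + 1) = 0"
      using * unfolding kpow_def by auto
    then show "x i = 0" "y i = 0" unfolding interleave_def by simp_all
  qed
next
  assume "x \<in> kpow n \<and> y \<in> kpow n"
  then show "interleave x y \<in> kpow (2 * n)"
    unfolding kpow_def interleave_def by (auto simp: less_eq_div_iff_mult_less_eq mult.commute)
qed

lemma lin_evens: "lin (2 * n) n evens" and lin_odds: "lin (2 * n) n odds"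
  unfolding linear_between_def kpow_def evens_def odds_def by (auto simp: fun_eq_iff)

lemma lin_interleave:
  fixes f g :: "(nat \<Rightarrow> 'k::field) \<Rightarrow> nat \<Rightarrow> 'k"
  assumes "lin m n f" "lin m n g"
  shows "lin m (2 * n) (\<lambda>x. interleave (f x) (g x))"
  unfolding linear_between_def
proof (intro conjI ballI allI)
  fix x :: "nat \<Rightarrow> 'k" assume x: "x \<in> kpow m"
  show "interleave (f x) (g x) \<in> kpow (2 * n)"
    using lin_in[OF assms(1) x] lin_in[OF assms(2) x] by simp
  fix c
  show "interleave (f (fscale c x)) (g (fscale c x)) = fscale c (interleave (f x) (g x))"
    unfolding lin_scale[OF assms(1) x] lin_scale[OF assms(2) x] by (simp add: interleave_def fun_eq_iff)
  fix y :: "nat \<Rightarrow> 'k" assume y: "y \<in> kpow m"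
  show "interleave (f (x + y)) (g (x + y)) = interleave (f x) (g x) + interleave (f y) (g y)"
    unfolding lin_add[OF assms(1) x y] lin_add[OF assms(2) x y] by (simp add: interleave_def fun_eq_iff)
qed

text \<open>
  A family \<open>\<phi>\<close> of linear maps along the arrows is the cocycle of the extension of \<open>X\<close> by itself
  with structure maps \<open>(x, y) \<mapsto> (a x + \<phi> a y, a y)\<close>; lifting the augmentation of the resolution
  to this extension and correcting the lift by the vanishing of \<open>Ext\<^sup>1\<close> yields a splitting.
\<close>

lemma ext_zero_imp_rigid:
  fixes X :: "('k::field, 'q, 'a) std_rep"
  assumes X: "coord_rep Q X n" and ext: "ext_zero Q (Suc 0) X X"
  shows "rigid Q X"
  unfolding rigid_def
proof (intro allI impI)
  fix \<phi> assume \<phi>: "\<forall>a. linear_between (scl X) (sp X (src Q a)) (scl X) (sp X (tgt Q a)) (\<phi> a)"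
  have sclX: "scl X = fscale" and spX: "sp X i = kpow (n i)" for i
    using X unfolding coord_rep_def by auto
  have repX: "is_rep Q X" using X unfolding coord_rep_def by blast
  have linX: "lin (n (src Q a)) (n (tgt Q a)) (mp X a)" for a
    using X unfolding coord_rep_iff by blast
  have lin\<phi>: "lin (n (src Q a)) (n (tgt Q a)) (\<phi> a)" for a
    using \<phi> by (simp add: sclX spX)
  define Z :: "('k, 'q, 'a) std_rep" where
    "Z = \<lparr>scl = fscale, sp = (\<lambda>i. kpow (2 * n i)),
      mp = (\<lambda>a z. interleave (mp X a (evens z) + \<phi> a (odds z)) (mp X a (odds z)))\<rparr>"
  have sclZ: "scl Z = fscale" and spZ: "sp Z i = kpow (2 * n i)"
    and mpZ: "mp Z a z = interleave (mp X a (evens z) + \<phi> a (odds z)) (mp X a (odds z))" for i a z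
    unfolding Z_def by simp_all
  have "lin (2 * n (src Q a)) (2 * n (tgt Q a)) (mp Z a)" for a
    unfolding Z_def rep.select_convs
    by (intro lin_interleave linear_between_add linear_between_compose[OF lin_evens linX]
        linear_between_compose[OF lin_odds lin\<phi>] linear_between_compose[OF lin_odds linX]
        vector_space_fscale subspace_kpow)
  then have "coord_rep Q Z (\<lambda>i. 2 * n i)"
    unfolding coord_rep_iff by (simp add: sclZ spZ)
  then have repZ: "is_rep Q Z" unfolding coord_rep_def by blast
  have homodds: "is_hom Q Z X (\<lambda>i. odds)"
    unfolding is_hom_def sclZ spZ sclX spX mpZ by (simp add: lin_odds)
  have surjodds: "surj_mor Z X (\<lambda>i. odds)"
    unfolding surj_mor_def spZ spX
  proof (intro allI equalityI image_subsetI subsetI)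
    fix i and x :: "nat \<Rightarrow> 'k" assume "x \<in> kpow (n i)"
    then show "x \<in> odds ` kpow (2 * n i)"
      by (intro image_eqI[of _ _ "interleave 0 x"]) simp_all
  qed (rule lin_in[OF lin_odds])
  obtain P d e where res: "proj_resolution Q X P d e"
    and coc: "\<And>u. cocycle Q X P d (Suc 0) u \<Longrightarrow> coboundary Q X P d (Suc 0) u"
    using ext unfolding ext_zero_def by blast
  have repP: "is_rep Q (P m)" and projP: "projective Q (P m)"
    and homd: "is_hom Q (P (Suc m)) (P m) (d m)"
    and exd: "exact_at (P (Suc (Suc m))) (P (Suc m)) (d (Suc m)) (d m)" for m
    using res unfolding proj_resolution_def by blast+
  have home: "is_hom Q (P 0) X e" and surje: "surj_mor (P 0) X e" and exe: "exact_at (P 1) (P 0) (d 0) e"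
    using res unfolding proj_resolution_def by blast+
  have "\<exists>e'. is_hom Q (P 0) Z e' \<and> (\<forall>i. \<forall>x\<in>sp (P 0) i. odds (e' i x) = e i x)"
    using projP[of 0, unfolded projective_def, rule_format, of Z X "\<lambda>i. odds" e]
      repZ repX homodds surjodds home by blast
  then obtain e' where home': "is_hom Q (P 0) Z e'"
    and e'e: "\<And>i x. x \<in> sp (P 0) i \<Longrightarrow> odds (e' i x) = e i x" by blast
  have ed: "e i (d 0 i x) = 0" if "x \<in> sp (P 1) i" for i x
    using exe that unfolding exact_at_def by blast
  have dd: "d 0 i (d 1 i x) = 0" if "x \<in> sp (P 2) i" for i x
    using exd[of 0] that unfolding exact_at_def by (auto simp: numeral_2_eq_2)
  have e'mp: "evens (e' (tgt Q a) (mp (P 0) a y)) = mp X a (evens (e' (src Q a) y)) + \<phi> a (e (src Q a) y)"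
    if "y \<in> sp (P 0) (src Q a)" for a y
    using is_homD(3)[OF home' that] e'e[OF that] by (simp add: mpZ)
  \<comment> \<open>Since \<open>odds\<close> of the lift is e and e kills the image of
    \<open>d 0\<close>, the lift maps that image into the even copy of X. The \<phi> term drops out
    there, so \<open>evens\<close> commutes with the structure maps and c is a morphism to
    X.\<close>
  define c where "c = (\<lambda>i x. evens (e' i (d 0 i x)))"
  have line': "linear_between (scl (P 0)) (sp (P 0) i) fscale (kpow (n i)) (\<lambda>y. evens (e' i y))" for i
    using linear_between_compose[OF is_homD(1)[OF home', unfolded sclZ spZ] lin_evens] .
  have "is_hom Q (P 1) X c"
    unfolding is_hom_def sclX spX c_def
  proof (intro conjI allI ballI)
    fix i show "linear_between (scl (P 1)) (sp (P 1) i) fscale (kpow (n i)) (\<lambda>x. evens (e' i (d 0 i x)))"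
      using linear_between_compose[OF is_homD(1)[OF homd[of 0]] line'] by simp
  next
    fix a x assume x: "x \<in> sp (P 1) (src Q a)"
    have dx: "d 0 (src Q a) x \<in> sp (P 0) (src Q a)"
      using is_homD(2)[OF homd[of 0]] x by simp
    have "d 0 (tgt Q a) (mp (P 1) a x) = mp (P 0) a (d 0 (src Q a) x)"
      using is_homD(3)[OF homd[of 0]] x by simp
    then show "evens (e' (tgt Q a) (d 0 (tgt Q a) (mp (P 1) a x))) = mp X a (evens (e' (src Q a) (d 0 (src Q a) x)))"
      using e'mp[OF dx] ed[OF x] lin_zero[OF lin\<phi>] by simp
  qed
  moreover have "c i (d 1 i x) = 0" if "x \<in> sp (P 2) i" for i x
  proof -
    have "c i (d 1 i x) = evens 0"
      unfolding c_def dd[OF that] is_hom_zero[OF repP home' repZ] ..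
    also have "\<dots> = 0" by (rule lin_zero[OF lin_evens])
    finally show ?thesis .
  qed
  ultimately have "cocycle Q X P d (Suc 0) c"
    unfolding cocycle_def by (simp add: numeral_2_eq_2)
  from coc[OF this] obtain g where homg: "is_hom Q (P 0) X g"
    and cg: "\<And>i x. x \<in> sp (P 1) i \<Longrightarrow> c i x = g i (d 0 i x)" by auto
  \<comment> \<open>Subtracting g makes the even part of the lift vanish on the kernel of e, so it
    descends to \<sigma> on X. The even part fails to commute with the structure maps exactly by
    \<phi>, and subtracting a morphism does not change this.\<close>
  let ?w = "\<lambda>i y. evens (e' i y) + - g i y"
  have linw: "linear_between (scl (P 0)) (sp (P 0) i) fscale (kpow (n i)) (?w i)" for i
    using is_homD(1)[OF homg, of i]
    by (intro linear_between_add linear_between_minus line' vector_space_fscale subspace_kpow) (simp_all add: sclX spX)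
  have "\<exists>\<sigma>. lin (n i) (n i) \<sigma> \<and> (\<forall>y\<in>sp (P 0) i. \<sigma> (e i y) = ?w i y)" for i
  proof -
    have vs: "vector_space (scl (P 0))" using repP unfolding is_rep_def by blast
    have ker: "?w i y = 0" if y: "y \<in> sp (P 0) i" "e i y = 0" for y
    proof -
      obtain x where x: "x \<in> sp (P 1) i" "y = d 0 i x"
        using exe y unfolding exact_at_def by blast
      show ?thesis using cg[OF x(1)] unfolding c_def x(2) by simp
    qed
    have line: "linear_between (scl (P 0)) (sp (P 0) i) fscale (kpow (n i)) (e i)"
      using is_homD(1)[OF home, of i] by (simp add: sclX spX)
    have surj: "e i ` sp (P 0) i = kpow (n i)" using surje unfolding surj_mor_def spX by blast
    show ?thesis
      by (rule linear_between_factor[OF vs vector_space_fscale is_rep_subspace[OF repP] line surj linw ker]) blast+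
  qed
  then obtain \<sigma> where \<sigma>: "\<And>i. lin (n i) (n i) (\<sigma> i)"
    and \<sigma>e: "\<And>i y. y \<in> sp (P 0) i \<Longrightarrow> \<sigma> i (e i y) = ?w i y" by metis
  have "\<phi> a x = \<sigma> (tgt Q a) (mp X a x) - mp X a (\<sigma> (src Q a) x)" if x: "x \<in> sp X (src Q a)" for a x
  proof -
    obtain y where y: "y \<in> sp (P 0) (src Q a)" "x = e (src Q a) y"
      using surje x unfolding surj_mor_def by blast
    have my: "mp (P 0) a y \<in> sp (P 0) (tgt Q a)" using is_rep_mp[OF repP y(1)] .
    have "\<sigma> (tgt Q a) (mp X a x) = \<sigma> (tgt Q a) (e (tgt Q a) (mp (P 0) a y))"
      using is_homD(3)[OF home y(1)] y(2) by simp
    also have "\<dots> = evens (e' (tgt Q a) (mp (P 0) a y)) - g (tgt Q a) (mp (P 0) a y)"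
      unfolding \<sigma>e[OF my] by simp
    also have "\<dots> = mp X a (evens (e' (src Q a) y)) + \<phi> a x - mp X a (g (src Q a) y)"
      unfolding e'mp[OF y(1)] is_homD(3)[OF homg y(1)] y(2) ..
    also have "\<dots> = mp X a (evens (e' (src Q a) y) - g (src Q a) y) + \<phi> a x"
      using lin_diff[OF linX] linear_betweenD(1)[OF line' y(1)] is_homD(2)[OF homg y(1)]
      by (simp add: spX)
    also have "evens (e' (src Q a) y) - g (src Q a) y = \<sigma> (src Q a) x"
      unfolding y(2) \<sigma>e[OF y(1)] by simp
    finally show ?thesis by (simp only: add_diff_cancel_left')
  qed
  then show "\<exists>\<sigma>. (\<forall>i. linear_between (scl X) (sp X i) (scl X) (sp X i) (\<sigma> i)) \<and>
          (\<forall>a. \<forall>x\<in>sp X (src Q a). \<phi> a x = \<sigma> (tgt Q a) (mp X a x) - mp X a (\<sigma> (src Q a) x))"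
    using \<sigma> by (intro exI[of _ \<sigma>]) (simp add: sclX spX)
qed


section \<open>Projective resolutions over the quiver\<close>

lemma Q1_simps [simp]:
  "src Q1 b_to_e = v_b" "src Q1 b_to_mid = v_b" "src Q1 mid_to_e = v_mid"
  "tgt Q1 b_to_e = v_e" "tgt Q1 b_to_mid = v_mid" "tgt Q1 mid_to_e = v_e"
  by (simp_all add: Q1_def)

lemma all_vertex: "(\<forall>v. R v) \<longleftrightarrow> R v_b \<and> R v_mid \<and> R v_e"
  by (metis vertex.exhaust)

lemma all_arrow: "(\<forall>a. R a) \<longleftrightarrow> R b_to_e \<and> R b_to_mid \<and> R mid_to_e"
  by (metis arrow.exhaust)

text \<open>Four slots hold every space of a projective below: two paths lead from b to e, one from
  mid to e, and e has its trivial path.\<close>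

definition quad :: "(nat \<Rightarrow> 'k) \<Rightarrow> (nat \<Rightarrow> 'k) \<Rightarrow> (nat \<Rightarrow> 'k) \<Rightarrow> (nat \<Rightarrow> 'k) \<Rightarrow> nat \<Rightarrow> 'k" where
  "quad w x y z = interleave (interleave w x) (interleave y z)"

definition c0 :: "(nat \<Rightarrow> 'k) \<Rightarrow> nat \<Rightarrow> 'k" where "c0 z = evens (evens z)"
definition c1 :: "(nat \<Rightarrow> 'k) \<Rightarrow> nat \<Rightarrow> 'k" where "c1 z = odds (evens z)"
definition c2 :: "(nat \<Rightarrow> 'k) \<Rightarrow> nat \<Rightarrow> 'k" where "c2 z = evens (odds z)"
definition c3 :: "(nat \<Rightarrow> 'k) \<Rightarrow> nat \<Rightarrow> 'k" where "c3 z = odds (odds z)"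

lemmas comp_defs = c0_def c1_def c2_def c3_def

lemma comp_quad [simp]:
  "c0 (quad w x y z) = w" "c1 (quad w x y z) = x" "c2 (quad w x y z) = y" "c3 (quad w x y z) = z"
  by (simp_all add: comp_defs quad_def)

lemma quad_comp [simp]: "quad (c0 z) (c1 z) (c2 z) (c3 z) = z"
  by (simp add: comp_defs quad_def)

lemma comp_add:
  fixes x y :: "nat \<Rightarrow> 'k::field"
  shows "c0 (x + y) = c0 x + c0 y" "c1 (x + y) = c1 x + c1 y" "c2 (x + y) = c2 x + c2 y" "c3 (x + y) = c3 x + c3 y"
  by (simp_all add: comp_defs evens_def odds_def fun_eq_iff)

lemma comp_scale:
  "c0 (fscale c x) = fscale c (c0 x)" "c1 (fscale c x) = fscale c (c1 x)"
  "c2 (fscale c x) = fscale c (c2 x)" "c3 (fscale c x) = fscale c (c3 x)"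
  by (simp_all add: comp_defs evens_def odds_def fun_eq_iff)

lemma comp_zero [simp]:
  "c0 (0 :: nat \<Rightarrow> 'k::field) = 0" "c1 (0 :: nat \<Rightarrow> 'k) = 0" "c2 (0 :: nat \<Rightarrow> 'k) = 0" "c3 (0 :: nat \<Rightarrow> 'k) = 0"
  by (simp_all add: comp_defs evens_def odds_def fun_eq_iff)

lemma comp_eqI: "c0 x = c0 y \<Longrightarrow> c1 x = c1 y \<Longrightarrow> c2 x = c2 y \<Longrightarrow> c3 x = c3 y \<Longrightarrow> x = y"
  by (metis quad_comp)

lemma quad_add:
  fixes w x y z :: "nat \<Rightarrow> 'k::field"
  shows "quad w x y z + quad w' x' y' z' = quad (w + w') (x + x') (y + y') (z + z')"
  by (rule comp_eqI) (simp_all only: comp_add comp_quad)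

lemma quad_scale:
  "fscale c (quad w x y z) = quad (fscale c w) (fscale c x) (fscale c y) (fscale c z)"
  by (rule comp_eqI) (simp_all only: comp_scale comp_quad)

lemma quad_zero: "quad 0 0 0 (0 :: nat \<Rightarrow> 'k::field) = 0"
  by (rule comp_eqI) simp_all

declare plus_fun_apply [simp del] zero_fun_apply [simp del]

text \<open>
  \<open>free_rep U V W\<close> is \<open>U \<otimes> P\<^sub>b \<oplus> V \<otimes> P\<^sub>m\<^sub>i\<^sub>d \<oplus> W \<otimes> P\<^sub>e\<close> for the indecomposable projectives
  \<open>P\<^sub>b\<close>, \<open>P\<^sub>m\<^sub>i\<^sub>d\<close>, \<open>P\<^sub>e\<close>. At \<open>e\<close>, the coordinate \<open>c0\<close> belongs to the path through \<open>mid\<close>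
  and \<open>c1\<close> to the arrow from \<open>b\<close> to \<open>e\<close>.
\<close>

definition quad_space ::
  "(nat \<Rightarrow> 'k) set \<Rightarrow> (nat \<Rightarrow> 'k) set \<Rightarrow> (nat \<Rightarrow> 'k) set \<Rightarrow> (nat \<Rightarrow> 'k) set \<Rightarrow> (nat \<Rightarrow> 'k::field) set" where
  "quad_space R S T U = {z. c0 z \<in> R \<and> c1 z \<in> S \<and> c2 z \<in> T \<and> c3 z \<in> U}"

definition free_rep ::
  "(nat \<Rightarrow> 'k::field) set \<Rightarrow> (nat \<Rightarrow> 'k) set \<Rightarrow> (nat \<Rightarrow> 'k) set \<Rightarrow> ('k, vertex, arrow) std_rep" where
  "free_rep U V W = \<lparr> scl = fscale,
     sp = (\<lambda>v. case v of v_b \<Rightarrow> quad_space U {0} {0} {0} | v_mid \<Rightarrow> quad_space U {0} V {0}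
            | v_e \<Rightarrow> quad_space U U V W),
     mp = (\<lambda>a z. case a of b_to_e \<Rightarrow> quad 0 (c0 z) 0 0 | _ \<Rightarrow> z) \<rparr>"

lemma free_rep_simps [simp]:
  "scl (free_rep U V W) = fscale"
  "sp (free_rep U V W) v_b = quad_space U {0} {0} {0}"
  "sp (free_rep U V W) v_mid = quad_space U {0} V {0}"
  "sp (free_rep U V W) v_e = quad_space U U V W"
  "mp (free_rep U V W) b_to_e z = quad 0 (c0 z) 0 0"
  "mp (free_rep U V W) b_to_mid z = z"
  "mp (free_rep U V W) mid_to_e z = z"
  by (simp_all add: free_rep_def)

lemma quad_in_quad_space [simp]:
  "quad w x y z \<in> quad_space R S T U \<longleftrightarrow> w \<in> R \<and> x \<in> S \<and> y \<in> T \<and> z \<in> U"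
  by (simp add: quad_space_def)

text \<open>The generator spaces of \<open>free_rep\<close> are not always of the form
  \<open>kpow n\<close>: the resolution needs a space that interleaves coordinate spaces of two
  different dimensions. A bound is enough for a finite basis.\<close>

definition bounded_subspace :: "(nat \<Rightarrow> 'k::field) set \<Rightarrow> bool" where
  "bounded_subspace S \<longleftrightarrow> fs.subspace S \<and> (\<exists>n. S \<subseteq> kpow n)"

lemma bounded_subspace_0: "bounded_subspace {0}"
  unfolding bounded_subspace_def using kpow_0 by (auto intro: exI[of _ 0])

lemma bounded_subspace_kpow: "bounded_subspace (kpow n)"
  unfolding bounded_subspace_def by auto

lemma kpow_mono: "m \<le> n \<Longrightarrow> kpow m \<subseteq> kpow n"
  unfolding kpow_def by auto

lemma subspace_quad_space:
  assumes "fs.subspace R" "fs.subspace S" "fs.subspace T" "fs.subspace U"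
  shows "fs.subspace (quad_space R S T U)"
  using assms unfolding fs.subspace_def quad_space_def by (simp add: comp_add comp_scale)

lemma bounded_quad_space:
  assumes "bounded_subspace R" "bounded_subspace S" "bounded_subspace T" "bounded_subspace U"
  shows "bounded_subspace (quad_space R S T U)"
proof -
  obtain a b c d where "R \<subseteq> kpow a" "S \<subseteq> kpow b" "T \<subseteq> kpow c" "U \<subseteq> kpow d"
    using assms unfolding bounded_subspace_def by blast
  then have sub: "R \<subseteq> kpow (a+b+c+d)" "S \<subseteq> kpow (a+b+c+d)" "T \<subseteq> kpow (a+b+c+d)" "U \<subseteq> kpow (a+b+c+d)"
    using kpow_mono[of a "a+b+c+d"] kpow_mono[of b "a+b+c+d"] kpow_mono[of c "a+b+c+d"] kpow_mono[of d "a+b+c+d"]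
    by auto
  have "z \<in> kpow (2 * (2 * (a+b+c+d)))" if "z \<in> quad_space R S T U" for z
  proof -
    have "quad (c0 z) (c1 z) (c2 z) (c3 z) \<in> kpow (2 * (2 * (a+b+c+d)))"
      using that sub unfolding quad_def interleave_in_kpow quad_space_def by blast
    then show ?thesis by simp
  qed
  then show ?thesis
    using assms subspace_quad_space unfolding bounded_subspace_def by blast
qed

lemma bounded_subspace_finite_basis:
  assumes "bounded_subspace S"
  obtains B where "finite B" "fs.independent B" "S = fs.span B"
proof -
  obtain n where n: "S \<subseteq> kpow n" and S: "fs.subspace S"
    using assms unfolding bounded_subspace_def by blast
  have "fs.fin_subspace S" by (rule fs.fin_subspace_subset[OF fin_subspace_kpow S n])
  then obtain B where "finite B" "fs.independent B" "fs.span B = S"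
    by (rule fs.fin_subspace_basis)
  then show ?thesis using that by blast
qed

lemma is_rep_free_rep:
  assumes U: "bounded_subspace U" and V: "bounded_subspace V" and W: "bounded_subspace W"
  shows "is_rep Q1 (free_rep U V W)"
proof -
  have "\<exists>B. finite B \<and> S = fs.span B" if "bounded_subspace S" for S :: "(nat \<Rightarrow> 'a) set"
    using bounded_subspace_finite_basis[OF that] by metis
  moreover have "0 \<in> U" "0 \<in> V" "0 \<in> W"
    using assms fs.subspace_0 unfolding bounded_subspace_def by blast+
  moreover have "\<exists>B. finite B \<and> sp (free_rep U V W) v = fs.span B" for v
    by (cases v) (simp_all only: free_rep_simps,
        (intro calculation(1) bounded_quad_space assms bounded_subspace_0)+)
  ultimately show ?thesis
    unfolding is_rep_def all_arrow
    using vector_space_fscale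
    by (auto simp: linear_between_def quad_space_def comp_add comp_scale quad_add quad_scale)
qed

text \<open>The universal property of \<open>free_rep\<close>: the values lb, lm, le on the
  generators at the three vertices are arbitrary, and each slot is sent along the path of A that it
  represents.\<close>

definition free_hom ::
  "('k::field, vertex, arrow, 'w::ab_group_add) rep \<Rightarrow> ((nat \<Rightarrow> 'k) \<Rightarrow> 'w) \<Rightarrow> ((nat \<Rightarrow> 'k) \<Rightarrow> 'w)
    \<Rightarrow> ((nat \<Rightarrow> 'k) \<Rightarrow> 'w) \<Rightarrow> (vertex, nat \<Rightarrow> 'k, 'w) mor" where
  "free_hom A lb lm le = (\<lambda>v z. case v of v_b \<Rightarrow> lb (c0 z)
     | v_mid \<Rightarrow> mp A b_to_mid (lb (c0 z)) + lm (c2 z)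
     | v_e \<Rightarrow> mp A mid_to_e (mp A b_to_mid (lb (c0 z))) + mp A b_to_e (lb (c1 z))
             + mp A mid_to_e (lm (c2 z)) + le (c3 z))"

lemma free_hom_simps [simp]:
  "free_hom A lb lm le v_b = (\<lambda>z. lb (c0 z))"
  "free_hom A lb lm le v_mid = (\<lambda>z. mp A b_to_mid (lb (c0 z)) + lm (c2 z))"
  "free_hom A lb lm le v_e = (\<lambda>z. mp A mid_to_e (mp A b_to_mid (lb (c0 z))) + mp A b_to_e (lb (c1 z))
             + mp A mid_to_e (lm (c2 z)) + le (c3 z))"
  by (simp_all add: free_hom_def)

lemma is_rep_mp_zero:
  assumes "is_rep Q A"
  shows "mp A a 0 = 0"
proof -
  have vs: "vector_space (scl A)" using assms unfolding is_rep_def by blast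
  then interpret vector_space "scl A" .
  have "linear_between (scl A) (sp A (src Q a)) (scl A) (sp A (tgt Q a)) (mp A a)"
    using assms unfolding is_rep_def by blast
  then show ?thesis
    using linear_between_zero[OF vs vs] subspace_0[OF is_rep_subspace[OF assms]] by blast
qed

lemma linear_between_comp_quad:
  "linear_between fscale (quad_space R S T U) fscale R c0"
  "linear_between fscale (quad_space R S T U) fscale S c1"
  "linear_between fscale (quad_space R S T U) fscale T c2"
  "linear_between fscale (quad_space R S T U) fscale U c3"
  unfolding linear_between_def by (simp_all add: comp_add comp_scale quad_space_def)

lemma is_hom_free_hom:
  assumes A: "is_rep Q1 A"
    and lb: "linear_between fscale U (scl A) (sp A v_b) lb"
    and lm: "linear_between fscale V (scl A) (sp A v_mid) lm"
    and le: "linear_between fscale W (scl A) (sp A v_e) le"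
    and 0: "0 \<in> U" "0 \<in> V" "0 \<in> W"
  shows "is_hom Q1 (free_rep U V W) A (free_hom A lb lm le)"
proof -
  have vs: "vector_space (scl A)" using A unfolding is_rep_def by blast
  note sub = is_rep_subspace[OF A]
  have z: "lb 0 = 0" "lm 0 = 0" "le 0 = 0"
    using linear_between_zero[OF vector_space_fscale vs lb 0(1)] linear_between_zero[OF vector_space_fscale vs lm 0(2)]
      linear_between_zero[OF vector_space_fscale vs le 0(3)] by auto
  have mp: "linear_between (scl A) (sp A v_b) (scl A) (sp A v_e) (mp A b_to_e)"
    "linear_between (scl A) (sp A v_b) (scl A) (sp A v_mid) (mp A b_to_mid)"
    "linear_between (scl A) (sp A v_mid) (scl A) (sp A v_e) (mp A mid_to_e)"
    using A unfolding is_rep_def all_arrow by auto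
  note comp = linear_between_compose
  have bm: "linear_between fscale U (scl A) (sp A v_mid) (\<lambda>x. mp A b_to_mid (lb x))"
    by (rule comp[OF lb mp(2)])
  have z': "mp A a 0 = 0" for a by (rule is_rep_mp_zero[OF A])
  have "linear_between fscale (quad_space U {0} {0} {0}) (scl A) (sp A v_b) (\<lambda>z. lb (c0 z))"
    by (rule comp[OF linear_between_comp_quad(1) lb])
  moreover have "linear_between fscale (quad_space U {0} V {0}) (scl A) (sp A v_mid) (\<lambda>z. mp A b_to_mid (lb (c0 z)) + lm (c2 z))"
    by (intro linear_between_add vs sub comp[OF linear_between_comp_quad(1) bm] comp[OF linear_between_comp_quad(3) lm])
  moreover have "linear_between fscale (quad_space U U V W) (scl A) (sp A v_e)
     (\<lambda>z. mp A mid_to_e (mp A b_to_mid (lb (c0 z))) + mp A b_to_e (lb (c1 z)) + mp A mid_to_e (lm (c2 z)) + le (c3 z))"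
    by (intro linear_between_add vs sub comp[OF linear_between_comp_quad(1) comp[OF bm mp(3)]]
        comp[OF linear_between_comp_quad(2) comp[OF lb mp(1)]]
        comp[OF linear_between_comp_quad(3) comp[OF lm mp(3)]] comp[OF linear_between_comp_quad(4) le])
  moreover have "mp A mid_to_e (mp A b_to_mid (lb x) + lm y) = mp A mid_to_e (mp A b_to_mid (lb x)) + mp A mid_to_e (lm y)"
    if "x \<in> U" "y \<in> V" for x y
    using linear_betweenD(2)[OF mp(3)] linear_betweenD(1)[OF bm that(1)] linear_betweenD(1)[OF lm that(2)] by blast
  ultimately show ?thesis
    unfolding is_hom_def all_vertex all_arrow
    by (simp add: quad_space_def z z')
qed

text \<open>Every slot is reached from a generator by structure maps, so the values of h on
  generators determine it.\<close>

lemma free_hom_unique: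
  assumes h: "is_hom Q1 (free_rep U V W) A h" and z: "z \<in> sp (free_rep U V W) v"
    and 0: "0 \<in> U" "0 \<in> V" "0 \<in> W"
  shows "h v z = free_hom A (\<lambda>u. h v_b (quad u 0 0 0)) (\<lambda>u. h v_mid (quad 0 0 u 0)) (\<lambda>u. h v_e (quad 0 0 0 u)) v z"
proof -
  note lin = linear_betweenD(2)[OF is_homD(1)[OF h]]
  have m: "mp A b_to_mid (h v_b (quad u 0 0 0)) = h v_mid (quad u 0 0 0)"
    "mp A b_to_e (h v_b (quad u 0 0 0)) = h v_e (quad 0 u 0 0)" if "u \<in> U" for u
    using is_homD(3)[OF h, of "quad u 0 0 0" b_to_mid] is_homD(3)[OF h, of "quad u 0 0 0" b_to_e] that by auto
  have m': "mp A mid_to_e (h v_mid z) = h v_e z" if "z \<in> quad_space U {0} V {0}" for z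
    using is_homD(3)[OF h, of z mid_to_e] that by simp
  have zeq: "z = quad (c0 z) (c1 z) (c2 z) (c3 z)" by simp
  show ?thesis
  proof (cases v)
    case v_b
    then have "z = quad (c0 z) 0 0 0" using z zeq by (simp add: quad_space_def)
    then show ?thesis using v_b by simp
  next
    case v_mid
    then have zz: "c0 z \<in> U" "c2 z \<in> V" "c1 z = 0" "c3 z = 0" using z by (auto simp: quad_space_def)
    have "z = quad (c0 z) 0 (c2 z) 0" using zeq zz by simp
    also have "\<dots> = quad (c0 z) 0 0 0 + quad 0 0 (c2 z) 0" unfolding quad_add by simp
    finally have "h v_mid z = h v_mid (quad (c0 z) 0 0 0 + quad 0 0 (c2 z) 0)" by (rule arg_cong)
    also have "\<dots> = h v_mid (quad (c0 z) 0 0 0) + h v_mid (quad 0 0 (c2 z) 0)"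
      by (rule lin) (use zz 0 in simp_all)
    finally show ?thesis using v_mid m(1)[OF zz(1)] by simp
  next
    case v_e
    then have zz: "c0 z \<in> U" "c1 z \<in> U" "c2 z \<in> V" "c3 z \<in> W" using z by (auto simp: quad_space_def)
    have "z = quad (c0 z) 0 0 0 + quad 0 (c1 z) 0 0 + quad 0 0 (c2 z) 0 + quad 0 0 0 (c3 z)"
      unfolding quad_add by simp
    then have "h v_e z = h v_e (quad (c0 z) 0 0 0 + quad 0 (c1 z) 0 0 + quad 0 0 (c2 z) 0 + quad 0 0 0 (c3 z))"
      by (rule arg_cong)
    also have "\<dots> = h v_e (quad (c0 z) 0 0 0 + quad 0 (c1 z) 0 0 + quad 0 0 (c2 z) 0) + h v_e (quad 0 0 0 (c3 z))"
      by (rule lin) (use zz 0 in \<open>simp_all add: quad_add\<close>)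
    also have "h v_e (quad (c0 z) 0 0 0 + quad 0 (c1 z) 0 0 + quad 0 0 (c2 z) 0) = h v_e (quad (c0 z) 0 0 0 + quad 0 (c1 z) 0 0) + h v_e (quad 0 0 (c2 z) 0)"
      by (rule lin) (use zz 0 in \<open>simp_all add: quad_add\<close>)
    also have "h v_e (quad (c0 z) 0 0 0 + quad 0 (c1 z) 0 0) = h v_e (quad (c0 z) 0 0 0) + h v_e (quad 0 (c1 z) 0 0)"
      by (rule lin) (use zz 0 in \<open>simp_all add: quad_add\<close>)
    finally show ?thesis
      using v_e m[OF zz(1)] m(2)[OF zz(2)] m'[of "quad (c0 z) 0 0 0"] m'[of "quad 0 0 (c2 z) 0"] zz 0 by simp
  qed
qed

lemma free_hom_eqI:
  assumes "is_hom Q1 (free_rep U V W) A h" "is_hom Q1 (free_rep U V W) A h'"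
    and z: "z \<in> sp (free_rep U V W) v" and 0: "0 \<in> U" "0 \<in> V" "0 \<in> W"
    and "\<And>u. u \<in> U \<Longrightarrow> h v_b (quad u 0 0 0) = h' v_b (quad u 0 0 0)"
    and "\<And>u. u \<in> V \<Longrightarrow> h v_mid (quad 0 0 u 0) = h' v_mid (quad 0 0 u 0)"
    and "\<And>u. u \<in> W \<Longrightarrow> h v_e (quad 0 0 0 u) = h' v_e (quad 0 0 0 u)"
  shows "h v z = h' v z"
  unfolding free_hom_unique[OF assms(1) z 0] free_hom_unique[OF assms(2) z 0]
  using z assms(7-9) by (cases v) (simp_all add: quad_space_def)

lemma free_hom_generators:
  assumes A: "is_rep Q1 A"
    and lb: "linear_between fscale U (scl A) (sp A v_b) lb"
    and lm: "linear_between fscale V (scl A) (sp A v_mid) lm"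
    and le: "linear_between fscale W (scl A) (sp A v_e) le"
    and 0: "0 \<in> U" "0 \<in> V" "0 \<in> W"
  shows "free_hom A lb lm le v_b (quad u 0 0 0) = lb u"
    and "free_hom A lb lm le v_mid (quad 0 0 u 0) = lm u"
    and "free_hom A lb lm le v_e (quad 0 0 0 u) = le u"
proof -
  have vs: "vector_space (scl A)" using A unfolding is_rep_def by blast
  have "lb 0 = 0" "lm 0 = 0" "le 0 = 0"
    using linear_between_zero[OF vector_space_fscale vs lb 0(1)] linear_between_zero[OF vector_space_fscale vs lm 0(2)]
      linear_between_zero[OF vector_space_fscale vs le 0(3)] by auto
  then show "free_hom A lb lm le v_b (quad u 0 0 0) = lb u"
    "free_hom A lb lm le v_mid (quad 0 0 u 0) = lm u"
    "free_hom A lb lm le v_e (quad 0 0 0 u) = le u"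
    by (simp_all add: is_rep_mp_zero[OF A])
qed

text \<open>Vector spaces are projective: preimages are chosen on a finite basis of \<open>U\<close>
  and extended linearly.\<close>

lemma linear_between_lift:
  fixes A :: "'v::ab_group_add set"
  assumes s: "vector_space s" and A: "module.subspace s A" and t: "vector_space t"
    and p: "linear_between s A t B p" and surj: "p ` A = B"
    and U: "bounded_subspace U" and k: "linear_between fscale U t B k"
  obtains l where "linear_between fscale U s A l" "\<And>u. u \<in> U \<Longrightarrow> p (l u) = k u"
proof -
  obtain C where C: "finite C" "fs.independent C" "U = fs.span C"
    by (rule bounded_subspace_finite_basis[OF U])
  interpret s: vector_space s by fact
  interpret t: vector_space t by fact
  interpret ks: vector_space_pair fscale s by unfold_locales
  have CU: "C \<subseteq> U" unfolding C(3) by (rule fs.span_superset)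
  have 0: "0 \<in> U" unfolding C(3) by (rule fs.span_zero)
  have "\<forall>u\<in>C. \<exists>a\<in>A. p a = k u"
    using CU linear_betweenD(1)[OF k] surj by (metis image_iff subsetD)
  then obtain a where a: "\<And>u. u \<in> C \<Longrightarrow> a u \<in> A \<and> p (a u) = k u" by metis
  obtain l where l: "Vector_Spaces.linear fscale s l" "\<forall>u\<in>C. l u = a u"
    using ks.linear_independent_extend[OF C(2), of a] by auto
  interpret l: Vector_Spaces.linear fscale s l by (fact l(1))
  have lu: "u \<in> U \<and> l u \<in> A \<and> p (l u) = k u" if "u \<in> fs.span C" for u
    using that
  proof (induction rule: fs.span_induct_alt)
    case base
    have "p 0 = 0" "k 0 = 0"
      using linear_between_zero[OF s t p s.subspace_0[OF A]]
        linear_between_zero[OF vector_space_fscale t k 0] by auto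
    then show ?case using 0 s.subspace_0[OF A] by (simp only: l.zero)
  next
    case (step c x y)
    have lx: "l x = a x" "l x \<in> A" "x \<in> U" "p (l x) = k x" using step a l(2) CU by auto
    have cx: "fscale c x \<in> U" "s c (l x) \<in> A"
      using lx fs.subspace_scale s.subspace_scale[OF A] unfolding C(3) by auto
    have "p (l (fscale c x + y)) = p (s c (l x)) + p (l y)"
      unfolding l.add l.scale using linear_betweenD(2)[OF p cx(2)] step by blast
    also have "\<dots> = t c (k x) + k y"
      using linear_betweenD(3)[OF p lx(2)] lx(4) step by simp
    also have "\<dots> = k (fscale c x + y)"
      using linear_betweenD(2)[OF k cx(1)] linear_betweenD(3)[OF k lx(3)] step by simp
    finally have "p (l (fscale c x + y)) = k (fscale c x + y)" .
    moreover have "fscale c x + y \<in> U"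
      using cx(1) step fs.span_add unfolding C(3) by blast
    moreover have "l (fscale c x + y) \<in> A"
      unfolding l.add l.scale using cx(2) step s.subspace_add[OF A] by blast
    ultimately show ?case by blast
  qed
  show ?thesis
  proof (rule that)
    show "linear_between fscale U s A l"
      by (rule linear_imp_linear_between[OF l(1)]) (use lu C(3) in blast)
  qed (use lu C(3) in blast)
qed

text \<open>The lift is chosen on the generator spaces at the three vertices separately; two
  morphisms out of a free representation that agree on generators are equal.\<close>

lemma projective_free_rep:
  assumes U: "bounded_subspace U" and V: "bounded_subspace V" and W: "bounded_subspace (W :: (nat \<Rightarrow> 'k::field) set)"
  shows "projective Q1 (free_rep U V W)"
  unfolding projective_def
proof (intro allI impI, elim conjE)
  fix A B :: "('k, vertex, arrow) std_rep" and p h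
  assume A: "is_rep Q1 A" and B: "is_rep Q1 B" and p: "is_hom Q1 A B p" and surj: "surj_mor A B p"
    and h: "is_hom Q1 (free_rep U V W) B h"
  have vA: "vector_space (scl A)" and vB: "vector_space (scl B)" using A B unfolding is_rep_def by auto
  have 0: "0 \<in> U" "0 \<in> V" "0 \<in> W"
    using assms fs.subspace_0 unfolding bounded_subspace_def by blast+
  have pA: "p v ` sp A v = sp B v" for v using surj unfolding surj_mor_def by blast
  have hq: "linear_between fscale U (scl B) (sp B v_b) (\<lambda>u. h v_b (quad u 0 0 0))"
    "linear_between fscale V (scl B) (sp B v_mid) (\<lambda>u. h v_mid (quad 0 0 u 0))"
    "linear_between fscale W (scl B) (sp B v_e) (\<lambda>u. h v_e (quad 0 0 0 u))"
  proof -
    have "linear_between fscale U fscale (quad_space U {0} {0} {0}) (\<lambda>u. quad u 0 0 0)"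
      "linear_between fscale V fscale (quad_space U {0} V {0}) (\<lambda>u. quad 0 0 u 0)"
      "linear_between fscale W fscale (quad_space U U V W) (\<lambda>u. quad 0 0 0 u)"
      unfolding linear_between_def using 0 by (simp_all add: quad_add quad_scale)
    from this(1)[THEN linear_between_compose] this(2)[THEN linear_between_compose] this(3)[THEN linear_between_compose]
    show "linear_between fscale U (scl B) (sp B v_b) (\<lambda>u. h v_b (quad u 0 0 0))"
      "linear_between fscale V (scl B) (sp B v_mid) (\<lambda>u. h v_mid (quad 0 0 u 0))"
      "linear_between fscale W (scl B) (sp B v_e) (\<lambda>u. h v_e (quad 0 0 0 u))"
      using is_homD(1)[OF h, of v_b] is_homD(1)[OF h, of v_mid] is_homD(1)[OF h, of v_e] by simp_all
  qed
  obtain lb where lb: "linear_between fscale U (scl A) (sp A v_b) lb" "\<And>u. u \<in> U \<Longrightarrow> p v_b (lb u) = h v_b (quad u 0 0 0)"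
    by (rule linear_between_lift[OF vA is_rep_subspace[OF A] vB is_homD(1)[OF p] pA U hq(1)]) blast
  obtain lm where lm: "linear_between fscale V (scl A) (sp A v_mid) lm" "\<And>u. u \<in> V \<Longrightarrow> p v_mid (lm u) = h v_mid (quad 0 0 u 0)"
    by (rule linear_between_lift[OF vA is_rep_subspace[OF A] vB is_homD(1)[OF p] pA V hq(2)]) blast
  obtain le where le: "linear_between fscale W (scl A) (sp A v_e) le" "\<And>u. u \<in> W \<Longrightarrow> p v_e (le u) = h v_e (quad 0 0 0 u)"
    by (rule linear_between_lift[OF vA is_rep_subspace[OF A] vB is_homD(1)[OF p] pA W hq(3)]) blast
  let ?h = "free_hom A lb lm le"
  have h': "is_hom Q1 (free_rep U V W) A ?h"
    by (rule is_hom_free_hom[OF A lb(1) lm(1) le(1) 0])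
  have ph: "is_hom Q1 (free_rep U V W) B (\<lambda>v z. p v (?h v z))"
    by (rule is_hom_compose[OF h' p])
  have "p v (?h v z) = h v z" if "z \<in> sp (free_rep U V W) v" for v z
    by (rule free_hom_eqI[OF ph h that 0])
      (simp_all only: free_hom_generators[OF A lb(1) lm(1) le(1) 0] lb lm le)
  then show "\<exists>h'. is_hom Q1 (free_rep U V W) A h' \<and> (\<forall>i. \<forall>x\<in>sp (free_rep U V W) i. p i (h' i x) = h i x)"
    using h' by blast
qed

section \<open>The standard resolution of length one\<close>

lemma linear_between_quad:
  assumes "linear_between fscale V fscale R f" "linear_between fscale V fscale S g"
    "linear_between fscale V fscale T h" "linear_between fscale V fscale U k"
  shows "linear_between fscale V fscale (quad_space R S T U) (\<lambda>x. quad (f x) (g x) (h x) (k x))"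
  using assms unfolding linear_between_def by (simp add: quad_add quad_scale)

text \<open>In the standard resolution \<open>P0\<close> has a generator space X_v at each vertex v,
  and \<open>P1\<close> has a generator space X_s at t for each arrow from s to t. A morphism from
  \<open>P1\<close> to X is thus a family of maps along the arrows, and those extending over
  \<open>P0\<close> are the families in the definition of \<open>rigid\<close>, up to sign. In
  higher degrees the resolution is zero.\<close>

lemma rigid_imp_ext_zero:
  fixes X :: "('k::field, vertex, arrow) std_rep"
  assumes X: "coord_rep Q1 X n" and rig: "rigid Q1 X"
  shows "ext_zero Q1 (Suc m) X X"
proof -
  have sclX: "scl X = fscale" and spX: "sp X i = kpow (n i)" for i
    using X unfolding coord_rep_def by auto
  have repX: "is_rep Q1 X" using X unfolding coord_rep_def by blast
  let ?\<alpha> = "mp X b_to_mid" and ?\<beta> = "mp X mid_to_e" and ?\<gamma> = "mp X b_to_e"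
  let ?p = "n v_b" and ?q = "n v_mid" and ?r = "n v_e"
  have \<alpha>: "lin ?p ?q ?\<alpha>" and \<beta>: "lin ?q ?r ?\<beta>" and \<gamma>: "lin ?p ?r ?\<gamma>"
    using X unfolding coord_rep_iff all_arrow by auto
  note mp0 = is_rep_mp_zero[OF repX]
  \<comment> \<open>Two arrows end in e: the even coordinates carry X_b for the arrow from b, the
    odd ones X_mid for the arrow from mid.\<close>
  define W :: "(nat \<Rightarrow> 'k) set" where "W = {w. evens w \<in> kpow ?p \<and> odds w \<in> kpow ?q}"
  have evW: "linear_between fscale W fscale (kpow ?p) evens" and odW: "linear_between fscale W fscale (kpow ?q) odds"
    unfolding linear_between_def W_def by (simp_all add: evens_def odds_def fun_eq_iff plus_fun_apply)
  have bW: "bounded_subspace W"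
  proof -
    have eo: "evens (x + y) = evens x + evens y" "odds (x + y) = odds x + odds y" "evens 0 = 0" "odds 0 = 0"
      "evens (fscale c x) = fscale c (evens x)" "odds (fscale c x) = fscale c (odds x)" for x y :: "nat \<Rightarrow> 'k" and c
      by (simp_all add: evens_def odds_def fun_eq_iff plus_fun_apply zero_fun_apply)
    have "fs.subspace W"
      unfolding W_def
      by (rule fs.subspaceI) (auto simp: eo fs.subspace_add[OF subspace_kpow] fs.subspace_scale[OF subspace_kpow])
    moreover have "w \<in> kpow (2 * (?p + ?q))" if "w \<in> W" for w
    proof -
      have "interleave (evens w) (odds w) \<in> kpow (2 * (?p + ?q))"
        using that kpow_mono[of ?p "?p + ?q"] kpow_mono[of ?q "?p + ?q"]
        unfolding W_def interleave_in_kpow by auto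
      then show ?thesis by simp
    qed
    ultimately show ?thesis unfolding bounded_subspace_def by blast
  qed
  define P0 where "P0 = free_rep (kpow ?p) (kpow ?q) (kpow ?r :: (nat \<Rightarrow> 'k) set)"
  define P1 where "P1 = free_rep {0} (kpow ?p) W"
  define Z where "Z = free_rep {0} {0} {0 :: nat \<Rightarrow> 'k}"
  have rep: "is_rep Q1 P0" "is_rep Q1 P1" "is_rep Q1 Z"
    and proj: "projective Q1 P0" "projective Q1 P1" "projective Q1 Z"
    unfolding P0_def P1_def Z_def
    by (intro is_rep_free_rep projective_free_rep bounded_subspace_0 bounded_subspace_kpow bW)+
  have W0: "0 \<in> W" using bW fs.subspace_0 unfolding bounded_subspace_def by blast
  define e where "e = free_hom X (\<lambda>x. x) (\<lambda>x. x) (\<lambda>x. x)"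
  \<comment> \<open>A generator x for an arrow a goes to the path a applied to the generator x,
    minus the generator a x at the target. The slots of \<open>quad\<close> record the
    paths.\<close>
  define dm where "dm = (\<lambda>x. quad x 0 (- ?\<alpha> x) 0)"
  define de where "de = (\<lambda>w. quad 0 (evens w) (odds w) (- ?\<gamma> (evens w) + - ?\<beta> (odds w)))"
  define d0 where "d0 = free_hom P0 (\<lambda>x. 0) dm de"
  note sk = vector_space_fscale subspace_kpow
  have s0: "fs.subspace {0}" by simp
  have ldm: "linear_between fscale (kpow ?p) (scl P0) (sp P0 v_mid) dm"
    unfolding P0_def free_rep_simps dm_def
    by (intro linear_between_quad linear_between_id linear_between_const_zero linear_between_minus sk s0 \<alpha>)
  have lde: "linear_between fscale W (scl P0) (sp P0 v_e) de"
    unfolding P0_def free_rep_simps de_def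
    by (intro linear_between_quad linear_between_const_zero linear_between_minus linear_between_add sk evW odW
        linear_between_compose[OF evW \<gamma>] linear_between_compose[OF odW \<beta>])
  have lz: "linear_between fscale {0} (scl P0) (sp P0 v_b) (\<lambda>x. 0)"
    using rep(1) is_rep_subspace[OF rep(1)] unfolding is_rep_def by (intro linear_between_const_zero) auto
  have home: "is_hom Q1 P0 X e"
    unfolding P0_def e_def by (rule is_hom_free_hom[OF repX]) (simp_all add: sclX spX linear_between_id)
  have homd: "is_hom Q1 P1 P0 d0"
    unfolding P1_def d0_def by (rule is_hom_free_hom[OF rep(1) lz ldm lde _ _ W0]) simp_all
  have eb: "e v_b z = c0 z" and em: "e v_mid z = ?\<alpha> (c0 z) + c2 z"
    and ee: "e v_e z = ?\<beta> (?\<alpha> (c0 z)) + ?\<gamma> (c1 z) + ?\<beta> (c2 z) + c3 z" for z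
    unfolding e_def by simp_all
  have db: "d0 v_b z = 0" and dmid: "d0 v_mid z = quad (c2 z) 0 (- ?\<alpha> (c2 z)) 0"
    and dve: "d0 v_e z = quad (c2 z) (evens (c3 z)) (odds (c3 z) - ?\<alpha> (c2 z)) (- ?\<gamma> (evens (c3 z)) + - ?\<beta> (odds (c3 z)))" for z
    unfolding d0_def P0_def dm_def de_def by (simp_all add: quad_add quad_zero)
  have sP0: "sp P0 v_b = quad_space (kpow ?p) {0} {0} {0}" "sp P0 v_mid = quad_space (kpow ?p) {0} (kpow ?q) {0}"
    "sp P0 v_e = quad_space (kpow ?p) (kpow ?p) (kpow ?q) (kpow ?r)"
    and sP1: "sp P1 v_b = quad_space {0} {0} {0} {0}" "sp P1 v_mid = quad_space {0} {0} (kpow ?p) {0}"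
    "sp P1 v_e = quad_space {0} {0} (kpow ?p) W"
    unfolding P0_def P1_def by simp_all
  have surj: "surj_mor P0 X e"
  proof -
    have "x \<in> e v ` sp P0 v" if "x \<in> sp X v" for x v
    proof (cases v)
      case v_b
      then show ?thesis using that
        by (intro image_eqI[of _ _ "quad x 0 0 0"]) (simp_all add: sP0 eb spX)
    next
      case v_mid
      then show ?thesis using that
        by (intro image_eqI[of _ _ "quad 0 0 x 0"]) (simp_all add: sP0 em spX mp0)
    next
      case v_e
      then show ?thesis using that
        by (intro image_eqI[of _ _ "quad 0 0 0 x"]) (simp_all add: sP0 ee spX mp0)
    qed
    then show ?thesis
      unfolding surj_mor_def using is_homD(2)[OF home] by blast
  qed
  have neg: "?\<beta> (- x) = - ?\<beta> x" if "x \<in> kpow ?q" for x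
    using lin_diff[OF \<beta> zero_in_kpow that] by (simp add: mp0)
  have ex0: "exact_at P1 P0 d0 e"
  proof -
    have ed: "e v (d0 v x) = 0" if "x \<in> sp P1 v" for v x
    proof (cases v)
      case v_b
      then show ?thesis by (simp add: db eb)
    next
      case v_mid
      then show ?thesis by (simp add: dmid em)
    next
      case v_e
      then have x: "c2 x \<in> kpow ?p" "odds (c3 x) \<in> kpow ?q" using that by (auto simp: sP1 quad_space_def W_def)
      then show ?thesis using lin_diff[OF \<beta> x(2) lin_in[OF \<alpha> x(1)]] v_e by (simp add: dve ee)
    qed
    have "z \<in> d0 v ` sp P1 v" if z: "z \<in> sp P0 v" "e v z = 0" for v z
    proof (cases v)
      case v_b
      then have "z = 0" using z by - (rule comp_eqI, auto simp: sP0 quad_space_def eb)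
      then show ?thesis using v_b
        by (intro image_eqI[of _ _ 0]) (simp_all add: db sP1 quad_space_def)
    next
      case v_mid
      then have c: "c0 z \<in> kpow ?p" "c1 z = 0" "c3 z = 0" "c2 z = - ?\<alpha> (c0 z)"
        using z by (auto simp: sP0 quad_space_def em eq_neg_iff_add_eq_0 add.commute)
      have "z = quad (c0 z) 0 (- ?\<alpha> (c0 z)) 0" by (rule comp_eqI) (simp_all add: c)
      then show ?thesis using v_mid c(1)
        by (intro image_eqI[of _ _ "quad 0 0 (c0 z) 0"]) (simp_all add: dmid sP1)
    next
      case v_e
      then have c: "c0 z \<in> kpow ?p" "c1 z \<in> kpow ?p" "c2 z \<in> kpow ?q"
        and s: "?\<beta> (?\<alpha> (c0 z)) + ?\<gamma> (c1 z) + ?\<beta> (c2 z) + c3 z = 0"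
        using z by (auto simp: sP0 quad_space_def ee)
      \<comment> \<open>The preimage is read off slot by slot from \<open>dve\<close>; adding
        \<open>?\<alpha> (c0 z)\<close> compensates the correction in the third slot, and the fourth
        slot then agrees because e kills z.\<close>
      let ?w = "quad 0 0 (c0 z) (interleave (c1 z) (c2 z + ?\<alpha> (c0 z)))"
      have \<alpha>c: "?\<alpha> (c0 z) \<in> kpow ?q" using lin_in[OF \<alpha> c(1)] .
      have "?\<beta> (c2 z + ?\<alpha> (c0 z)) = ?\<beta> (c2 z) + ?\<beta> (?\<alpha> (c0 z))"
        by (rule lin_add[OF \<beta> c(3) \<alpha>c])
      moreover have "c3 z = - (?\<beta> (?\<alpha> (c0 z)) + ?\<gamma> (c1 z) + ?\<beta> (c2 z))"
        using s by (simp only: eq_neg_iff_add_eq_0 add.commute)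
      ultimately have c3: "c3 z = - ?\<gamma> (c1 z) + - ?\<beta> (c2 z + ?\<alpha> (c0 z))" by (simp add: algebra_simps)
      have "d0 v_e ?w = z"
        unfolding dve by (rule comp_eqI) (simp_all add: c3)
      moreover have "?w \<in> sp P1 v_e"
        using c fs.subspace_add[OF subspace_kpow c(3) \<alpha>c] by (simp add: sP1 W_def)
      ultimately show ?thesis unfolding v_e by (metis image_eqI)
    qed
    then show ?thesis
      unfolding exact_at_def using is_homD(2)[OF homd] ed by blast
  qed
  have inj: "z = 0" if "z \<in> sp P1 v" "d0 v z = 0" for v z
  proof (cases v)
    case v_b
    then show ?thesis using that by - (rule comp_eqI, auto simp: sP1 quad_space_def)
  next
    case v_mid
    then have "c0 (d0 v_mid z) = 0" using that by simp
    then show ?thesis using that v_mid by - (rule comp_eqI, auto simp: sP1 quad_space_def dmid)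
  next
    case v_e
    then have "c0 (d0 v_e z) = 0" "c1 (d0 v_e z) = 0" "c2 (d0 v_e z) = 0" using that by simp_all
    then have 1: "c2 z = 0" "evens (c3 z) = 0" "odds (c3 z) = 0" by (simp_all add: dve mp0)
    have "c3 z = interleave (evens (c3 z)) (odds (c3 z))" by simp
    also have "\<dots> = 0" unfolding 1 by (simp add: interleave_def fun_eq_iff zero_fun_apply)
    finally show ?thesis using that v_e 1 by - (rule comp_eqI, auto simp: sP1 quad_space_def)
  qed
  have "quad_space {0} {0} {0} {0} = {0 :: nat \<Rightarrow> 'k}"
  proof (intro subset_antisym subsetI)
    fix z :: "nat \<Rightarrow> 'k" assume "z \<in> quad_space {0} {0} {0} {0}"
    then have "z = 0" by - (rule comp_eqI, auto simp: quad_space_def)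
    then show "z \<in> {0}" by simp
  qed (simp add: quad_space_def)
  then have spZ: "sp Z v = {0}" for v
    unfolding Z_def by (cases v) simp_all
  have P1z: "0 \<in> sp P1 v" for v
    using W0 by (cases v) (simp_all add: sP1 quad_space_def)
  define P where "P = (\<lambda>k::nat. case k of 0 \<Rightarrow> P0 | Suc 0 \<Rightarrow> P1 | Suc (Suc _) \<Rightarrow> Z)"
  define d where "d = (\<lambda>k::nat. case k of 0 \<Rightarrow> d0 | Suc _ \<Rightarrow> (\<lambda>i z. 0))"
  have P: "P 0 = P0" "P 1 = P1" "P (Suc 0) = P1" "P (Suc (Suc k)) = Z" "d 0 = d0" "d (Suc k) = (\<lambda>i z. 0)" for k
    unfolding P_def d_def by simp_all
  have zhom: "is_hom Q1 Z Y (\<lambda>i z. 0)" if Y: "is_rep Q1 Y" for Y :: "('k, vertex, arrow) std_rep"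
    using Y is_rep_subspace[OF Y] is_rep_mp_zero[OF Y] unfolding is_hom_def is_rep_def
    by (auto intro: linear_between_const_zero)
  have res: "proj_resolution Q1 X P d e"
    unfolding proj_resolution_def
  proof (intro conjI allI)
    fix k
    show "is_rep Q1 (P k)" unfolding P_def using rep by (auto split: nat.split)
    show "projective Q1 (P k)" unfolding P_def using proj by (auto split: nat.split)
    show "is_hom Q1 (P (Suc k)) (P k) (d k)"
    proof (cases k)
      case 0
      then show ?thesis using homd by (simp add: P)
    next
      case (Suc j)
      have "is_rep Q1 (P k)" unfolding P_def using rep by (auto split: nat.split)
      then show ?thesis unfolding Suc P using zhom by simp
    qed
    show "exact_at (P (Suc (Suc k))) (P (Suc k)) (d (Suc k)) (d k)"
    proof (cases k)
      case 0
      have "d0 v 0 = 0" for v by (rule is_hom_zero[OF rep(2) homd rep(1)])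
      then show ?thesis unfolding exact_at_def 0 P spZ using inj P1z by auto
    next
      case (Suc j)
      then show ?thesis by (auto simp: exact_at_def P spZ)
    qed
  qed (use home surj ex0 in \<open>simp_all only: P\<close>)
  have "coboundary Q1 X P d (Suc m) f" if f: "cocycle Q1 X P d (Suc m) f" for f
  proof (cases m)
    case 0
    then have homf: "is_hom Q1 P1 X f" using f unfolding cocycle_def by (simp add: P)
    have hf: "linear_between fscale (sp P1 v) fscale (kpow (n v)) (f v)" for v
      using is_homD(1)[OF homf, of v] by (simp add: P1_def sclX spX)
    have lqm: "linear_between fscale (kpow ?p) fscale (sp P1 v_mid) (\<lambda>x. quad 0 0 x 0)"
      unfolding sP1 by (intro linear_between_quad linear_between_id linear_between_const_zero sk s0)
    have lqe: "linear_between fscale W fscale (sp P1 v_e) (\<lambda>x. quad 0 0 0 x)"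
      unfolding sP1 by (intro linear_between_quad linear_between_id linear_between_const_zero sk s0)
    have lid: "lin ?p ?p (\<lambda>x. x)" "lin ?q ?q (\<lambda>x. x)" by (rule linear_between_id)+
    have lzero: "lin ?p ?q (\<lambda>x. 0)" "lin ?q ?p (\<lambda>x. 0)" by (intro linear_between_const_zero sk)+
    have i1: "linear_between fscale (kpow ?p) fscale W (\<lambda>x. interleave x 0)"
      and i2: "linear_between fscale (kpow ?q) fscale W (\<lambda>x. interleave 0 x)"
      unfolding linear_between_def W_def
      by (auto simp: interleave_def fun_eq_iff plus_fun_apply zero_fun_apply evens_def odds_def kpow_def)
    \<comment> \<open>The values of the cocycle on the generators of \<open>P1\<close>, sorted by
      arrow.\<close>
    define \<phi> where "\<phi> = (\<lambda>a x. case a of b_to_mid \<Rightarrow> f v_mid (quad 0 0 x 0)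
       | b_to_e \<Rightarrow> f v_e (quad 0 0 0 (interleave x 0)) | mid_to_e \<Rightarrow> f v_e (quad 0 0 0 (interleave 0 x)))"
    have "linear_between (scl X) (sp X (src Q1 a)) (scl X) (sp X (tgt Q1 a)) (\<phi> a)" for a
      by (cases a) (simp_all add: \<phi>_def sclX spX linear_between_compose[OF lqm hf]
          linear_between_compose[OF i1 linear_between_compose[OF lqe hf]] linear_between_compose[OF i2 linear_between_compose[OF lqe hf]])
    then obtain \<sigma> where \<sigma>: "\<And>i. linear_between (scl X) (sp X i) (scl X) (sp X i) (\<sigma> i)"
      and \<sigma>\<phi>: "\<And>a x. x \<in> sp X (src Q1 a) \<Longrightarrow> \<phi> a x = \<sigma> (tgt Q1 a) (mp X a x) - mp X a (\<sigma> (src Q1 a) x)"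
      using rig unfolding rigid_def by blast
    have l\<sigma>: "lin (n i) (n i) (\<sigma> i)" for i using \<sigma>[of i] by (simp add: sclX spX)
    have \<sigma>0: "\<sigma> i 0 = 0" for i using lin_zero[OF l\<sigma>] .
    have lm: "linear_between fscale (kpow (n i)) (scl X) (sp X i) (\<lambda>x. - \<sigma> i x)" for i
      unfolding sclX spX by (intro linear_between_minus sk l\<sigma>)
    \<comment> \<open>The sign comes from \<open>d0\<close>: on the generator x of an arrow a, the
      composite is a (- \<sigma> x) + \<sigma> (a x), which is \<phi> a x.\<close>
    define g where "g = free_hom X (\<lambda>x. - \<sigma> v_b x) (\<lambda>x. - \<sigma> v_mid x) (\<lambda>x. - \<sigma> v_e x)"
    have homg: "is_hom Q1 P0 X g"
      unfolding P0_def g_def by (rule is_hom_free_hom[OF repX lm lm lm]) simp_all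
    have homgd: "is_hom Q1 P1 X (\<lambda>v z. g v (d0 v z))"
      by (rule is_hom_compose[OF homd homg])
    have negX: "mp X a (- x) = - mp X a x" if "x \<in> kpow (n (src Q1 a))" for a x
    proof -
      have "lin (n (src Q1 a)) (n (tgt Q1 a)) (mp X a)" using X unfolding coord_rep_iff by blast
      from lin_diff[OF this zero_in_kpow that] show ?thesis by (simp add: mp0)
    qed
    have neg\<sigma>: "\<sigma> i (- x) = - \<sigma> i x" if "x \<in> kpow (n i)" for i x
      using lin_diff[OF l\<sigma> zero_in_kpow that] by (simp add: \<sigma>0)
    have "f v z = g v (d0 v z)" if "z \<in> sp P1 v" for v z
    proof (rule free_hom_eqI[OF homf[unfolded P1_def] homgd[unfolded P1_def] that[unfolded P1_def] _ _ W0])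
      fix u :: "nat \<Rightarrow> 'k" assume "u \<in> {0}"
      then show "f v_b (quad u 0 0 0) = g v_b (d0 v_b (quad u 0 0 0))"
        using is_hom_zero[OF rep(2) homf repX, of v_b] by (simp add: quad_zero db g_def \<sigma>0)
    next
      fix x :: "nat \<Rightarrow> 'k" assume x: "x \<in> kpow ?p"
      have "f v_mid (quad 0 0 x 0) = \<sigma> v_mid (?\<alpha> x) - ?\<alpha> (\<sigma> v_b x)"
        using \<sigma>\<phi>[of x b_to_mid] x by (simp add: \<phi>_def spX)
      then show "f v_mid (quad 0 0 x 0) = g v_mid (d0 v_mid (quad 0 0 x 0))"
        using negX[of "\<sigma> v_b x" b_to_mid] neg\<sigma>[OF lin_in[OF \<alpha> x]] lin_in[OF l\<sigma> x]
        by (simp add: dmid g_def)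
    next
      fix w assume w: "w \<in> W"
      then have y: "evens w \<in> kpow ?p" and z: "odds w \<in> kpow ?q" unfolding W_def by auto
      have "interleave (evens w) 0 + interleave 0 (odds w) = interleave (evens w) (odds w)"
        unfolding interleave_def by (rule ext) (simp add: plus_fun_apply zero_fun_apply)
      then have weq: "w = interleave (evens w) 0 + interleave 0 (odds w)" by simp
      have "quad 0 0 0 w = quad 0 0 0 (interleave (evens w) 0) + quad 0 0 0 (interleave 0 (odds w))"
        unfolding quad_add weq[symmetric] by simp
      then have "f v_e (quad 0 0 0 w) = f v_e (quad 0 0 0 (interleave (evens w) 0)) + f v_e (quad 0 0 0 (interleave 0 (odds w)))"
        using linear_betweenD(2)[OF hf[of v_e]] linear_betweenD(1)[OF lqe linear_betweenD(1)[OF i1 y]]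
          linear_betweenD(1)[OF lqe linear_betweenD(1)[OF i2 z]] by simp
      also have "\<dots> = (\<sigma> v_e (?\<gamma> (evens w)) - ?\<gamma> (\<sigma> v_b (evens w))) + (\<sigma> v_e (?\<beta> (odds w)) - ?\<beta> (\<sigma> v_mid (odds w)))"
        using \<sigma>\<phi>[of "evens w" b_to_e] \<sigma>\<phi>[of "odds w" mid_to_e] y z by (simp add: \<phi>_def spX)
      also have "\<dots> = g v_e (d0 v_e (quad 0 0 0 w))"
      proof -
        note gy = lin_in[OF \<gamma> y] and bz = lin_in[OF \<beta> z]
        have neg: "- u \<in> kpow k" if "u \<in> kpow k" for u :: "nat \<Rightarrow> 'k" and k
          using fs.subspace_neg[OF subspace_kpow that] .
        have "\<sigma> v_e (- ?\<gamma> (evens w) + - ?\<beta> (odds w)) = - \<sigma> v_e (?\<gamma> (evens w)) + - \<sigma> v_e (?\<beta> (odds w))"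
          using lin_add[OF l\<sigma> neg[OF gy] neg[OF bz]] neg\<sigma>[OF gy] neg\<sigma>[OF bz] by simp
        then show ?thesis
          using negX[of "\<sigma> v_b (evens w)" b_to_e] negX[of "\<sigma> v_mid (odds w)" mid_to_e]
            lin_in[OF l\<sigma> y] lin_in[OF l\<sigma> z]
          by (simp add: dve g_def mp0 \<sigma>0 algebra_simps)
      qed
      finally show "f v_e (quad 0 0 0 w) = g v_e (d0 v_e (quad 0 0 0 w))" .
    qed simp_all
    then show ?thesis using homg 0 by (auto simp: P)
  next
    case (Suc k)
    have homf: "is_hom Q1 Z X f" using f unfolding cocycle_def Suc by (simp add: P)
    have f0: "f v 0 = 0" for v by (rule is_hom_zero[OF rep(3) homf repX])
    have "is_hom Q1 (P m) X (\<lambda>i z. 0)"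
      using is_rep_subspace[OF repX] mp0 repX unfolding is_hom_def is_rep_def
      by (auto intro: linear_between_const_zero)
    then show ?thesis unfolding Suc using f0 by (auto simp: P spZ)
  qed
  then show ?thesis unfolding ext_zero_def using res by blast
qed

lemma exceptional_coord_iff:
  fixes X :: "('k::field, vertex, arrow) std_rep"
  assumes "coord_rep Q1 X n"
  shows "exceptional Q1 X \<longleftrightarrow> brick Q1 X \<and> rigid Q1 X"
  using ext_zero_imp_rigid[OF assms] rigid_imp_ext_zero[OF assms] unfolding exceptional_iff by blast


section \<open>Injective pencils\<close>

interpretation fsc: alg_closed_linear_operators fscale
  by unfold_locales

instance vertex :: finite
proof
  have "(UNIV :: vertex set) \<subseteq> {v_b, v_mid, v_e}"
    using vertex.exhaust by blast
  then show "finite (UNIV :: vertex set)" by (rule finite_subset) simp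
qed

instance arrow :: finite
proof
  have "(UNIV :: arrow set) \<subseteq> {b_to_e, b_to_mid, mid_to_e}"
    using arrow.exhaust by blast
  then show "finite (UNIV :: arrow set)" by (rule finite_subset) simp
qed

lemma sum_vertex: "(\<Sum>v\<in>UNIV. F v) = F v_b + F v_mid + (F v_e :: nat)"
proof -
  have "(UNIV :: vertex set) = {v_b, v_mid, v_e}" using vertex.exhaust by blast
  then show ?thesis unfolding \<open>UNIV = _\<close> by simp
qed

lemma sum_arrow: "(\<Sum>a\<in>UNIV. F a) = F b_to_e + F b_to_mid + (F mid_to_e :: nat)"
proof -
  have "(UNIV :: arrow set) = {b_to_e, b_to_mid, mid_to_e}" using arrow.exhaust by blast
  then show ?thesis unfolding \<open>UNIV = _\<close> by simp
qed

lemma evec_nonzero [simp]: "evec i \<noteq> (0 :: nat \<Rightarrow> 'k::field)"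
proof
  assume "evec i = (0 :: nat \<Rightarrow> 'k)"
  then have "evec i i = (0 :: nat \<Rightarrow> 'k) i" by (rule fun_cong)
  then show False by (simp add: zero_fun_apply)
qed

lemma coord_repD:
  assumes "coord_rep Q X n"
  shows "is_rep Q X" "scl X = fscale" "sp X i = kpow (n i)"
    "lin (n (src Q a)) (n (tgt Q a)) (mp X a)"
  using assms unfolding coord_rep_def is_rep_def by auto

lemma coord_rep_Q1_lin:
  assumes "coord_rep Q1 X n"
  shows "lin (n v_b) (n v_e) (mp X b_to_e)" "lin (n v_b) (n v_mid) (mp X b_to_mid)"
    "lin (n v_mid) (n v_e) (mp X mid_to_e)"
  using coord_repD(4)[OF assms, of b_to_e] coord_repD(4)[OF assms, of b_to_mid]
    coord_repD(4)[OF assms, of mid_to_e] by auto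

lemma coord_rep_mk_rep:
  "coord_rep Q1 (mk_rep p q r f g h) (case_vertex p q r) \<longleftrightarrow> lin p r f \<and> lin p q g \<and> lin q r h"
  unfolding coord_rep_iff all_arrow all_vertex by (auto simp: mk_rep_def fscale_def fun_eq_iff)

lemma mk_rep_mp [simp]:
  "mp (mk_rep p q r f g h) b_to_e = f" "mp (mk_rep p q r f g h) b_to_mid = g" "mp (mk_rep p q r f g h) mid_to_e = h"
  by (simp_all add: mk_rep_def)

section \<open>Maximal rank from rigidity\<close>

lemma max_rank_of_intertwiners:
  fixes \<theta> :: "(nat \<Rightarrow> 'k::field) \<Rightarrow> nat \<Rightarrow> 'k"
  assumes \<theta>: "lin p r \<theta>"
    and split: "\<And>\<phi>. lin p r \<phi> \<Longrightarrow> \<exists>\<sigma> \<tau>. lin p p \<sigma> \<and> lin r r \<tau> \<and> (\<forall>x\<in>kpow p. \<phi> x = \<tau> (\<theta> x) - \<theta> (\<sigma> x))"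
  shows "(\<forall>x\<in>kpow p. \<theta> x = 0 \<longrightarrow> x = 0) \<or> \<theta> ` kpow p = kpow r"
proof (rule disjCI)
  assume "\<theta> ` kpow p \<noteq> kpow r"
  show "\<forall>x\<in>kpow p. \<theta> x = 0 \<longrightarrow> x = 0"
  proof (intro ballI impI, rule ccontr)
    fix x assume x: "x \<in> kpow p" "\<theta> x = 0" and "x \<noteq> 0"
    then obtain i where i: "x i \<noteq> 0" by (auto simp: fun_eq_iff zero_fun_apply)
    have "kpow r \<subseteq> \<theta> ` kpow p"
    proof
      fix y :: "nat \<Rightarrow> 'k" assume y: "y \<in> kpow r"
      \<comment> \<open>A map of rank at most one with x \<mapsto> y. Evaluating its decomposition
        at the kernel vector x leaves only the term - \<theta> (\<sigma> x), so the arbitrary vector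
        y lies in the image.\<close>
      let ?\<phi> = "\<lambda>z. fscale (z i / x i) y"
      have "lin p r ?\<phi>"
        unfolding linear_between_def using fs.subspace_scale[OF subspace_kpow y]
        by (simp add: fun_eq_iff plus_fun_apply add_divide_distrib algebra_simps)
      from split[OF this] obtain \<sigma> \<tau> where \<sigma>: "lin p p \<sigma>" "lin r r \<tau>"
        and eq: "\<forall>x\<in>kpow p. ?\<phi> x = \<tau> (\<theta> x) - \<theta> (\<sigma> x)" by blast
      have "y = ?\<phi> x" using i by (simp add: fun_eq_iff)
      also have "\<dots> = - \<theta> (\<sigma> x)" using bspec[OF eq x(1)] x(2) lin_zero[OF \<sigma>(2)] by simp
      also have "\<dots> = \<theta> (- \<sigma> x)"
        using lin_diff[OF \<theta> zero_in_kpow lin_in[OF \<sigma>(1) x(1)]] lin_zero[OF \<theta>] by simp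
      finally show "y \<in> \<theta> ` kpow p"
        using fs.subspace_neg[OF subspace_kpow lin_in[OF \<sigma>(1) x(1)]] by blast
    qed
    then have "\<theta> ` kpow p = kpow r" using lin_in[OF \<theta>] by blast
    then show False using \<open>\<theta> ` kpow p \<noteq> kpow r\<close> by blast
  qed
qed

text \<open>Rigidity is applied to the family that is \<phi> on the arrow a and zero elsewhere; the
  zero entries make \<sigma> commute with all other arrows.\<close>

lemma rigid_arrow_intertwiners:
  fixes X :: "('k::field, 'q, 'a) std_rep"
  assumes X: "coord_rep Q X n" and rig: "rigid Q X" and \<phi>: "lin (n (src Q a)) (n (tgt Q a)) \<phi>"
  obtains \<sigma> where "\<And>i. lin (n i) (n i) (\<sigma> i)"
    "\<And>x. x \<in> kpow (n (src Q a)) \<Longrightarrow> \<phi> x = \<sigma> (tgt Q a) (mp X a x) - mp X a (\<sigma> (src Q a) x)"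
    "\<And>a' x. a' \<noteq> a \<Longrightarrow> x \<in> kpow (n (src Q a')) \<Longrightarrow> \<sigma> (tgt Q a') (mp X a' x) = mp X a' (\<sigma> (src Q a') x)"
proof -
  let ?\<phi> = "\<lambda>a'. if a' = a then \<phi> else (\<lambda>x. 0)"
  have "lin (n (src Q a')) (n (tgt Q a')) (?\<phi> a')" for a'
    using \<phi> linear_between_const_zero[OF vector_space_fscale subspace_kpow] by auto
  then obtain \<sigma> where \<sigma>: "\<And>i. lin (n i) (n i) (\<sigma> i)"
    and eq: "\<And>a' x. x \<in> kpow (n (src Q a')) \<Longrightarrow> ?\<phi> a' x = \<sigma> (tgt Q a') (mp X a' x) - mp X a' (\<sigma> (src Q a') x)"
    using rig[unfolded rigid_def coord_repD(2,3)[OF X], rule_format, of ?\<phi>] by blast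
  show ?thesis
  proof (rule that[of \<sigma>])
    fix a' and x :: "nat \<Rightarrow> 'k" assume "a' \<noteq> a" "x \<in> kpow (n (src Q a'))"
    then show "\<sigma> (tgt Q a') (mp X a' x) = mp X a' (\<sigma> (src Q a') x)" using eq[of x a'] by simp
  qed (use \<sigma> eq[of _ a] in simp_all)
qed

lemma rigid_arrow_max_rank:
  fixes X :: "('k::field, 'q, 'a) std_rep"
  assumes X: "coord_rep Q X n" and rig: "rigid Q X"
  shows "(\<forall>x\<in>kpow (n (src Q a)). mp X a x = 0 \<longrightarrow> x = 0) \<or> mp X a ` kpow (n (src Q a)) = kpow (n (tgt Q a))"
proof (rule max_rank_of_intertwiners[OF coord_repD(4)[OF X]])
  fix \<phi> :: "(nat \<Rightarrow> 'k) \<Rightarrow> nat \<Rightarrow> 'k" assume \<phi>: "lin (n (src Q a)) (n (tgt Q a)) \<phi>"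
  obtain \<sigma> where "\<And>i. lin (n i) (n i) (\<sigma> i)"
    "\<And>x. x \<in> kpow (n (src Q a)) \<Longrightarrow> \<phi> x = \<sigma> (tgt Q a) (mp X a x) - mp X a (\<sigma> (src Q a) x)"
    by (rule rigid_arrow_intertwiners[OF X rig \<phi>]) blast
  then show "\<exists>\<sigma> \<tau>. lin (n (src Q a)) (n (src Q a)) \<sigma> \<and> lin (n (tgt Q a)) (n (tgt Q a)) \<tau> \<and>
     (\<forall>x\<in>kpow (n (src Q a)). \<phi> x = \<tau> (mp X a x) - mp X a (\<sigma> x))" by blast
qed

lemma rigid_arrow_injective:
  fixes X :: "('k::field, 'q, 'a) std_rep"
  assumes X: "coord_rep Q X n" and rig: "rigid Q X" and le: "n (src Q a) \<le> n (tgt Q a)"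
    and x: "x \<in> kpow (n (src Q a))" "mp X a x = 0"
  shows "x = 0"
  using rigid_arrow_max_rank[OF X rig, of a] lin_surj_inj[OF coord_repD(4)[OF X] _ le x] x by blast

lemma rigid_arrow_surjective:
  fixes X :: "('k::field, 'q, 'a) std_rep"
  assumes X: "coord_rep Q X n" and rig: "rigid Q X" and le: "n (tgt Q a) \<le> n (src Q a)"
  shows "mp X a ` kpow (n (src Q a)) = kpow (n (tgt Q a))"
  using rigid_arrow_max_rank[OF X rig, of a] lin_inj_surj[OF coord_repD(4)[OF X] _ le] by blast

text \<open>Together with multiples of \<gamma> - c \<beta> \<alpha>, the nonzero multiples of
  \<beta> \<alpha> exhaust the nonzero members of the pencil, and \<beta> \<alpha> is injective by
  the first two conditions.\<close>

definition pencil_injective :: "('k::field, vertex, arrow) std_rep \<Rightarrow> (vertex \<Rightarrow> nat) \<Rightarrow> bool" where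
  "pencil_injective X n \<longleftrightarrow>
     (\<forall>x\<in>kpow (n v_b). mp X b_to_mid x = 0 \<longrightarrow> x = 0) \<and>
     (\<forall>x\<in>kpow (n v_mid). mp X mid_to_e x = 0 \<longrightarrow> x = 0) \<and>
     (\<forall>c. \<forall>x\<in>kpow (n v_b). mp X b_to_e x = fscale c (mp X mid_to_e (mp X b_to_mid x)) \<longrightarrow> x = 0)"

text \<open>For a family supported on the arrow from b to e, \<sigma> commutes with \<alpha> and
  \<beta>, hence with \<beta> \<alpha>. The multiple of \<beta> \<alpha> added to \<gamma> therefore
  cancels in \<sigma> \<theta> - \<theta> \<sigma>, and every member of the pencil inherits maximal
  rank.\<close>

lemma rigid_pencil_injective:
  fixes X :: "('k::field, vertex, arrow) std_rep"
  assumes X: "coord_rep Q1 X n" and rig: "rigid Q1 X" and le: "n v_b \<le> n v_mid" "n v_mid \<le> n v_e"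
  shows "pencil_injective X n"
  unfolding pencil_injective_def
proof (intro conjI allI ballI impI)
  fix x assume "x \<in> kpow (n v_b)" "mp X b_to_mid x = 0"
  then show "x = 0" using rigid_arrow_injective[OF X rig, of b_to_mid x] le by simp
next
  fix x assume "x \<in> kpow (n v_mid)" "mp X mid_to_e x = 0"
  then show "x = 0" using rigid_arrow_injective[OF X rig, of mid_to_e x] le by simp
next
  fix c and x :: "nat \<Rightarrow> 'k"
  assume x: "x \<in> kpow (n v_b)" "mp X b_to_e x = fscale c (mp X mid_to_e (mp X b_to_mid x))"
  let ?\<alpha> = "mp X b_to_mid" and ?\<beta> = "mp X mid_to_e" and ?\<gamma> = "mp X b_to_e"
  note \<gamma> = coord_rep_Q1_lin(1)[OF X] and \<alpha> = coord_rep_Q1_lin(2)[OF X] and \<beta> = coord_rep_Q1_lin(3)[OF X]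
  let ?\<theta> = "\<lambda>x. ?\<gamma> x + fscale (- c) (?\<beta> (?\<alpha> x))"
  have \<theta>: "lin (n v_b) (n v_e) ?\<theta>"
    by (intro linear_between_add linear_between_scale linear_between_compose[OF \<alpha> \<beta>] \<gamma> vector_space_fscale subspace_kpow)
  have "(\<forall>x\<in>kpow (n v_b). ?\<theta> x = 0 \<longrightarrow> x = 0) \<or> ?\<theta> ` kpow (n v_b) = kpow (n v_e)"
  proof (rule max_rank_of_intertwiners[OF \<theta>])
    fix \<phi> :: "(nat \<Rightarrow> 'k) \<Rightarrow> nat \<Rightarrow> 'k" assume "lin (n v_b) (n v_e) \<phi>"
    then have \<phi>: "lin (n (src Q1 b_to_e)) (n (tgt Q1 b_to_e)) \<phi>" by simp
    obtain \<sigma> where \<sigma>: "\<And>i. lin (n i) (n i) (\<sigma> i)"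
      and s1: "\<And>x. x \<in> kpow (n (src Q1 b_to_e)) \<Longrightarrow> \<phi> x = \<sigma> (tgt Q1 b_to_e) (?\<gamma> x) - ?\<gamma> (\<sigma> (src Q1 b_to_e) x)"
      and s2: "\<And>a x. a \<noteq> b_to_e \<Longrightarrow> x \<in> kpow (n (src Q1 a)) \<Longrightarrow> \<sigma> (tgt Q1 a) (mp X a x) = mp X a (\<sigma> (src Q1 a) x)"
      by (rule rigid_arrow_intertwiners[OF X rig \<phi>]) blast
    have "\<phi> y = \<sigma> v_e (?\<theta> y) - ?\<theta> (\<sigma> v_b y)" if y: "y \<in> kpow (n v_b)" for y
    proof -
      have \<alpha>y: "?\<alpha> y \<in> kpow (n v_mid)" by (rule lin_in[OF \<alpha> y])
      have \<beta>y: "?\<beta> (?\<alpha> y) \<in> kpow (n v_e)" by (rule lin_in[OF \<beta> \<alpha>y])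
      have \<sigma>\<beta>: "\<sigma> v_e (?\<beta> (?\<alpha> y)) = ?\<beta> (?\<alpha> (\<sigma> v_b y))"
        using s2[of mid_to_e "?\<alpha> y"] s2[of b_to_mid y] y \<alpha>y by simp
      have s3: "\<sigma> v_e (?\<theta> y) = \<sigma> v_e (?\<gamma> y) + fscale (- c) (?\<beta> (?\<alpha> (\<sigma> v_b y)))"
        unfolding lin_add[OF \<sigma> lin_in[OF \<gamma> y] fs.subspace_scale[OF subspace_kpow \<beta>y]] lin_scale[OF \<sigma> \<beta>y] \<sigma>\<beta> ..
      show ?thesis unfolding s3 using s1[of y] y by (simp add: algebra_simps)
    qed
    then show "\<exists>\<sigma> \<tau>. lin (n v_b) (n v_b) \<sigma> \<and> lin (n v_e) (n v_e) \<tau> \<and>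
        (\<forall>x\<in>kpow (n v_b). \<phi> x = \<tau> (?\<theta> x) - ?\<theta> (\<sigma> x))"
      using \<sigma> by blast
  qed
  moreover have "?\<theta> x = 0" using x(2) by simp
  ultimately show "x = 0"
    using lin_surj_inj[OF \<theta> _ _ x(1)] x(1) le order.trans[OF le] by blast
qed

text \<open>If \<open>S v_b\<close> is nonzero, an injective pencil over an algebraically closed
  field needs a target of larger dimension. If it is zero, the claim is that \<open>S v_e\<close> is
  nonzero, which holds because \<open>S v_mid\<close> embeds into it.\<close>

lemma pencil_injective_subrep:
  fixes X :: "('k::alg_closed_field, vertex, arrow) std_rep"
  assumes X: "coord_rep Q1 X n" and inj: "pencil_injective X n"
    and S: "\<And>v. fs.subspace (S v)" "\<And>v. S v \<subseteq> kpow (n v)"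
    and mpS: "\<And>a x. x \<in> S (src Q1 a) \<Longrightarrow> mp X a x \<in> S (tgt Q1 a)"
    and nz: "x \<in> S v" "x \<noteq> 0"
  shows "fs.dim (S v_b) < fs.dim (S v_e)"
proof -
  let ?\<alpha> = "mp X b_to_mid" and ?\<beta> = "mp X mid_to_e" and ?\<gamma> = "mp X b_to_e"
  note \<gamma> = coord_rep_Q1_lin(1)[OF X] and \<alpha> = coord_rep_Q1_lin(2)[OF X] and \<beta> = coord_rep_Q1_lin(3)[OF X]
  have fin: "fs.fin_subspace (S v)" for v
    by (rule fs.fin_subspace_subset[OF fin_subspace_kpow S])
  have i1: "x = 0" if "x \<in> kpow (n v_b)" "?\<alpha> x = 0" for x
    using inj that unfolding pencil_injective_def by blast
  have i2: "x = 0" if "x \<in> kpow (n v_mid)" "?\<beta> x = 0" for x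
    using inj that unfolding pencil_injective_def by blast
  have i3: "x = 0" if "x \<in> kpow (n v_b)" "?\<gamma> x = fscale c (?\<beta> (?\<alpha> x))" for x c
    using inj that unfolding pencil_injective_def by blast
  have mem: "?\<gamma> x \<in> S v_e" "?\<alpha> x \<in> S v_mid" if "x \<in> S v_b" for x
    using mpS[of x b_to_e] mpS[of x b_to_mid] that by simp_all
  have memb: "?\<beta> x \<in> S v_e" if "x \<in> S v_mid" for x
    using mpS[of x mid_to_e] that by simp
  show ?thesis
  proof (cases "S v_b = {0}")
    case True
    have "S v_e \<noteq> {0}"
    proof
      assume e: "S v_e = {0}"
      have "S v_mid \<subseteq> {0}" using memb S(2) i2 unfolding e by blast
      then have "S v \<subseteq> {0}" using True e by (cases v) auto
      then show False using nz by blast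
    qed
    then have "fs.dim (S v_e) \<noteq> 0" using fs.fin_subspace_dim_0[OF fin] by blast
    moreover have "fs.dim (S v_b) = 0" using fs.fin_subspace_dim_0[OF fin] True by blast
    ultimately show ?thesis by simp
  next
    case False
    obtain F where F: "Vector_Spaces.linear fscale fscale F" "\<And>x. x \<in> kpow (n v_b) \<Longrightarrow> F x = ?\<gamma> x"
      by (rule lin_extends[OF \<gamma>]) blast
    obtain G where G: "Vector_Spaces.linear fscale fscale G" "\<And>x. x \<in> kpow (n v_b) \<Longrightarrow> G x = ?\<beta> (?\<alpha> x)"
      by (rule lin_extends[OF linear_between_compose[OF \<alpha> \<beta>]]) blast
    show ?thesis
    proof (rule fsc.injective_pencil_dim_less[OF F(1) G(1) fin False fin])
      fix x assume x: "x \<in> S v_b"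
      then have k: "x \<in> kpow (n v_b)" using S(2) by blast
      show "F x \<in> S v_e" using F(2)[OF k] mem(1)[OF x] by simp
      show "G x \<in> S v_e" using G(2)[OF k] memb[OF mem(2)[OF x]] by simp
      show "x = 0" if "G x = 0"
        using i2[OF lin_in[OF \<alpha> k]] i1[OF k] that G(2)[OF k] by simp
      show "x = 0" if "F x = fscale c (G x)" for c
        using i3[OF k, of c] that F(2)[OF k] G(2)[OF k] by simp
    qed
  qed
qed

lemma coord_rep_homD:
  assumes X: "coord_rep Q X n" and Y: "coord_rep Q Y m" and h: "is_hom Q X Y h"
  shows "lin (n v) (m v) (h v)"
    and "x \<in> kpow (n (src Q a)) \<Longrightarrow> h (tgt Q a) (mp X a x) = mp Y a (h (src Q a) x)"
  using is_homD(1)[OF h, of v] is_homD(3)[OF h, of x a] coord_repD[OF X] coord_repD[OF Y] by simp_all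

text \<open>
  Kernel and image of a nonzero morphism that is not injective would both have defect
  \<open>dim\<^sub>b - dim\<^sub>e\<close> at most \<open>-1\<close>, although these defects add up to the defect \<open>-1\<close> of the domain.
\<close>

lemma pencil_injective_hom:
  fixes X Y :: "('k::alg_closed_field, vertex, arrow) std_rep"
  assumes X: "coord_rep Q1 X n" and Y: "coord_rep Q1 Y m"
    and iX: "pencil_injective X n" and iY: "pencil_injective Y m" and def: "n v_e = Suc (n v_b)"
    and h: "is_hom Q1 X Y h" and nz: "y \<in> kpow (n w)" "h w y \<noteq> 0"
    and x: "x \<in> kpow (n v)" "h v x = 0"
  shows "x = 0"
proof (rule ccontr)
  assume "x \<noteq> 0"
  note lh = coord_rep_homD(1)[OF X Y h] and ch = coord_rep_homD(2)[OF X Y h]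
  note rn = lin_rank_nullity[OF lh subspace_kpow order.refl]
  have "fs.dim {x \<in> kpow (n v_b). h v_b x = 0} < fs.dim {x \<in> kpow (n v_e). h v_e x = 0}"
  proof (rule pencil_injective_subrep[OF X iX, of "\<lambda>v. {x \<in> kpow (n v). h v x = 0}", OF rn(2)])
    fix a and x :: "nat \<Rightarrow> 'k" assume "x \<in> {x \<in> kpow (n (src Q1 a)). h (src Q1 a) x = 0}"
    then show "mp X a x \<in> {x \<in> kpow (n (tgt Q1 a)). h (tgt Q1 a) x = 0}"
      using ch[of x a] lin_in[OF coord_repD(4)[OF X]] is_rep_mp_zero[OF coord_repD(1)[OF Y]] by simp
  qed (use x \<open>x \<noteq> 0\<close> in auto)
  moreover have "fs.dim (h v_b ` kpow (n v_b)) < fs.dim (h v_e ` kpow (n v_e))"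
  proof (rule pencil_injective_subrep[OF Y iY, of "\<lambda>v. h v ` kpow (n v)", OF rn(3) _ _ imageI[OF nz(1)] nz(2)])
    show "h v ` kpow (n v) \<subseteq> kpow (m v)" for v using lin_in[OF lh] by blast
    fix a y assume "y \<in> h (src Q1 a) ` kpow (n (src Q1 a))"
    then obtain x where x: "x \<in> kpow (n (src Q1 a))" "y = h (src Q1 a) x" by blast
    show "mp Y a y \<in> h (tgt Q1 a) ` kpow (n (tgt Q1 a))"
      unfolding x(2) ch[OF x(1), symmetric] by (intro imageI lin_in[OF coord_repD(4)[OF X]] x(1))
  qed
  ultimately show False using rn(1)[of v_b] rn(1)[of v_e] def by simp
qed

lemma brickI:
  fixes X :: "('k::field, 'q, 'a) std_rep"
  assumes X: "coord_rep Q X n" and v: "n v > 0"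
    and "\<And>h. is_hom Q X X h \<Longrightarrow> \<exists>c. \<forall>i. \<forall>x\<in>kpow (n i). h i x = fscale c x"
  shows "brick Q X"
  unfolding brick_def coord_repD(2,3)[OF X]
proof (intro allI impI)
  fix h assume "is_hom Q X X h"
  then obtain c where c: "\<forall>i. \<forall>x\<in>kpow (n i). h i x = fscale c x" using assms(3) by blast
  show "\<exists>!c. \<forall>i. \<forall>x\<in>kpow (n i). h i x = fscale c x"
  proof (rule ex1I[of _ c])
    fix d assume "\<forall>i. \<forall>x\<in>kpow (n i). h i x = fscale d x"
    then have "fscale d (evec 0) = fscale c (evec 0 :: nat \<Rightarrow> 'k)"
      using c v by (metis evec_in_kpow)
    then show "d = c" by simp
  qed (rule c)
qed

text \<open>The argument of Schur's lemma: h has an eigenvalue c on the nonzero space at e, so h - c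
  id is an endomorphism that is not injective, and must vanish at every vertex.\<close>

lemma pencil_injective_brick:
  fixes X :: "('k::alg_closed_field, vertex, arrow) std_rep"
  assumes X: "coord_rep Q1 X n" and iX: "pencil_injective X n" and def: "n v_e = Suc (n v_b)"
  shows "brick Q1 X"
proof (rule brickI[OF X, of v_e])
  show "0 < n v_e" using def by simp
  fix h assume h: "is_hom Q1 X X h"
  note lh = coord_rep_homD(1)[OF X X h] and ch = coord_rep_homD(2)[OF X X h]
  obtain F where F: "Vector_Spaces.linear fscale fscale F" "\<And>x. x \<in> kpow (n v_e) \<Longrightarrow> F x = h v_e x"
    by (rule lin_extends[OF lh[of v_e]]) blast
  have "evec 0 \<in> kpow (n v_e)" using def by simp
  then have nz: "kpow (n v_e) \<noteq> {0 :: nat \<Rightarrow> 'k}" using evec_nonzero by blast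
  obtain y c where y: "y \<in> kpow (n v_e)" "y \<noteq> 0" "F y = fscale c y"
    by (rule fsc.eigenvector_exists[OF F(1) _ fin_subspace_kpow nz]) (use F(2) lin_in[OF lh] in auto)
  let ?h = "\<lambda>v x. h v x + fscale (- c) x"
  have h': "is_hom Q1 X X ?h"
    unfolding is_hom_def coord_repD(2,3)[OF X]
  proof (intro conjI allI ballI)
    fix v show "lin (n v) (n v) (?h v)"
      by (intro linear_between_add linear_between_scale linear_between_id lh vector_space_fscale subspace_kpow)
  next
    fix a and x :: "nat \<Rightarrow> 'k" assume x: "x \<in> kpow (n (src Q1 a))"
    note l = coord_repD(4)[OF X, of a]
    show "?h (tgt Q1 a) (mp X a x) = mp X a (?h (src Q1 a) x)"
      unfolding lin_add[OF l lin_in[OF lh x] fs.subspace_scale[OF subspace_kpow x]] lin_scale[OF l x] ch[OF x] ..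
  qed
  have "?h v_e y = 0" using y(3) F(2)[OF y(1)] by (simp add: fun_eq_iff zero_fun_apply plus_fun_apply)
  then have "?h v x = 0" if "x \<in> kpow (n v)" for v x
    using pencil_injective_hom[OF X X iX iX def h' that _ y(1)] y(2) by blast
  then have "h v x = fscale c x" if "x \<in> kpow (n v)" for v x
    using that by (simp add: fun_eq_iff zero_fun_apply plus_fun_apply)
  then show "\<exists>c. \<forall>i. \<forall>x\<in>kpow (n i). h i x = fscale c x" by blast
qed

text \<open>For either value of \<open>n v_mid\<close> the Euler form of n with itself is 1, which
  yields a nonzero morphism; it is injective, and equal dimensions make it bijective.\<close>

lemma pencil_injective_iso:
  fixes X Y :: "('k::alg_closed_field, vertex, arrow) std_rep"
  assumes X: "coord_rep Q1 X n" and Y: "coord_rep Q1 Y n"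
    and iX: "pencil_injective X n" and iY: "pencil_injective Y n" and def: "n v_e = Suc (n v_b)"
    and mid: "n v_mid = n v_b \<or> n v_mid = n v_e"
  shows "rep_iso Q1 X Y"
proof -
  have "(\<Sum>a\<in>UNIV. n (src Q1 a) * n (tgt Q1 a)) < (\<Sum>v\<in>UNIV. n v * n v)"
    unfolding sum_vertex sum_arrow using def mid by auto
  then obtain h w y where h: "is_hom Q1 X Y h" and y: "y \<in> sp X w" "h w y \<noteq> 0"
    by (rule nonzero_hom_exists[OF X Y])
  have y': "y \<in> kpow (n w)" using y(1) coord_repD(3)[OF X] by simp
  note lh = coord_rep_homD(1)[OF X Y h]
  have inj: "x = 0" if "x \<in> kpow (n v)" "h v x = 0" for v x
    by (rule pencil_injective_hom[OF X Y iX iY def h y' y(2) that])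
  have "bij_betw (h v) (sp X v) (sp Y v)" for v
    unfolding bij_betw_def coord_repD(3)[OF X] coord_repD(3)[OF Y]
    using lin_kernel_trivial(1)[OF lh inj[of _ v]] lin_inj_surj[OF lh inj[of _ v] order.refl] by simp
  then show ?thesis using bij_hom_imp_rep_iso[OF coord_repD(1)[OF X] h] by blast
qed


section \<open>Duality\<close>

text \<open>The transposed matrix in standard coordinates. Using it in place of spaces of
  functionals keeps the dual representation on the carrier
  \<open>nat \<Rightarrow> 'k\<close>.\<close>

definition transposed :: "nat \<Rightarrow> nat \<Rightarrow> ((nat \<Rightarrow> 'k::field) \<Rightarrow> nat \<Rightarrow> 'k) \<Rightarrow> (nat \<Rightarrow> 'k) \<Rightarrow> nat \<Rightarrow> 'k" where
  "transposed p r f y = (\<lambda>i. if i < p then \<Sum>j<r. y j * f (evec i) j else 0)"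

lemma lin_transposed: "lin r p (transposed p r f)"
  unfolding linear_between_def transposed_def kpow_def
  by (auto simp: fun_eq_iff plus_fun_apply sum.distrib distrib_right sum_distrib_left mult.assoc)

lemma transposed_pairing:
  assumes f: "lin p r f" and x: "x \<in> kpow p"
  shows "(\<Sum>i<p. transposed p r f y i * x i) = (\<Sum>j<r. y j * f x j)"
proof -
  have "(\<Sum>j<r. y j * f x j) = (\<Sum>j<r. \<Sum>i<p. y j * f (evec i) j * x i)"
    unfolding lin_expansion[OF f x] sum_fun_apply by (simp add: sum_distrib_left mult_ac)
  also have "\<dots> = (\<Sum>i<p. \<Sum>j<r. y j * f (evec i) j * x i)" by (rule sum.swap)
  also have "\<dots> = (\<Sum>i<p. transposed p r f y i * x i)"
    unfolding transposed_def by (intro sum.cong) (simp_all add: sum_distrib_right)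
  finally show ?thesis by simp
qed

lemma transposed_compose:
  assumes f: "lin p q f" and g: "lin q r g"
  shows "transposed p q f (transposed q r g y) = transposed p r (\<lambda>x. g (f x)) y"
proof
  fix i
  show "transposed p q f (transposed q r g y) i = transposed p r (\<lambda>x. g (f x)) y i"
  proof (cases "i < p")
    case True
    then have "f (evec i) \<in> kpow q" using lin_in[OF f, of "evec i"] by simp
    from transposed_pairing[OF g this, of y] show ?thesis using True by (simp add: transposed_def[of p])
  qed (simp add: transposed_def)
qed

lemma transposed_cong:
  assumes "\<And>x. x \<in> kpow p \<Longrightarrow> f x = g x"
  shows "transposed p r f = transposed p r g"
  using assms unfolding transposed_def by (auto simp: fun_eq_iff intro!: sum.cong)

lemma transposed_scale:
  assumes "y \<in> kpow p"
  shows "transposed p p (fscale c) y = fscale c y"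
proof
  fix i
  have "(\<Sum>j<p. y j * fscale c (evec i) j) = (\<Sum>j<p. if j = i then c * y j else 0)"
    by (intro sum.cong) auto
  then show "transposed p p (fscale c) y i = fscale c y i"
    using assms unfolding transposed_def kpow_def by (auto simp: not_less)
qed

lemma transposed_transposed:
  assumes f: "lin p r f" and x: "x \<in> kpow p"
  shows "transposed r p (transposed p r f) x = f x"
proof
  fix j
  show "transposed r p (transposed p r f) x j = f x j"
  proof (cases "j < r")
    case True
    have "transposed p r f (evec j) i = f (evec i) j" if "i < p" for i
    proof -
      have "(\<Sum>k<r. evec j k * f (evec i) k) = (\<Sum>k<r. if k = j then f (evec i) k else 0)"
        by (intro sum.cong) auto
      then show ?thesis using True that unfolding transposed_def by simp
    qed
    then show ?thesis
      using True unfolding transposed_def[of r] lin_expansion[OF f x] sum_fun_apply by simp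
  next
    case False
    then show ?thesis using lin_in[OF f x] unfolding transposed_def kpow_def by simp
  qed
qed

text \<open>Duality reverses the arrows, and exchanging b with e identifies the opposite quiver with
  \<open>Q1\<close> again. The arrow from b to e stays in place while the two arrows at mid are
  swapped. The sizes of the matrices are supplied by n.\<close>

definition dual_rep :: "('k::field, vertex, arrow) std_rep \<Rightarrow> (vertex \<Rightarrow> nat) \<Rightarrow> ('k, vertex, arrow) std_rep" where
  "dual_rep X n = mk_rep (n v_e) (n v_mid) (n v_b)
     (transposed (n v_b) (n v_e) (mp X b_to_e)) (transposed (n v_mid) (n v_e) (mp X mid_to_e))
     (transposed (n v_b) (n v_mid) (mp X b_to_mid))"

fun opp :: "vertex \<Rightarrow> vertex" where
  "opp v_b = v_e" | "opp v_mid = v_mid" | "opp v_e = v_b"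

fun opp_arrow :: "arrow \<Rightarrow> arrow" where
  "opp_arrow b_to_e = b_to_e" | "opp_arrow b_to_mid = mid_to_e" | "opp_arrow mid_to_e = b_to_mid"

lemma opp_opp [simp]: "opp (opp v) = v"
  by (cases v) auto

lemma src_opp [simp]: "src Q1 (opp_arrow a) = opp (tgt Q1 a)"
  and tgt_opp [simp]: "tgt Q1 (opp_arrow a) = opp (src Q1 a)"
  by (cases a; simp)+

lemma dual_rep_mp:
  "mp (dual_rep X n) a = transposed (n (opp (tgt Q1 a))) (n (opp (src Q1 a))) (mp X (opp_arrow a))"
  by (cases a) (simp_all add: dual_rep_def)

lemma coord_rep_dual: "coord_rep Q1 (dual_rep X n) (\<lambda>v. n (opp v))"
proof -
  have "case_vertex (n v_e) (n v_mid) (n v_b) = (\<lambda>v. n (opp v))"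
    by (rule ext) (simp split: vertex.split)
  then show ?thesis
    using coord_rep_mk_rep lin_transposed unfolding dual_rep_def by metis
qed

text \<open>Transposition reverses composites, so the commuting square of h at the opposite arrow
  becomes the square required at a.\<close>

lemma is_hom_dual:
  assumes X: "coord_rep Q1 X n" and Y: "coord_rep Q1 Y m" and h: "is_hom Q1 X Y h"
  shows "is_hom Q1 (dual_rep Y m) (dual_rep X n) (\<lambda>v. transposed (n (opp v)) (m (opp v)) (h (opp v)))"
  unfolding is_hom_def coord_repD(2,3)[OF coord_rep_dual]
proof (intro conjI allI ballI)
  fix a y
  note lh = coord_rep_homD(1)[OF X Y h] and ch = coord_rep_homD(2)[OF X Y h]
  let ?s = "opp (tgt Q1 a)" and ?t = "opp (src Q1 a)"
  have lX: "lin (n ?s) (n ?t) (mp X (opp_arrow a))" and lY: "lin (m ?s) (m ?t) (mp Y (opp_arrow a))"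
    using coord_repD(4)[OF X, of "opp_arrow a"] coord_repD(4)[OF Y, of "opp_arrow a"] by simp_all
  show "transposed (n ?s) (m ?s) (h ?s) (mp (dual_rep Y m) a y)
      = mp (dual_rep X n) a (transposed (n ?t) (m ?t) (h ?t) y)"
    unfolding dual_rep_mp transposed_compose[OF lh lY] transposed_compose[OF lX lh]
    by (rule fun_cong[OF transposed_cong]) (use ch[of _ "opp_arrow a"] in simp)
qed (rule lin_transposed)

text \<open>Values outside the spaces are arbitrary, so representations with the same matrices may
  differ as records; the identity is still an isomorphism.\<close>

lemma rep_iso_of_agreement:
  assumes X: "coord_rep Q X n" and Y: "coord_rep Q Y n"
    and "\<And>a x. x \<in> kpow (n (src Q a)) \<Longrightarrow> mp X a x = mp Y a x"
  shows "rep_iso Q X Y"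
  unfolding rep_iso_def is_hom_def coord_repD(2,3)[OF X] coord_repD(2,3)[OF Y]
  using assms(3) linear_between_id by (intro exI[of _ "\<lambda>i x. x"]) auto

lemma rep_iso_dual_dual:
  assumes X: "coord_rep Q1 X n"
  shows "rep_iso Q1 X (dual_rep (dual_rep X n) (\<lambda>v. n (opp v)))"
proof (rule rep_iso_of_agreement[OF X])
  show "coord_rep Q1 (dual_rep (dual_rep X n) (\<lambda>v. n (opp v))) n"
    using coord_rep_dual[of "dual_rep X n" "\<lambda>v. n (opp v)"] by simp
  have aa: "opp_arrow (opp_arrow a) = a" for a by (cases a) auto
  fix a and x :: "nat \<Rightarrow> 'a" assume x: "x \<in> kpow (n (src Q1 a))"
  show "mp X a x = mp (dual_rep (dual_rep X n) (\<lambda>v. n (opp v))) a x"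
    unfolding dual_rep_mp using transposed_transposed[OF coord_repD(4)[OF X] x] by (simp add: aa)
qed

lemma rep_iso_dual:
  assumes X: "coord_rep Q1 X n" and Y: "coord_rep Q1 Y m" and iso: "rep_iso Q1 X Y"
  shows "rep_iso Q1 (dual_rep X n) (dual_rep Y m)"
proof -
  obtain f g where f: "is_hom Q1 X Y f" and g: "is_hom Q1 Y X g"
    and gf: "\<And>i x. x \<in> sp X i \<Longrightarrow> g i (f i x) = x" and fg: "\<And>i y. y \<in> sp Y i \<Longrightarrow> f i (g i y) = y"
    using iso unfolding rep_iso_def by blast
  note lf = coord_rep_homD(1)[OF X Y f] and lg = coord_rep_homD(1)[OF Y X g]
  have "transposed (n v) (m v) (f v) (transposed (m v) (n v) (g v) y) = y" if y: "y \<in> kpow (n v)" for v y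
  proof -
    have "transposed (n v) (m v) (f v) (transposed (m v) (n v) (g v) y) = transposed (n v) (n v) (fscale 1) y"
      unfolding transposed_compose[OF lf lg]
      by (rule fun_cong[OF transposed_cong]) (use gf coord_repD(3)[OF X] in simp)
    then show ?thesis using transposed_scale[OF y] by simp
  qed
  moreover have "transposed (m v) (n v) (g v) (transposed (n v) (m v) (f v) y) = y" if y: "y \<in> kpow (m v)" for v y
  proof -
    have "transposed (m v) (n v) (g v) (transposed (n v) (m v) (f v) y) = transposed (m v) (m v) (fscale 1) y"
      unfolding transposed_compose[OF lg lf]
      by (rule fun_cong[OF transposed_cong]) (use fg coord_repD(3)[OF Y] in simp)
    then show ?thesis using transposed_scale[OF y] by simp
  qed
  ultimately show ?thesis
    unfolding rep_iso_def coord_repD(3)[OF coord_rep_dual]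
    using is_hom_dual[OF X Y f] is_hom_dual[OF Y X g]
    by (intro exI[of _ "\<lambda>v. transposed (m (opp v)) (n (opp v)) (g (opp v))"]
        exI[of _ "\<lambda>v. transposed (n (opp v)) (m (opp v)) (f (opp v))"]) blast
qed

text \<open>An endomorphism of the dual transposes to one of the double dual, which is isomorphic to
  X and hence a brick. Transposing the resulting scalar back recovers h.\<close>

lemma brick_dual:
  assumes X: "coord_rep Q1 X n" and b: "brick Q1 X"
  shows "brick Q1 (dual_rep X n)"
proof -
  let ?D = "dual_rep X n" and ?d = "\<lambda>v. n (opp v)"
  note D = coord_rep_dual[of X n]
  have bDD: "brick Q1 (dual_rep ?D ?d)" by (rule brick_iso[OF rep_iso_dual_dual[OF X] b])
  obtain v where "n v > 0" using brick_nonzero[OF X b] by blast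
  then have v: "?d (opp v) > 0" by simp
  show ?thesis
  proof (rule brickI[OF D v])
    fix h assume h: "is_hom Q1 ?D ?D h"
    note lh = coord_rep_homD(1)[OF D D h]
    obtain c where "\<forall>v. \<forall>x\<in>kpow (n (opp (opp v))).
        transposed (n (opp (opp v))) (n (opp (opp v))) (h (opp v)) x = fscale c x"
      using bDD[unfolded brick_def coord_repD(2,3)[OF coord_rep_dual], rule_format, OF is_hom_dual[OF D D h]] by blast
    then have c: "transposed (n v) (n v) (h (opp v)) x = fscale c x" if "x \<in> kpow (n v)" for v x
      using that by simp
    have "h v x = fscale c x" if x: "x \<in> kpow (?d v)" for v x
    proof -
      have "h v x = transposed (?d v) (?d v) (transposed (?d v) (?d v) (h v)) x"
        using transposed_transposed[OF lh x] by simp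
      also have "\<dots> = transposed (?d v) (?d v) (fscale c) x"
        by (rule fun_cong[OF transposed_cong]) (use c[of _ "opp v"] in simp)
      also have "\<dots> = fscale c x" by (rule transposed_scale[OF x])
      finally show ?thesis .
    qed
    then show "\<exists>c. \<forall>i. \<forall>x\<in>kpow (?d i). h i x = fscale c x" by blast
  qed
qed


section \<open>The list of exceptional representations\<close>

fun label_dim :: "label \<Rightarrow> vertex \<Rightarrow> nat" where
  "label_dim (E1 m) = case_vertex (m + 1) m m"
| "label_dim (E2 m) = case_vertex m (m + 1) (m + 1)"
| "label_dim (E3 m) = case_vertex m m (m + 1)"
| "label_dim (E4 m) = case_vertex (m + 1) (m + 1) m"
| "label_dim M = case_vertex 0 1 0"
| "label_dim M' = case_vertex 1 0 1"

lemma label_dim_inj: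
  assumes "label_dim l = label_dim l'"
  shows "l = l'"
proof -
  have "label_dim l v_b = label_dim l' v_b" "label_dim l v_mid = label_dim l' v_mid" "label_dim l v_e = label_dim l' v_e"
    using assms by auto
  then show ?thesis by (cases l; cases l') auto
qed

lemma lin_structure_maps:
  "lin (Suc m) m (pi_plus m)" "lin (Suc m) m (pi_minus m)" "lin m (Suc m) (j_plus m)" "lin m (Suc m) (j_minus m)"
  "lin m m id" "lin p q (\<lambda>x. 0)"
  unfolding linear_between_def kpow_def pi_plus_def pi_minus_def j_plus_def j_minus_def
  by (auto simp: fun_eq_iff plus_fun_apply zero_fun_apply)

lemma lin_structure_maps_zero: "lin p q (\<lambda>_ _. 0)"
  using lin_structure_maps(6)[of p q] by (simp add: zero_fun_def)

lemma coord_rep_listed: "coord_rep Q1 (listed l) (label_dim l)"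
  by (cases l) (simp_all add: coord_rep_mk_rep lin_structure_maps lin_structure_maps_zero)

text \<open>Comparing coordinates gives x_0 = 0 and x_i = c x_(i-1) for 0 < i < m.\<close>

lemma shift_pencil_injective:
  fixes x :: "nat \<Rightarrow> 'k::field"
  assumes x: "x \<in> kpow m" and eq: "j_plus m x = fscale c (j_minus m x)"
  shows "x = 0"
proof -
  have "x i = 0" for i
  proof (induction i rule: less_induct)
    case (less i)
    show ?case
    proof (cases "i < m")
      case True
      have "j_plus m x i = c * j_minus m x i" using eq by simp
      then show ?thesis using True less[of "i - 1"] by (auto simp: j_plus_def j_minus_def split: if_splits)
    next
      case False
      then show ?thesis using x by (simp add: kpow_def)
    qed
  qed
  then show ?thesis by (simp add: fun_eq_iff zero_fun_apply)
qed

lemma j_minus_injective: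
  assumes x: "x \<in> kpow m" and eq: "j_minus m x = (0 :: nat \<Rightarrow> 'k::field)"
  shows "x = 0"
proof
  fix i
  show "x i = (0 :: nat \<Rightarrow> 'k) i"
  proof (cases "i < m")
    case True
    then show ?thesis using fun_cong[OF eq, of "Suc i"] by (simp add: j_minus_def zero_fun_apply)
  qed (use x in \<open>simp add: kpow_def zero_fun_apply\<close>)
qed

lemma pencil_injective_listed:
  "pencil_injective (listed (E2 m)) (label_dim (E2 m))" "pencil_injective (listed (E3 m)) (label_dim (E3 m))"
  unfolding pencil_injective_def
  using shift_pencil_injective[of _ m] j_minus_injective[of _ m] by auto

text \<open>Inserting a zero coordinate is transposed to deleting that coordinate, so
  \<open>j_plus\<close> and \<open>j_minus\<close> become \<open>pi_plus\<close> and
  \<open>pi_minus\<close>; the identity moves to the other arrow at mid.\<close>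

lemma dual_listed:
  "rep_iso Q1 (dual_rep (listed (E3 m)) (label_dim (E3 m))) (listed (E1 m) :: ('k::field, vertex, arrow) std_rep)"
  "rep_iso Q1 (dual_rep (listed (E2 m)) (label_dim (E2 m))) (listed (E4 m) :: ('k, vertex, arrow) std_rep)"
proof -
  have jp: "transposed m (Suc m) (j_plus m) y = pi_plus m y" for y :: "nat \<Rightarrow> 'k"
  proof
    fix i
    have "(\<Sum>j<Suc m. y j * j_plus m (evec i) j) = (\<Sum>j<Suc m. if j = i then y j else 0)" if "i < m"
      using that by (intro sum.cong) (auto simp: j_plus_def)
    then show "transposed m (Suc m) (j_plus m) y i = pi_plus m y i"
      by (auto simp: transposed_def pi_plus_def)
  qed
  have jm: "transposed m (Suc m) (j_minus m) y = pi_minus m y" for y :: "nat \<Rightarrow> 'k"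
  proof
    fix i
    have "(\<Sum>j<Suc m. y j * j_minus m (evec i) j) = (\<Sum>j<Suc m. if j = Suc i then y j else 0)" if "i < m"
      using that by (intro sum.cong) (auto simp: j_minus_def)
    then show "transposed m (Suc m) (j_minus m) y i = pi_minus m y i"
      by (auto simp: transposed_def pi_minus_def)
  qed
  have id: "transposed k k id y = y" if "y \<in> kpow k" for k and y :: "nat \<Rightarrow> 'k"
  proof -
    have "transposed k k id y = transposed k k (fscale 1) y"
      by (rule fun_cong[OF transposed_cong]) simp
    then show ?thesis using transposed_scale[OF that, of 1] by simp
  qed
  have d: "(\<lambda>v. label_dim (E3 m) (opp v)) = label_dim (E1 m)" "(\<lambda>v. label_dim (E2 m) (opp v)) = label_dim (E4 m)"
    by (auto split: vertex.split intro!: ext)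
  show "rep_iso Q1 (dual_rep (listed (E3 m)) (label_dim (E3 m))) (listed (E1 m) :: ('k, vertex, arrow) std_rep)"
  proof (rule rep_iso_of_agreement[OF coord_rep_dual[of _ "label_dim (E3 m)", unfolded d] coord_rep_listed])
    fix a and x :: "nat \<Rightarrow> 'k" assume "x \<in> kpow (label_dim (E1 m) (src Q1 a))"
    then show "mp (dual_rep (listed (E3 m)) (label_dim (E3 m))) a x = mp (listed (E1 m)) a x"
      by (cases a) (simp_all add: dual_rep_def jp jm id)
  qed
  show "rep_iso Q1 (dual_rep (listed (E2 m)) (label_dim (E2 m))) (listed (E4 m) :: ('k, vertex, arrow) std_rep)"
  proof (rule rep_iso_of_agreement[OF coord_rep_dual[of _ "label_dim (E2 m)", unfolded d] coord_rep_listed])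
    fix a and x :: "nat \<Rightarrow> 'k" assume "x \<in> kpow (label_dim (E4 m) (src Q1 a))"
    then show "mp (dual_rep (listed (E2 m)) (label_dim (E2 m))) a x = mp (listed (E4 m)) a x"
      by (cases a) (simp_all add: dual_rep_def jp jm id)
  qed
qed

lemma lin_1_1:
  assumes f: "lin 1 1 f"
  obtains c where "\<And>x. x \<in> kpow 1 \<Longrightarrow> f x = fscale c x"
proof (rule that[of "f (evec 0) 0"])
  fix x :: "nat \<Rightarrow> 'a" assume x: "x \<in> kpow 1"
  have "f x = fscale (x 0) (f (evec 0))" using lin_expansion[OF f x] by simp
  moreover have "f (evec 0) \<in> kpow 1" using lin_in[OF f, of "evec 0"] by simp
  ultimately show "f x = fscale (f (evec 0) 0) x"
    using x unfolding kpow_def by (auto simp: fun_eq_iff) (metis One_nat_def less_one mult.commute mult_zero_left not_le)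
qed

lemma brick_listed: "brick Q1 (listed l :: ('k::alg_closed_field, vertex, arrow) std_rep)"
proof -
  have 2: "brick Q1 (listed (E2 m) :: ('k, vertex, arrow) std_rep)" for m
    by (rule pencil_injective_brick[OF coord_rep_listed pencil_injective_listed(1)]) simp
  have 3: "brick Q1 (listed (E3 m) :: ('k, vertex, arrow) std_rep)" for m
    by (rule pencil_injective_brick[OF coord_rep_listed pencil_injective_listed(2)]) simp
  have 1: "brick Q1 (listed (E1 m) :: ('k, vertex, arrow) std_rep)" for m
    by (rule brick_iso[OF dual_listed(1) brick_dual[OF coord_rep_listed 3]])
  have 4: "brick Q1 (listed (E4 m) :: ('k, vertex, arrow) std_rep)" for m
    by (rule brick_iso[OF dual_listed(2) brick_dual[OF coord_rep_listed 2]])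
  have 5: "brick Q1 (listed M :: ('k, vertex, arrow) std_rep)"
  proof (rule brickI[OF coord_rep_listed, where v = v_mid])
    fix h assume h: "is_hom Q1 (listed M :: ('k, vertex, arrow) std_rep) (listed M) h"
    note lh = coord_rep_homD(1)[OF coord_rep_listed coord_rep_listed h]
    obtain c where c: "\<And>x. x \<in> kpow 1 \<Longrightarrow> h v_mid x = fscale c x"
      by (rule lin_1_1[of "h v_mid"]) (use lh[of v_mid] in auto)
    have "h i 0 = 0" for i by (rule lin_zero[OF lh])
    then have "h i x = fscale c x" if "x \<in> kpow (label_dim M i)" for i x
      using that c by (cases i) (auto simp: kpow_0)
    then show "\<exists>c. \<forall>i. \<forall>x\<in>kpow (label_dim M i). h i x = fscale c x" by blast
  qed simp
  have 6: "brick Q1 (listed M' :: ('k, vertex, arrow) std_rep)"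
  proof (rule brickI[OF coord_rep_listed, where v = v_b])
    fix h assume h: "is_hom Q1 (listed M' :: ('k, vertex, arrow) std_rep) (listed M') h"
    note lh = coord_rep_homD(1)[OF coord_rep_listed coord_rep_listed h]
    obtain c where c: "\<And>x. x \<in> kpow 1 \<Longrightarrow> h v_b x = fscale c x"
      by (rule lin_1_1[of "h v_b"]) (use lh[of v_b] in auto)
    have "h v_e x = h v_b x" if "x \<in> kpow 1" for x
      using coord_rep_homD(2)[OF coord_rep_listed coord_rep_listed h, of x b_to_e] that by simp
    moreover have "h i 0 = 0" for i by (rule lin_zero[OF lh])
    ultimately have "h i x = fscale c x" if "x \<in> kpow (label_dim M' i)" for i x
      using that c by (cases i) (auto simp: kpow_0)
    then show "\<exists>c. \<forall>i. \<forall>x\<in>kpow (label_dim M' i). h i x = fscale c x" by blast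
  qed simp
  show ?thesis by (cases l) (simp_all only: 1 2 3 4 5 6)
qed

text \<open>All listed dimension vectors have Euler form 1, the equality under which a brick is
  rigid.\<close>

lemma exceptional_listed: "exceptional Q1 (listed l :: ('k::alg_closed_field, vertex, arrow) std_rep)"
proof -
  have "rigid Q1 (listed l :: ('k, vertex, arrow) std_rep)"
    by (rule brick_imp_rigid[OF coord_rep_listed brick_listed], cases l) (simp_all add: sum_vertex sum_arrow)
  then show ?thesis
    unfolding exceptional_coord_iff[OF coord_rep_listed] using brick_listed by blast
qed

lemma rep_iso_dim_le:
  assumes X: "coord_rep Q X n" and Y: "coord_rep Q Y m" and iso: "rep_iso Q X Y"
  shows "n v \<le> m v"
proof -
  obtain f g where f: "is_hom Q X Y f" and g: "is_hom Q Y X g"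
    and gf: "\<And>i x. x \<in> sp X i \<Longrightarrow> g i (f i x) = x"
    using iso unfolding rep_iso_def by blast
  note lf = coord_rep_homD(1)[OF X Y f] and lg = coord_rep_homD(1)[OF Y X g]
  show ?thesis
  proof (rule lin_inj_le[OF lf[of v]])
    fix x assume x: "x \<in> kpow (n v)" "f v x = 0"
    have "g v (f v x) = x" using gf[of x v] x(1) coord_repD(3)[OF X] by simp
    then show "x = 0" using x(2) lin_zero[OF lg] by simp
  qed
qed

lemma rep_iso_listed_eq:
  assumes "rep_iso Q1 (listed l :: ('k::field, vertex, arrow) std_rep) (listed l' :: ('k, vertex, arrow) std_rep)"
  shows "l = l'"
  using rep_iso_dim_le[OF coord_rep_listed coord_rep_listed assms]
    rep_iso_dim_le[OF coord_rep_listed coord_rep_listed rep_iso_sym[OF assms]]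
  by (intro label_dim_inj ext order.antisym)


section \<open>Classification\<close>

text \<open>With a = p - q and b = q - r the doubled inequality reads a^2 + b^2 + (a + b)^2 \<le> 2.
  Hence a, b and a + b have absolute value at most 1, and a, b are not both 1 or both -1.\<close>

lemma euler_form_le_one_cases:
  fixes p q r :: nat
  assumes "p * p + q * q + r * r \<le> p * r + p * q + q * r + 1"
  obtains "p = q" "q = r" | "r = Suc p" "q = p \<or> q = r" | "p = Suc r" "q = p \<or> q = r"
    | "p = r" "q = Suc p" | "p = r" "p = Suc q"
proof -
  define a b where "a = int p - int q" and "b = int q - int r"
  have "int (p * p + q * q + r * r) \<le> int (p * r + p * q + q * r + 1)"
    using assms by (simp only: of_nat_le_iff)
  then have "int p * int p + int q * int q + int r * int r \<le> int p * int r + int p * int q + int q * int r + 1"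
    by (simp only: of_nat_mult of_nat_add of_nat_1)
  then have "a * a + b * b + (a + b) * (a + b) \<le> 2"
    unfolding a_def b_def by (simp add: algebra_simps)
  moreover have sq: "\<bar>x\<bar> \<le> 1" if "x * x \<le> 2" for x :: int
  proof (rule ccontr)
    assume "\<not> \<bar>x\<bar> \<le> 1"
    then have "2 * 2 \<le> \<bar>x\<bar> * \<bar>x\<bar>" by (intro mult_mono) auto
    then show False using that by simp
  qed
  moreover have "0 \<le> a * a" "0 \<le> b * b" "0 \<le> (a + b) * (a + b)" by simp_all
  ultimately have "\<bar>a\<bar> \<le> 1" "\<bar>b\<bar> \<le> 1" "\<bar>a + b\<bar> \<le> 1" by (smt (verit))+
  then have "p = q \<or> p = Suc q \<or> q = Suc p" "q = r \<or> q = Suc r \<or> r = Suc q"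
    "\<not> (p = Suc q \<and> q = Suc r)" "\<not> (q = Suc p \<and> r = Suc q)"
    unfolding a_def b_def by linarith+
  then show ?thesis using that by blast
qed

lemma kpow_trivial: "(\<And>x. x \<in> kpow n \<Longrightarrow> x = (0 :: nat \<Rightarrow> 'k::field)) \<Longrightarrow> n = 0"
proof (rule ccontr)
  assume *: "\<And>x. x \<in> kpow n \<Longrightarrow> x = (0 :: nat \<Rightarrow> 'k)" and "n \<noteq> 0"
  then show False using *[of "evec 0"] by simp
qed

text \<open>Defect -1. The Euler form is 1, so X is rigid and has an injective pencil, as has the
  listed representation of the same dimension vector; such representations are isomorphic.\<close>

lemma preprojective_case:
  fixes X :: "('k::alg_closed_field, vertex, arrow) std_rep"
  assumes X: "coord_rep Q1 X n" and b: "brick Q1 X"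
    and def: "n v_e = Suc (n v_b)" and mid: "n v_mid = n v_b \<or> n v_mid = n v_e"
  shows "rep_iso Q1 X (listed (if n v_mid = n v_b then E3 (n v_b) else E2 (n v_b)))"
proof -
  let ?l = "if n v_mid = n v_b then E3 (n v_b) else E2 (n v_b)"
  have "(\<Sum>v\<in>UNIV. n v * n v) = (\<Sum>a\<in>UNIV. n (src Q1 a) * n (tgt Q1 a)) + 1"
    unfolding sum_vertex sum_arrow using def mid by auto
  then have "rigid Q1 X" by (rule brick_imp_rigid[OF X b])
  then have iX: "pencil_injective X n"
    using rigid_pencil_injective[OF X] def mid by auto
  have "label_dim ?l = n"
    using def mid by (auto simp: fun_eq_iff split: vertex.split)
  then have Y: "coord_rep Q1 (listed ?l :: ('k, vertex, arrow) std_rep) n"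
    using coord_rep_listed[of ?l] by simp
  have "pencil_injective (listed ?l :: ('k, vertex, arrow) std_rep) (label_dim ?l)"
    using pencil_injective_listed[of "n v_b"] by (cases "n v_mid = n v_b") (simp_all del: listed.simps label_dim.simps)
  then have iY: "pencil_injective (listed ?l :: ('k, vertex, arrow) std_rep) n"
    using \<open>label_dim ?l = n\<close> by simp
  show ?thesis by (rule pencil_injective_iso[OF X Y iX iY def mid])
qed

text \<open>The dual of X has defect -1 and is already classified; dualising that isomorphism and
  using the double dual returns to X.\<close>

lemma preinjective_case:
  fixes X :: "('k::alg_closed_field, vertex, arrow) std_rep"
  assumes X: "coord_rep Q1 X n" and b: "brick Q1 X"
    and def: "n v_b = Suc (n v_e)" and mid: "n v_mid = n v_b \<or> n v_mid = n v_e"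
  shows "\<exists>l. rep_iso Q1 X (listed l :: ('k, vertex, arrow) std_rep)"
proof -
  let ?D = "dual_rep X n" and ?d = "\<lambda>v. n (opp v)"
  note D = coord_rep_dual[of X n]
  define l where "l = (if n v_mid = n v_e then E3 (n v_e) else E2 (n v_e))"
  have iso: "rep_iso Q1 ?D (listed l :: ('k, vertex, arrow) std_rep)"
    using preprojective_case[OF D brick_dual[OF X b]] def mid unfolding l_def by auto
  have "rep_iso Q1 X (dual_rep (listed l) (label_dim l))"
    by (rule rep_iso_trans[OF rep_iso_dual_dual[OF X] rep_iso_dual[OF D coord_rep_listed iso]])
  moreover have "\<exists>l'. rep_iso Q1 (dual_rep (listed l) (label_dim l)) (listed l' :: ('k, vertex, arrow) std_rep)"
    using dual_listed[of "n v_e"] unfolding l_def by (cases "n v_mid = n v_e") (auto simp del: listed.simps label_dim.simps)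
  ultimately show ?thesis using rep_iso_trans by blast
qed

text \<open>Equal dimensions at b and e make \<gamma> invertible, so the triangle of arrows can be
  traversed in a circle.\<close>

lemma regular_endomorphism:
  fixes X :: "('k::field, vertex, arrow) std_rep"
  assumes X: "coord_rep Q1 X n" and rig: "rigid Q1 X" and b: "brick Q1 X" and eq: "n v_b = n v_e"
  obtains \<delta> c where "lin (n v_e) (n v_b) \<delta>" "\<And>y. y \<in> kpow (n v_e) \<Longrightarrow> mp X b_to_e (\<delta> y) = y"
    "\<And>x. x \<in> kpow (n v_b) \<Longrightarrow> \<delta> (mp X mid_to_e (mp X b_to_mid x)) = fscale c x"
    "\<And>x. x \<in> kpow (n v_mid) \<Longrightarrow> mp X b_to_mid (\<delta> (mp X mid_to_e x)) = fscale c x"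
proof -
  let ?\<alpha> = "mp X b_to_mid" and ?\<beta> = "mp X mid_to_e" and ?\<gamma> = "mp X b_to_e"
  note \<gamma> = coord_rep_Q1_lin(1)[OF X] and \<alpha> = coord_rep_Q1_lin(2)[OF X] and \<beta> = coord_rep_Q1_lin(3)[OF X]
  have inj: "inj_on ?\<gamma> (kpow (n v_b))"
    using rigid_arrow_injective[OF X rig, of b_to_e] eq by (intro lin_kernel_trivial(1)[OF \<gamma>]) simp
  have surj: "?\<gamma> ` kpow (n v_b) = kpow (n v_e)"
    using rigid_arrow_surjective[OF X rig, of b_to_e] eq by simp
  define \<delta> where "\<delta> = inv_into (kpow (n v_b)) ?\<gamma>"
  have \<delta>: "lin (n v_e) (n v_b) \<delta>"
    unfolding \<delta>_def by (rule linear_between_inv_into[OF vector_space_fscale subspace_kpow \<gamma> inj surj])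
  have \<gamma>\<delta>: "?\<gamma> (\<delta> y) = y" if "y \<in> kpow (n v_e)" for y
    unfolding \<delta>_def using that surj by (simp add: f_inv_into_f)
  have \<delta>\<gamma>: "\<delta> (?\<gamma> x) = x" if "x \<in> kpow (n v_b)" for x
    unfolding \<delta>_def using inv_into_f_f[OF inj that] .
  \<comment> \<open>One turn around the triangle from each vertex, using \<delta> to go back from e
    to b. Turning commutes with every arrow, so h is an endomorphism and acts by one scalar
    c.\<close>
  define h where "h = (\<lambda>v. case v of v_b \<Rightarrow> (\<lambda>x. \<delta> (?\<beta> (?\<alpha> x))) | v_mid \<Rightarrow> (\<lambda>x. ?\<alpha> (\<delta> (?\<beta> x))) | v_e \<Rightarrow> (\<lambda>x. ?\<beta> (?\<alpha> (\<delta> x))))"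
  note comp = linear_between_compose
  have "is_hom Q1 X X h"
    unfolding is_hom_def coord_repD(2,3)[OF X] all_vertex all_arrow
    using comp[OF comp[OF \<alpha> \<beta>] \<delta>] comp[OF comp[OF \<beta> \<delta>] \<alpha>] comp[OF comp[OF \<delta> \<alpha>] \<beta>]
    by (simp add: h_def \<gamma>\<delta> \<delta>\<gamma> lin_in[OF \<alpha>] lin_in[OF \<beta>])
  then obtain c where c: "\<And>v x. x \<in> kpow (n v) \<Longrightarrow> h v x = fscale c x"
    using b unfolding brick_def coord_repD(2,3)[OF X] by blast
  have "\<delta> (?\<beta> (?\<alpha> x)) = fscale c x" if "x \<in> kpow (n v_b)" for x
    using c[OF that] by (simp add: h_def)
  moreover have "?\<alpha> (\<delta> (?\<beta> x)) = fscale c x" if "x \<in> kpow (n v_mid)" for x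
    using c[OF that] by (simp add: h_def)
  ultimately show ?thesis using that[OF \<delta> \<gamma>\<delta>] by blast
qed

text \<open>For dimensional reasons \<beta> kills a nonzero vector, which forces c = 0, so \<alpha>
  \<delta> \<beta> = 0. As \<alpha> and \<delta> are injective, \<beta> = 0; but \<beta> is onto, so
  the space at e vanishes.\<close>

lemma regular_case_M:
  fixes X :: "('k::field, vertex, arrow) std_rep"
  assumes X: "coord_rep Q1 X n" and rig: "rigid Q1 X" and b: "brick Q1 X"
    and eq: "n v_b = n v_e" and mid: "n v_mid = Suc (n v_b)"
  shows "rep_iso Q1 X (listed M)"
proof -
  let ?\<alpha> = "mp X b_to_mid" and ?\<beta> = "mp X mid_to_e" and ?\<gamma> = "mp X b_to_e"
  note \<gamma> = coord_rep_Q1_lin(1)[OF X] and \<alpha> = coord_rep_Q1_lin(2)[OF X] and \<beta> = coord_rep_Q1_lin(3)[OF X]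
  obtain \<delta> c where \<delta>: "lin (n v_e) (n v_b) \<delta>" "\<And>y. y \<in> kpow (n v_e) \<Longrightarrow> ?\<gamma> (\<delta> y) = y"
    and c: "\<And>x. x \<in> kpow (n v_mid) \<Longrightarrow> ?\<alpha> (\<delta> (?\<beta> x)) = fscale c x"
    by (rule regular_endomorphism[OF X rig b eq]) blast
  have injA: "x = 0" if "x \<in> kpow (n v_b)" "?\<alpha> x = 0" for x
    using rigid_arrow_injective[OF X rig, of b_to_mid x] that mid by simp
  have surjB: "?\<beta> ` kpow (n v_mid) = kpow (n v_e)"
    using rigid_arrow_surjective[OF X rig, of mid_to_e] eq mid by simp
  obtain x where x: "x \<in> kpow (n v_mid)" "?\<beta> x = 0" "x \<noteq> 0"
    using lin_inj_le[OF \<beta>] eq mid by (metis Suc_n_not_le_n)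
  have "fscale c x = 0" using c[OF x(1)] x(2) lin_zero[OF \<delta>(1)] lin_zero[OF \<alpha>] by simp
  then have c0: "c = 0" using x(3) by simp
  have "?\<beta> x = 0" if x: "x \<in> kpow (n v_mid)" for x
  proof -
    have \<beta>x: "?\<beta> x \<in> kpow (n v_e)" by (rule lin_in[OF \<beta> x])
    have "\<delta> (?\<beta> x) = 0" using injA[OF lin_in[OF \<delta>(1) \<beta>x]] c[OF x] c0 by simp
    then show ?thesis using \<delta>(2)[OF \<beta>x] lin_zero[OF \<gamma>] by simp
  qed
  then have "n v_e = 0" using surjB kpow_trivial by (metis imageE)
  then have n: "n v_b = 0" "n v_mid = 1" "n v_e = 0" using eq mid by simp_all
  then have "n = label_dim M" by (auto simp: fun_eq_iff split: vertex.split)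
  then have Y: "coord_rep Q1 (listed M :: ('k, vertex, arrow) std_rep) n" using coord_rep_listed[of M] by simp
  show ?thesis
  proof (rule rep_iso_of_agreement[OF X Y])
    fix a and x :: "nat \<Rightarrow> 'k" assume x: "x \<in> kpow (n (src Q1 a))"
    \<comment> \<open>Every arrow starts or ends in the zero space, so the structure maps have no
      choice.\<close>
    have "mp X a x \<in> kpow (n (tgt Q1 a))" "mp (listed M) a x \<in> kpow (n (tgt Q1 a))"
      using lin_in[OF coord_repD(4)[OF X] x] lin_in[OF coord_repD(4)[OF Y] x] .
    moreover have "mp X a 0 = 0" "mp (listed M :: ('k, vertex, arrow) std_rep) a 0 = 0"
      using lin_zero[OF coord_repD(4)[OF X]] lin_zero[OF coord_repD(4)[OF Y]] .
    ultimately show "mp X a x = mp (listed M) a x"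
      using x by (cases a) (simp_all add: n kpow_0 del: listed.simps)
  qed
qed

text \<open>The mirror image: \<alpha> kills a nonzero vector, so c = 0 and \<beta> \<alpha> = 0. As
  \<beta> is injective, \<alpha> = 0; but \<alpha> is onto, so the space at mid vanishes.\<close>

lemma regular_case_M':
  fixes X :: "('k::field, vertex, arrow) std_rep"
  assumes X: "coord_rep Q1 X n" and rig: "rigid Q1 X" and b: "brick Q1 X"
    and eq: "n v_b = n v_e" and mid: "n v_b = Suc (n v_mid)"
  shows "rep_iso Q1 X (listed M')"
proof -
  let ?\<alpha> = "mp X b_to_mid" and ?\<beta> = "mp X mid_to_e" and ?\<gamma> = "mp X b_to_e"
  note \<gamma> = coord_rep_Q1_lin(1)[OF X] and \<alpha> = coord_rep_Q1_lin(2)[OF X] and \<beta> = coord_rep_Q1_lin(3)[OF X]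
  obtain \<delta> c where \<delta>: "lin (n v_e) (n v_b) \<delta>" "\<And>y. y \<in> kpow (n v_e) \<Longrightarrow> ?\<gamma> (\<delta> y) = y"
    and c: "\<And>x. x \<in> kpow (n v_b) \<Longrightarrow> \<delta> (?\<beta> (?\<alpha> x)) = fscale c x"
    by (rule regular_endomorphism[OF X rig b eq]) blast
  have injB: "x = 0" if "x \<in> kpow (n v_mid)" "?\<beta> x = 0" for x
    using rigid_arrow_injective[OF X rig, of mid_to_e x] that eq mid by simp
  have surjA: "?\<alpha> ` kpow (n v_b) = kpow (n v_mid)"
    using rigid_arrow_surjective[OF X rig, of b_to_mid] mid by simp
  obtain x where x: "x \<in> kpow (n v_b)" "?\<alpha> x = 0" "x \<noteq> 0"
    using lin_inj_le[OF \<alpha>] mid by (metis Suc_n_not_le_n)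
  have "fscale c x = 0" using c[OF x(1)] x(2) lin_zero[OF \<delta>(1)] lin_zero[OF \<beta>] by simp
  then have c0: "c = 0" using x(3) by simp
  have \<alpha>0: "?\<alpha> x = 0" if x: "x \<in> kpow (n v_b)" for x
  proof -
    have \<alpha>x: "?\<alpha> x \<in> kpow (n v_mid)" by (rule lin_in[OF \<alpha> x])
    have "?\<gamma> (\<delta> (?\<beta> (?\<alpha> x))) = 0" using c[OF x] c0 lin_zero[OF \<gamma>] by simp
    then have "?\<beta> (?\<alpha> x) = 0" using \<delta>(2)[OF lin_in[OF \<beta> \<alpha>x]] by simp
    then show ?thesis by (rule injB[OF \<alpha>x])
  qed
  have "n v_mid = 0" using \<alpha>0 surjA kpow_trivial by (metis imageE)
  then have n: "n v_b = 1" "n v_mid = 0" "n v_e = 1" using eq mid by simp_all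
  then have "n = label_dim M'" by (auto simp: fun_eq_iff split: vertex.split)
  then have Y: "coord_rep Q1 (listed M' :: ('k, vertex, arrow) std_rep) n" using coord_rep_listed[of M'] by simp
  \<comment> \<open>Only the bijection \<gamma> between lines is left; applying it at b turns it
    into the identity of \<open>M'\<close>.\<close>
  define h where "h = (\<lambda>v. case v of v_b \<Rightarrow> ?\<gamma> | _ \<Rightarrow> (\<lambda>x. x))"
  have kz: "x = 0" if "x \<in> kpow 0" for x :: "nat \<Rightarrow> 'k" using that kpow_0 by blast
  have h: "is_hom Q1 X (listed M') h"
    unfolding is_hom_def coord_repD(2,3)[OF X] coord_repD(2,3)[OF Y] all_vertex all_arrow
    using \<gamma> \<alpha>0 lin_zero[OF \<beta>] linear_between_id by (auto simp: h_def n dest!: kz)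
  have "bij_betw (h v) (sp X v) (sp (listed M' :: ('k, vertex, arrow) std_rep) v)" for v
  proof (cases v)
    case v_b
    have "inj_on ?\<gamma> (kpow (n v_b))"
      using rigid_arrow_injective[OF X rig, of b_to_e] eq by (intro lin_kernel_trivial(1)[OF \<gamma>]) simp
    moreover have "?\<gamma> ` kpow (n v_b) = kpow (n v_e)"
      using rigid_arrow_surjective[OF X rig, of b_to_e] eq by simp
    ultimately show ?thesis
      unfolding bij_betw_def coord_repD(3)[OF X] coord_repD(3)[OF Y] using v_b eq by (simp add: h_def)
  qed (simp_all add: coord_repD(3)[OF X] coord_repD(3)[OF Y] h_def bij_betw_def del: listed.simps)
  then show ?thesis by (rule bij_hom_imp_rep_iso[OF coord_repD(1)[OF X] h])
qed

lemma exceptional_classification: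
  fixes X :: "('k::alg_closed_field, vertex, arrow) std_rep"
  assumes X: "coord_rep Q1 X n" and exc: "exceptional Q1 X"
  shows "\<exists>l. rep_iso Q1 X (listed l :: ('k, vertex, arrow) std_rep)"
proof -
  have b: "brick Q1 X" and rig: "rigid Q1 X" using exc exceptional_coord_iff[OF X] by auto
  have "n v_b * n v_b + n v_mid * n v_mid + n v_e * n v_e
      \<le> n v_b * n v_e + n v_b * n v_mid + n v_mid * n v_e + 1"
    using brick_euler_form_le[OF X b] unfolding sum_vertex sum_arrow by simp
  then show ?thesis
  proof (cases rule: euler_form_le_one_cases)
    case 1
    then have inj: "pencil_injective X n" by (intro rigid_pencil_injective[OF X rig]) simp_all
    obtain v where "n v > 0" using brick_nonzero[OF X b] by blast
    then have ev: "evec 0 \<in> kpow (n v)" by simp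
    \<comment> \<open>X as a subrepresentation of itself would have smaller dimension at b than at
      e, although the two are equal.\<close>
    have "fs.dim (kpow (n v_b) :: (nat \<Rightarrow> 'k) set) < fs.dim (kpow (n v_e) :: (nat \<Rightarrow> 'k) set)"
      by (rule pencil_injective_subrep[OF X inj, of "\<lambda>v. kpow (n v)", OF _ _ _ ev evec_nonzero])
        (simp_all add: lin_in[OF coord_repD(4)[OF X]])
    then show ?thesis using 1 by simp
  next
    case 2
    then show ?thesis using preprojective_case[OF X b] by blast
  next
    case 3
    then show ?thesis using preinjective_case[OF X b] by blast
  next
    case 4
    then show ?thesis using regular_case_M[OF X rig b] by blast
  next
    case 5
    then show ?thesis using regular_case_M'[OF X rig b] by blast
  qed
qed

theorem proposition2p2:
  shows "(\<forall>l. is_rep Q1 (listed l :: ('k::alg_closed_field, vertex, arrow) std_rep) \<and>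
              exceptional Q1 (listed l :: ('k, vertex, arrow) std_rep)) \<and>
         (\<forall>l l'. rep_iso Q1 (listed l :: ('k, vertex, arrow) std_rep)
                            (listed l' :: ('k, vertex, arrow) std_rep) \<longrightarrow> l = l') \<and>
         (\<forall>X :: ('k, vertex, arrow, 'v::ab_group_add) rep. is_rep Q1 X \<longrightarrow>
            (exceptional Q1 X \<longleftrightarrow>
             (\<exists>l. rep_iso Q1 X (listed l :: ('k, vertex, arrow) std_rep))))"
proof (intro conjI allI impI)
  fix l
  show rep: "is_rep Q1 (listed l :: ('k, vertex, arrow) std_rep)" by (rule coord_repD(1)[OF coord_rep_listed])
  show "exceptional Q1 (listed l :: ('k, vertex, arrow) std_rep)" by (rule exceptional_listed)
next
  fix l l' assume "rep_iso Q1 (listed l :: ('k, vertex, arrow) std_rep) (listed l' :: ('k, vertex, arrow) std_rep)"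
  then show "l = l'" by (rule rep_iso_listed_eq)
next
  fix X :: "('k, vertex, arrow, 'v) rep"
  assume X: "is_rep Q1 X"
  show "exceptional Q1 X \<longleftrightarrow> (\<exists>l. rep_iso Q1 X (listed l :: ('k, vertex, arrow) std_rep))"
  proof
    assume exc: "exceptional Q1 X"
    obtain Y n where Y: "coord_rep Q1 Y n" "rep_iso Q1 X Y" by (rule coord_rep_exists[OF X])
    have "exceptional Q1 Y" by (rule exceptional_iso[OF X coord_repD(1)[OF Y(1)] Y(2) exc])
    then obtain l where "rep_iso Q1 Y (listed l :: ('k, vertex, arrow) std_rep)"
      using exceptional_classification[OF Y(1)] by blast
    then show "\<exists>l. rep_iso Q1 X (listed l :: ('k, vertex, arrow) std_rep)"
      using rep_iso_trans[OF Y(2)] by blast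
  next
    assume "\<exists>l. rep_iso Q1 X (listed l :: ('k, vertex, arrow) std_rep)"
    then obtain l where "rep_iso Q1 X (listed l :: ('k, vertex, arrow) std_rep)" by blast
    then show "exceptional Q1 X"
      by (rule exceptional_iso[OF coord_repD(1)[OF coord_rep_listed] X rep_iso_sym exceptional_listed])
  qed
qed

end
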